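(* Let $k\ge1$ and $\diamond\in\{\prec,\succ,\prec',\succ'\}^k$, and let $S_\diamond(x_1,\dots,x_{k-1})$ be the generating function of admissible matchings of $G_\diamond$ that can be obtained from the minimal matching $\mathfrak{m}_\diamond$ by a finite sequence of flips, where the exponent of $x_i$ is the number of flips at abscissa $\frac32 i$ in a sequence of minimal length. Then $$S_\diamond(x_1,\dots,x_{k-1})=\prod_{\substack{i<j\\ \diamond_i\in\{\prec,\prec'\}\\ \diamond_j\in\{\succ,\succ'\}}}\left(1+\epsilon_{i,j}x_ix_{i+1}\cdots x_{j-1}\right)^{\epsilon_{i,j}},$$ where $\epsilon_{i,j}=1$ if $(\diamond_i,\diamond_j)\in\{(\prec,\succ'),(\prec',\succ)\}$ and $\epsilon_{i,j}=-1$ if $(\diamond_i,\diamond_j)\in\{(\prec,\succ),(\prec',\succ')\}$.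
   Context: The graph $G_\diamond$: vertex set $V=\bigcup_{j=0}^kV_j\cup\bigcup_{j=1}^kW_j$, $V_j=\{(\frac32j,y):y\in\mathbb{Z}+\frac{j+1}{2}\}$, $W_j=\{(\frac32j-1,y):y\in\mathbb{Z}+\frac{j+1}{2}\}$ if $\diamond_j\in\{\prec,\succ\}$ and $W_j=\{(\frac32j-\frac12,y):y\in\mathbb{Z}+\frac j2\}$ if $\diamond_j\in\{\prec',\succ'\}$; edges join vertices differing by $(1,0)$, $(\frac12,\frac12)$ or $(\frac12,-\frac12)$ (straight-line plane embedding). $Y_0=0$, $Y_j=Y_{j-1}+\frac12$ if $\diamond_j\in\{\prec,\succ'\}$, $Y_j=Y_{j-1}-\frac12$ if $\diamond_j\in\{\prec',\succ\}$. Matchings (sets of disjoint edges) considered cover all of $V\setminus(V_0\cup V_k)$; a vertex is matched to the left (right) if it is matched to a vertex with smaller (larger) abscissa, or is uncovered and lies in $V_0$ (resp. $V_k$). Admissible: for each $j$, the number of vertices of $V_j$ above ordinate $Y_j$ matched to the left is finite and equals the number of vertices of $V_j$ below $Y_j$ matched to the right. The minimal matching $\mathfrak{m}_\diamond$ is the admissible matching in which, for every $j$, the vertices of $V_j$ matched to the left are exactly those with ordinate $<Y_j$. Flip: if a bounded face bordered by $2p$ edges has $p$ of them in the matching, replace them by the other $p$ edges of the face. Every bounded face has exactly two of its vertices in a single $V_j$; the abscissa of a flip of that face is $\frac32 j$.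
   Formalization: Edges only join a vertex of some V_i to a vertex of some W_j; read literally, W_j and W_{j+1} would also be joined by (1,0) when the j-th symbol is primed and the next is not, and the formula would fail, e.g. for (≺′,≻), where S=1 but the product is 1+x_1. *)

theory Defs
  imports "HOL-Analysis.Analysis" "HOL-Library.Poly_Mapping"
begin

section \<open>Formal power series in the variables \<open>x\<^sub>0, x\<^sub>1, x\<^sub>2, \<dots>\<close>\<close>

text \<open>
  A monomial is a finitely supported exponent vector of type \<open>nat \<Rightarrow>\<^sub>0 nat\<close>; a series is an
  arbitrary family of coefficients indexed by monomials.
\<close>

typedef 'a mps = "UNIV :: ((nat \<Rightarrow>\<^sub>0 nat) \<Rightarrow> 'a) set"
  morphisms mps_coeff Abs_mps ..

lemma mps_coeff_Abs [simp]: "mps_coeff (Abs_mps f) = f"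
  by (simp add: Abs_mps_inverse)

lemma mps_eqI: "(\<And>m. mps_coeff f m = mps_coeff g m) \<Longrightarrow> f = g"
  by (metis ext mps_coeff_inject)

lemma finite_monomial_le:
  fixes m :: "nat \<Rightarrow>\<^sub>0 nat"
  shows "finite {a :: nat \<Rightarrow>\<^sub>0 nat. \<forall>i. Poly_Mapping.lookup a i \<le> Poly_Mapping.lookup m i}"
proof (rule finite_imageD)
  define B where "B = {..Max (insert 0 (Poly_Mapping.lookup m ` Poly_Mapping.keys m))}"
  have le: "Poly_Mapping.lookup m i \<in> B" if "i \<in> Poly_Mapping.keys m" for i
    using that by (auto simp: B_def intro!: Max_ge)
  show "finite (Poly_Mapping.lookup ` {a. \<forall>i. Poly_Mapping.lookup a i \<le> Poly_Mapping.lookup m i})"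
  proof (rule finite_subset)
    show "Poly_Mapping.lookup ` {a. \<forall>i. Poly_Mapping.lookup a i \<le> Poly_Mapping.lookup m i} \<subseteq>
        {f. \<forall>i. (i \<in> Poly_Mapping.keys m \<longrightarrow> f i \<in> B) \<and> (i \<notin> Poly_Mapping.keys m \<longrightarrow> f i = 0)}"
    proof (clarsimp, intro conjI impI)
      fix a :: "nat \<Rightarrow>\<^sub>0 nat" and i assume *: "\<forall>i. Poly_Mapping.lookup a i \<le> Poly_Mapping.lookup m i"
      show "Poly_Mapping.lookup a i \<in> B" if "i \<in> Poly_Mapping.keys m"
        using le[OF that] *[rule_format, of i] by (auto simp: B_def)
      show "Poly_Mapping.lookup a i = 0" if "i \<notin> Poly_Mapping.keys m"
        using *[rule_format, of i] that by (simp add: in_keys_iff)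
    qed
    show "finite {f. \<forall>i. (i \<in> Poly_Mapping.keys m \<longrightarrow> f i \<in> B) \<and> (i \<notin> Poly_Mapping.keys m \<longrightarrow> f i = 0)}"
      by (rule finite_set_of_finite_funs) (auto simp: B_def)
  qed
  show "inj_on Poly_Mapping.lookup {a. \<forall>i. Poly_Mapping.lookup a i \<le> Poly_Mapping.lookup m i}"
    by (simp add: inj_on_def lookup_inject)
qed

definition monomial_splits :: "(nat \<Rightarrow>\<^sub>0 nat) \<Rightarrow> ((nat \<Rightarrow>\<^sub>0 nat) \<times> (nat \<Rightarrow>\<^sub>0 nat)) set" where
  "monomial_splits m = {(a, b). a + b = m}"

lemma finite_monomial_splits [simp]: "finite (monomial_splits m)"
proof (rule finite_subset)
  let ?S = "{a :: nat \<Rightarrow>\<^sub>0 nat. \<forall>i. Poly_Mapping.lookup a i \<le> Poly_Mapping.lookup m i}"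
  show "monomial_splits m \<subseteq> ?S \<times> ?S"
    by (auto simp: monomial_splits_def lookup_add)
  show "finite (?S \<times> ?S)"
    using finite_monomial_le by blast
qed

instantiation mps :: (comm_ring_1) comm_ring_1
begin

definition "0 = Abs_mps (\<lambda>m. 0)"
definition "1 = Abs_mps (\<lambda>m. if m = 0 then 1 else 0)"
definition "f + g = Abs_mps (\<lambda>m. mps_coeff f m + mps_coeff g m)"
definition "f - g = Abs_mps (\<lambda>m. mps_coeff f m - mps_coeff g m)"
definition "- f = Abs_mps (\<lambda>m. - mps_coeff f m)"
definition "f * g = Abs_mps (\<lambda>m. \<Sum>(a, b)\<in>monomial_splits m. mps_coeff f a * mps_coeff g b)"

instance
proof
  fix f g h :: "'a mps"
  show "f + g + h = f + (g + h)" "f + g = g + f" "0 + f = f" "- f + f = 0" "f - g = f + - g"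
    by (auto simp: plus_mps_def zero_mps_def minus_mps_def uminus_mps_def algebra_simps
        intro: mps_eqI)
  show "(0 :: 'a mps) \<noteq> 1"
  proof
    assume "(0 :: 'a mps) = 1"
    then have "mps_coeff (0 :: 'a mps) 0 = mps_coeff 1 0" by simp
    then show False by (simp add: zero_mps_def one_mps_def)
  qed
  show "f * g = g * f"
    unfolding times_mps_def
    by (rule mps_eqI, simp,
        rule sum.reindex_bij_witness[where i = prod.swap and j = prod.swap])
       (auto simp: monomial_splits_def algebra_simps)
  show "(f + g) * h = f * h + g * h"
    by (rule mps_eqI) (simp add: times_mps_def plus_mps_def case_prod_beta
        distrib_right sum.distrib)
  show "1 * f = f"
  proof (rule mps_eqI)
    fix m
    have "mps_coeff (1 * f) m = (\<Sum>p\<in>monomial_splits m. if p = (0, m) then mps_coeff f m else 0)"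
      unfolding times_mps_def one_mps_def mps_coeff_Abs
      by (rule sum.cong) (auto simp: monomial_splits_def split: if_splits)
    also have "\<dots> = mps_coeff f m"
      by (subst sum.delta[OF finite_monomial_splits]) (auto simp: monomial_splits_def)
    finally show "mps_coeff (1 * f) m = mps_coeff f m" .
  qed
  show "f * g * h = f * (g * h)"
  proof (rule mps_eqI)
    fix m
    let ?c = "\<lambda>a b c. mps_coeff f a * mps_coeff g b * mps_coeff h c"
    have "mps_coeff (f * g * h) m =
        (\<Sum>p\<in>monomial_splits m. \<Sum>q\<in>monomial_splits (fst p). ?c (fst q) (snd q) (snd p))"
      by (simp add: times_mps_def case_prod_beta sum_distrib_right)
    also have "\<dots> = (\<Sum>(p, q)\<in>Sigma (monomial_splits m) (\<lambda>p. monomial_splits (fst p)).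
        ?c (fst q) (snd q) (snd p))"
      by (rule sum.Sigma) auto
    also have "\<dots> = (\<Sum>(p, q)\<in>Sigma (monomial_splits m) (\<lambda>p. monomial_splits (snd p)).
        ?c (fst p) (fst q) (snd q))"
      by (rule sum.reindex_bij_witness[where
            i = "\<lambda>((a, n), (b, c)). ((a + b, c), (a, b))" and
            j = "\<lambda>((n, c), (a, b)). ((a, b + c), (b, c))"])
         (auto simp: monomial_splits_def add.assoc)
    also have "\<dots> =
        (\<Sum>p\<in>monomial_splits m. \<Sum>q\<in>monomial_splits (snd p). ?c (fst p) (fst q) (snd q))"
      by (rule sum.Sigma[symmetric]) auto
    also have "\<dots> = mps_coeff (f * (g * h)) m"
      by (simp add: times_mps_def case_prod_beta sum_distrib_left mult.assoc)
    finally show "mps_coeff (f * g * h) m = mps_coeff (f * (g * h)) m" .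
  qed
qed

end

instantiation mps :: (comm_ring_1) inverse
begin

definition "inverse f = (if \<exists>g. f * g = 1 then THE g. f * g = 1 else (0 :: 'a mps))"
definition "f div g = f * inverse (g :: 'a mps)"

instance ..

end

lemma mps_inverse_eqI: "f * g = 1 \<Longrightarrow> inverse f = (g :: 'a :: comm_ring_1 mps)"
  unfolding inverse_mps_def
  by (auto intro!: the_equality) (metis mult.commute mult.left_commute mult_1_right)

definition mps_var :: "nat \<Rightarrow> 'a :: comm_ring_1 mps" where
  "mps_var i = Abs_mps (\<lambda>m. if m = Poly_Mapping.single i 1 then 1 else 0)"


section \<open>The graph\<close>

datatype diamond = Prec | Succ | Prec' | Succ'

text \<open>
  A word \<open>\<diamond> \<in> {\<prec>, \<succ>, \<prec>', \<succ>'}\<^sup>k\<close> is represented by a function \<open>d :: nat \<Rightarrow> diamond\<close>, of which only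
  the values at \<open>1, \<dots>, k\<close> are ever used.
\<close>

type_synonym point = "real \<times> real"
type_synonym edge = "point set"

definition V_col :: "nat \<Rightarrow> point set" where
  "V_col j = {(3/2 * real j, y) | y. y - (real j + 1) / 2 \<in> \<int>}"

definition W_col :: "(nat \<Rightarrow> diamond) \<Rightarrow> nat \<Rightarrow> point set" where
  "W_col d j =
    (if d j \<in> {Prec, Succ}
     then {(3/2 * real j - 1, y) | y. y - (real j + 1) / 2 \<in> \<int>}
     else {(3/2 * real j - 1/2, y) | y. y - real j / 2 \<in> \<int>})"

definition verts :: "nat \<Rightarrow> (nat \<Rightarrow> diamond) \<Rightarrow> point set" where
  "verts k d = (\<Union>j\<in>{0..k}. V_col j) \<union> (\<Union>j\<in>{1..k}. W_col d j)"

text \<open>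
  The graph is bipartite between the \<open>V\<close>-columns and the \<open>W\<close>-columns. The requirement that an edge
  respect this bipartition only matters when \<open>\<diamond>\<^sub>j\<close> is primed and \<open>\<diamond>\<^bsub>j+1\<^esub>\<close> is not: then points of
  \<open>W\<^sub>j\<close> and \<open>W\<^bsub>j+1\<^esub>\<close> also differ by \<open>(1, 0)\<close>, but joining them would cut the square faces centred on
  the line of abscissa \<open>3/2 j\<close> into triangles with a single vertex in \<open>V\<^sub>j\<close>.
\<close>

definition edges :: "nat \<Rightarrow> (nat \<Rightarrow> diamond) \<Rightarrow> edge set" where
  "edges k d = {{u, v} | u v.
     u \<in> verts k d \<and> v \<in> verts k d \<and>
     v - u \<in> {(1, 0), (1/2, 1/2), (1/2, - (1/2))} \<and>
     (u \<in> (\<Union>j\<in>{0..k}. V_col j) \<longleftrightarrow> v \<in> (\<Union>j\<in>{1..k}. W_col d j))}"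

fun Y_ord :: "(nat \<Rightarrow> diamond) \<Rightarrow> nat \<Rightarrow> real" where
  "Y_ord d 0 = 0"
| "Y_ord d (Suc j) = (if d (Suc j) \<in> {Prec, Succ'} then Y_ord d j + 1/2 else Y_ord d j - 1/2)"

text \<open>The segment representing an edge is the convex hull of its two endpoints.\<close>

definition drawing :: "nat \<Rightarrow> (nat \<Rightarrow> diamond) \<Rightarrow> point set" where
  "drawing k d = verts k d \<union> (\<Union>e\<in>edges k d. convex hull e)"

definition bounded_faces :: "nat \<Rightarrow> (nat \<Rightarrow> diamond) \<Rightarrow> point set set" where
  "bounded_faces k d = {F \<in> components (- drawing k d). bounded F}"

definition face_edges :: "nat \<Rightarrow> (nat \<Rightarrow> diamond) \<Rightarrow> point set \<Rightarrow> edge set" where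
  "face_edges k d F = {e \<in> edges k d. convex hull e \<subseteq> frontier F}"

definition face_verts :: "nat \<Rightarrow> (nat \<Rightarrow> diamond) \<Rightarrow> point set \<Rightarrow> point set" where
  "face_verts k d F = verts k d \<inter> frontier F"

definition face_abscissa :: "nat \<Rightarrow> (nat \<Rightarrow> diamond) \<Rightarrow> point set \<Rightarrow> real" where
  "face_abscissa k d F = 3/2 * real (THE j. j \<le> k \<and> card (face_verts k d F \<inter> V_col j) = 2)"


section \<open>Matchings\<close>

definition is_matching :: "nat \<Rightarrow> (nat \<Rightarrow> diamond) \<Rightarrow> edge set \<Rightarrow> bool" where
  "is_matching k d M \<longleftrightarrow>
     M \<subseteq> edges k d \<and> pairwise disjnt M \<and> verts k d - (V_col 0 \<union> V_col k) \<subseteq> \<Union>M"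

definition matched_left :: "edge set \<Rightarrow> point \<Rightarrow> bool" where
  "matched_left M v \<longleftrightarrow> (\<exists>w. {v, w} \<in> M \<and> fst w < fst v) \<or> (v \<notin> \<Union>M \<and> v \<in> V_col 0)"

definition matched_right :: "nat \<Rightarrow> edge set \<Rightarrow> point \<Rightarrow> bool" where
  "matched_right k M v \<longleftrightarrow> (\<exists>w. {v, w} \<in> M \<and> fst w > fst v) \<or> (v \<notin> \<Union>M \<and> v \<in> V_col k)"

definition admissible :: "nat \<Rightarrow> (nat \<Rightarrow> diamond) \<Rightarrow> edge set \<Rightarrow> bool" where
  "admissible k d M \<longleftrightarrow> is_matching k d M \<and>
     (\<forall>j\<in>{0..k}.
        let L = {v \<in> V_col j. snd v > Y_ord d j \<and> matched_left M v};
            R = {v \<in> V_col j. snd v < Y_ord d j \<and> matched_right k M v}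
        in finite L \<and> finite R \<and> card L = card R)"

definition min_matching :: "nat \<Rightarrow> (nat \<Rightarrow> diamond) \<Rightarrow> edge set" where
  "min_matching k d = (THE M. admissible k d M \<and>
     (\<forall>j\<in>{0..k}. \<forall>v\<in>V_col j. matched_left M v \<longleftrightarrow> snd v < Y_ord d j))"


section \<open>Flips\<close>

definition flip :: "nat \<Rightarrow> (nat \<Rightarrow> diamond) \<Rightarrow> point set \<Rightarrow> edge set \<Rightarrow> edge set \<Rightarrow> bool" where
  "flip k d F M M' \<longleftrightarrow> F \<in> bounded_faces k d \<and>
     (\<exists>p. card (face_edges k d F) = 2 * p \<and> card (M \<inter> face_edges k d F) = p) \<and>
     M' = (M - face_edges k d F) \<union> (face_edges k d F - M)"

text \<open>A sequence of flips is recorded as the list of the faces that are flipped.\<close>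

fun flip_seq :: "nat \<Rightarrow> (nat \<Rightarrow> diamond) \<Rightarrow> edge set \<Rightarrow> point set list \<Rightarrow> edge set \<Rightarrow> bool" where
  "flip_seq k d M [] M' \<longleftrightarrow> M' = M"
| "flip_seq k d M (F # Fs) M' \<longleftrightarrow> (\<exists>M1. flip k d F M M1 \<and> flip_seq k d M1 Fs M')"

definition flip_reachable :: "nat \<Rightarrow> (nat \<Rightarrow> diamond) \<Rightarrow> edge set set" where
  "flip_reachable k d = {M. admissible k d M \<and> (\<exists>Fs. flip_seq k d (min_matching k d) Fs M)}"

definition min_flip_seq :: "nat \<Rightarrow> (nat \<Rightarrow> diamond) \<Rightarrow> edge set \<Rightarrow> point set list \<Rightarrow> bool" where
  "min_flip_seq k d M Fs \<longleftrightarrow> flip_seq k d (min_matching k d) Fs M \<and>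
     (\<forall>Gs. flip_seq k d (min_matching k d) Gs M \<longrightarrow> length Fs \<le> length Gs)"

definition flip_monomial :: "nat \<Rightarrow> (nat \<Rightarrow> diamond) \<Rightarrow> point set list \<Rightarrow> (nat \<Rightarrow>\<^sub>0 nat)" where
  "flip_monomial k d Fs = (\<Sum>i\<in>{1..<k}. Poly_Mapping.single i
     (length (filter (\<lambda>F. face_abscissa k d F = 3/2 * real i) Fs)))"

definition is_exponent :: "nat \<Rightarrow> (nat \<Rightarrow> diamond) \<Rightarrow> edge set \<Rightarrow> (nat \<Rightarrow>\<^sub>0 nat) \<Rightarrow> bool" where
  "is_exponent k d M m \<longleftrightarrow> (\<exists>Fs. min_flip_seq k d M Fs \<and> flip_monomial k d Fs = m)"

definition exponent :: "nat \<Rightarrow> (nat \<Rightarrow> diamond) \<Rightarrow> edge set \<Rightarrow> (nat \<Rightarrow>\<^sub>0 nat)" where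
  "exponent k d M = (THE m. is_exponent k d M m)"

definition S_series :: "nat \<Rightarrow> (nat \<Rightarrow> diamond) \<Rightarrow> int mps" where
  "S_series k d = Abs_mps (\<lambda>m. int (card {M \<in> flip_reachable k d. exponent k d M = m}))"

definition eps :: "diamond \<Rightarrow> diamond \<Rightarrow> int" where
  "eps a b = (if (a, b) \<in> {(Prec, Succ'), (Prec', Succ)} then 1 else - 1)"

end

theory Submission
  imports Defs
begin

text \<open>
  The matchings reachable from the minimal one are encoded by height functions on the faces. The height of
  the face between the \<open>(n-1)\<close>-st and \<open>n\<close>-th vertex of \<open>V\<^sub>j\<close> is the number of vertices of \<open>V\<^sub>j\<close> from the \<open>n\<close>-th
  upwards that are matched to the left. Column \<open>j\<close> is thus the Maya diagram of a partition \<open>\<lambda>\<^sup>j\<close>, consecutive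
  partitions interlace as prescribed by \<open>\<diamond>\<^sub>j\<close>, and \<open>\<lambda>\<^sup>0 = \<lambda>\<^sup>k = \<emptyset>\<close>. A flip changes a single height by one, and
  from any non-minimal height function some height can be lowered, so in a shortest sequence the number of
  flips at abscissa \<open>3j/2\<close> is \<open>|\<lambda>\<^sup>j|\<close>.

  The sequences of partitions are counted by commuting the steps, which is done bijectively: for fixed
  neighbours \<open>\<lambda>\<close> and \<open>\<mu>\<close>, the intermediate partitions of an up-step followed by a down-step correspond to pairs
  of an intermediate partition of the exchanged steps and a number \<open>n\<close>, which is arbitrary if the types agree
  and at most \<open>1\<close> if they differ, and \<open>|\<nu>| + |\<kappa>| = |\<lambda>| + |\<mu>| + n\<close>. Once every down-step precedes every up-step,
  only the constant sequence is left, so a sequence amounts to one such number for every pair of an up-step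
  and a later down-step.
\<close>

text \<open>Faces are given topologically, as bounded components of the complement of the drawing,
  so the plane has to be cut into explicit convex cells before any combinatorics applies. Measuring
  indices from \<open>Y_ord\<close> makes the ground state look the same in every column, and the
  four strip types then differ only in a small index shift. Heights make all conditions linear:
  nonnegative edge values express interlacing and the matching property at once, and a flip adds one
  vector of signs. A flip only requires half of the edges of the face to be present; that these
  alternate has to be deduced. The obstacle to monotone lowering is that neighbouring columns may
  block each other, which a potential with a tie-breaking term rules out. The monomial of a pair
  arises because the exchange identity for areas is linear: spreading the number attached to
  \<open>(i, j)\<close> evenly over the columns \<open>i, ..., j - 1\<close> satisfies the same
  identity, so areas and loads agree by induction. Working with bijections throughout keeps every
  coefficient a cardinality.\<close>

declare Y_ord.simps(2) [simp del]

section \<open>Generating functions of weighted sets\<close>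

definition gen_fun :: "'s set \<Rightarrow> ('s \<Rightarrow> (nat \<Rightarrow>\<^sub>0 nat)) \<Rightarrow> int mps" where
  "gen_fun S w = Abs_mps (\<lambda>m. int (card {s \<in> S. w s = m}))"

text \<open>Since \<open>card\<close> is 0 on infinite sets, \<open>gen_fun\<close> is an honest
  count only for finite fibres. The condition is carried through all constructions and finally
  yields the finiteness claim of the theorem.\<close>

definition fin_fibers :: "'s set \<Rightarrow> ('s \<Rightarrow> (nat \<Rightarrow>\<^sub>0 nat)) \<Rightarrow> bool" where
  "fin_fibers S w \<longleftrightarrow> (\<forall>m. finite {s \<in> S. w s = m})"

definition mono_mps :: "(nat \<Rightarrow>\<^sub>0 nat) \<Rightarrow> int mps" where
  "mono_mps v = Abs_mps (\<lambda>m. if m = v then 1 else 0)"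

definition smul :: "nat \<Rightarrow> (nat \<Rightarrow>\<^sub>0 nat) \<Rightarrow> (nat \<Rightarrow>\<^sub>0 nat)" where
  "smul n v = (\<Sum>_<n. v)"

lemma smul_simps [simp]: "smul 0 v = 0" "smul (Suc n) v = v + smul n v"
  by (simp_all add: smul_def add.commute del: sum_constant)

lemma lookup_smul: "Poly_Mapping.lookup (smul n v) l = n * Poly_Mapping.lookup v l"
  by (induction n) (auto simp: lookup_add)

lemma bij_betw_fiber:
  assumes "bij_betw f S T" "\<And>s. s \<in> S \<Longrightarrow> w' (f s) = w s"
  shows "bij_betw f {s \<in> S. w s = m} {t \<in> T. w' t = m}"
  using assms unfolding bij_betw_def inj_on_def by (auto simp: image_iff)

lemma gen_fun_bij:
  assumes "bij_betw f S T" "\<And>s. s \<in> S \<Longrightarrow> w' (f s) = w s"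
  shows "gen_fun S w = gen_fun T w'"
  unfolding gen_fun_def using bij_betw_same_card[OF bij_betw_fiber[where w = w and w' = w', OF assms]] by simp

lemma fin_fibers_bij:
  assumes "bij_betw f S T" "\<And>s. s \<in> S \<Longrightarrow> w' (f s) = w s"
  shows "fin_fibers S w \<longleftrightarrow> fin_fibers T w'"
  unfolding fin_fibers_def using bij_betw_finite[OF bij_betw_fiber[where w = w and w' = w', OF assms]] by simp

text \<open>A fibre over \<open>m\<close> is sorted by the way \<open>m\<close> splits between the
  two factors, which is the shape of the Cauchy product of series.\<close>

lemma fiber_Times:
  "bij_betw (\<lambda>(s, t). ((w s, w' t), (s, t))) {p \<in> S \<times> T. w (fst p) + w' (snd p) = m}
     (SIGMA ab:monomial_splits m. {s \<in> S. w s = fst ab} \<times> {t \<in> T. w' t = snd ab})"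
  by (rule bij_betw_byWitness[where f' = snd]) (auto simp: monomial_splits_def)

lemma fin_fibers_Times:
  assumes "fin_fibers S w" "fin_fibers T w'"
  shows "fin_fibers (S \<times> T) (\<lambda>p. w (fst p) + w' (snd p))"
  unfolding fin_fibers_def
proof
  fix m
  have "finite (SIGMA ab:monomial_splits m. {s \<in> S. w s = fst ab} \<times> {t \<in> T. w' t = snd ab})"
    using assms by (auto simp: fin_fibers_def intro!: finite_SigmaI)
  then show "finite {p \<in> S \<times> T. w (fst p) + w' (snd p) = m}"
    using bij_betw_finite[OF fiber_Times] by blast
qed

lemma gen_fun_Times:
  assumes "fin_fibers S w" "fin_fibers T w'"
  shows "gen_fun (S \<times> T) (\<lambda>p. w (fst p) + w' (snd p)) = gen_fun S w * gen_fun T w'"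
proof (rule mps_eqI)
  fix m
  have "card {p \<in> S \<times> T. w (fst p) + w' (snd p) = m} =
     card (SIGMA ab:monomial_splits m. {s \<in> S. w s = fst ab} \<times> {t \<in> T. w' t = snd ab})"
    by (rule bij_betw_same_card[OF fiber_Times])
  also have "\<dots> = (\<Sum>ab\<in>monomial_splits m. card {s \<in> S. w s = fst ab} * card {t \<in> T. w' t = snd ab})"
    using assms by (subst card_SigmaI) (auto simp: fin_fibers_def card_cartesian_product)
  finally show "mps_coeff (gen_fun (S \<times> T) (\<lambda>p. w (fst p) + w' (snd p))) m = mps_coeff (gen_fun S w * gen_fun T w') m"
    by (simp add: gen_fun_def times_mps_def case_prod_beta)
qed

lemma gen_fun_singleton: "gen_fun {s} w = mono_mps (w s)"
  unfolding gen_fun_def mono_mps_def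
proof (rule arg_cong[where f = Abs_mps], rule ext)
  fix m
  have "{t \<in> {s}. w t = m} = (if m = w s then {s} else {})" by auto
  then show "int (card {t \<in> {s}. w t = m}) = (if m = w s then 1 else 0)" by simp
qed

lemma gen_fun_insert:
  assumes "s \<notin> S" "fin_fibers S w"
  shows "gen_fun (insert s S) w = mono_mps (w s) + gen_fun S w"
proof (rule mps_eqI)
  fix m
  have "{t \<in> insert s S. w t = m} = (if m = w s then insert s {t \<in> S. w t = m} else {t \<in> S. w t = m})"
    by auto
  then show "mps_coeff (gen_fun (insert s S) w) m = mps_coeff (mono_mps (w s) + gen_fun S w) m"
    using assms by (simp add: gen_fun_def mono_mps_def plus_mps_def fin_fibers_def)
qed

lemma fin_fibers_finite: "finite S \<Longrightarrow> fin_fibers S w"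
  by (simp add: fin_fibers_def)

lemma mono_mps_0: "mono_mps 0 = 1"
  by (simp add: mono_mps_def one_mps_def)

lemma mono_mps_mult: "mono_mps u * mono_mps v = mono_mps (u + v)"
  using gen_fun_Times[of "{()}" "\<lambda>_. u" "{()}" "\<lambda>_. v"]
  by (simp add: fin_fibers_finite gen_fun_singleton)

lemma mps_var_mono: "mps_var i = mono_mps (Poly_Mapping.single i 1)"
  by (simp add: mps_var_def mono_mps_def)

lemma prod_mps_var: "finite I \<Longrightarrow> (\<Prod>l\<in>I. mps_var l) = mono_mps (\<Sum>l\<in>I. Poly_Mapping.single l 1)"
  by (induction I rule: finite_induct)
     (simp_all add: mono_mps_0 mono_mps_mult mps_var_mono)

lemma gen_fun_two: "gen_fun {0, 1} (\<lambda>n. smul n v) = 1 + mono_mps v"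
  by (simp add: gen_fun_insert gen_fun_singleton fin_fibers_finite mono_mps_0 insert_commute)

lemma smul_inj: "v \<noteq> 0 \<Longrightarrow> smul n v = smul n' v \<Longrightarrow> n = n'"
proof -
  assume "v \<noteq> 0" and eq: "smul n v = smul n' v"
  then obtain l where "Poly_Mapping.lookup v l \<noteq> 0" by (metis lookup_zero poly_mapping_eqI)
  then show "n = n'" using arg_cong[OF eq, of "\<lambda>u. Poly_Mapping.lookup u l"] by (simp add: lookup_smul)
qed

lemma fin_fibers_smul:
  assumes "v \<noteq> 0"
  shows "fin_fibers (A :: nat set) (\<lambda>n. smul n v)"
  unfolding fin_fibers_def
proof
  fix m
  have "\<exists>a. {n \<in> A. smul n v = m} \<subseteq> {a}"
    using smul_inj[OF assms] by blast
  then show "finite {n \<in> A. smul n v = m}" by (meson finite.emptyI finite_insert finite_subset)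
qed

text \<open>Splitting off \<open>n = 0\<close> gives \<open>G = 1 + mono_mps v * G\<close>. For
  \<open>v = 0\<close> all numbers would fall into one infinite fibre.\<close>

lemma gen_fun_geometric:
  assumes "v \<noteq> 0"
  shows "gen_fun UNIV (\<lambda>n. smul n v) = inverse (1 - mono_mps v)"
proof -
  let ?G = "gen_fun UNIV (\<lambda>n. smul n v)"
  have "?G = gen_fun (insert 0 (range Suc)) (\<lambda>n. smul n v)"
    by (rule arg_cong[where f = "\<lambda>S. gen_fun S _"]) (metis UNIV_nat_eq)
  also have "\<dots> = 1 + gen_fun (range Suc) (\<lambda>n. smul n v)"
    using fin_fibers_smul[OF assms] by (subst gen_fun_insert) (auto simp: mono_mps_0)
  \<comment> \<open>The common summand \<open>v\<close> is treated as the weight of a one-point set,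
    so that the product rule can extract it.\<close>
  also have "gen_fun (range Suc) (\<lambda>n. smul n v) = gen_fun ({()} \<times> UNIV) (\<lambda>p. v + smul (snd p) v)"
    by (rule gen_fun_bij[symmetric, where f = "\<lambda>p. Suc (snd p)"]) (auto simp: bij_betw_def inj_on_def image_iff)
  also have "\<dots> = mono_mps v * ?G"
    using gen_fun_Times[of "{()}" "\<lambda>_. v" "UNIV" "\<lambda>n. smul n v"] fin_fibers_smul[OF assms]
    by (simp add: fin_fibers_finite gen_fun_singleton)
  finally have "(1 - mono_mps v) * ?G = 1" by (simp add: algebra_simps)
  then show ?thesis by (rule mps_inverse_eqI[symmetric])
qed

text \<open>The value 0 outside \<open>P\<close> gives every family of choices on \<open>P\<close>
  exactly one representative.\<close>

definition Fill :: "'p set \<Rightarrow> ('p \<Rightarrow> nat set) \<Rightarrow> ('p \<Rightarrow> nat) set" where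
  "Fill P A = {a. (\<forall>p\<in>P. a p \<in> A p) \<and> (\<forall>p. p \<notin> P \<longrightarrow> a p = 0)}"

text \<open>Both claims go through one induction, because the product rule needs the finite fibres
  of the smaller set of fillings.\<close>

lemma gen_fun_Fill_aux:
  assumes "finite P" "\<And>p. p \<in> P \<Longrightarrow> v p \<noteq> 0"
  shows "gen_fun (Fill P A) (\<lambda>a. \<Sum>p\<in>P. smul (a p) (v p)) = (\<Prod>p\<in>P. gen_fun (A p) (\<lambda>n. smul n (v p))) \<and>
    fin_fibers (Fill P A) (\<lambda>a. \<Sum>p\<in>P. smul (a p) (v p))"
  using assms
proof (induction P rule: finite_induct)
  case empty
  have "Fill {} A = {\<lambda>_. 0}" by (auto simp: Fill_def)
  then show ?case by (simp add: gen_fun_singleton mono_mps_0 fin_fibers_finite)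
next
  case (insert p P)
  let ?w = "\<lambda>P a. \<Sum>p\<in>P. smul (a p) (v p)"
  let ?f = "\<lambda>x. (snd x)(p := fst x)"
  have bij: "bij_betw ?f (A p \<times> Fill P A) (Fill (insert p P) A)"
    by (rule bij_betw_byWitness[where f' = "\<lambda>a. (a p, a(p := 0))"])
       (use insert.hyps in \<open>auto simp: Fill_def fun_eq_iff\<close>)
  have w: "?w (insert p P) (?f x) = smul (fst x) (v p) + ?w P (snd x)" for x
    using insert.hyps by (auto intro!: sum.cong)
  have IH: "gen_fun (Fill P A) (?w P) = (\<Prod>p\<in>P. gen_fun (A p) (\<lambda>n. smul n (v p)))" "fin_fibers (Fill P A) (?w P)"
    using insert by auto
  have F: "fin_fibers (A p) (\<lambda>n. smul n (v p))"
    by (rule fin_fibers_smul) (use insert.prems in auto)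
  have "gen_fun (Fill (insert p P) A) (?w (insert p P)) =
        gen_fun (A p \<times> Fill P A) (\<lambda>x. smul (fst x) (v p) + ?w P (snd x))"
    by (rule gen_fun_bij[symmetric, OF bij]) (rule w)
  also have "\<dots> = gen_fun (A p) (\<lambda>n. smul n (v p)) * gen_fun (Fill P A) (?w P)"
    by (rule gen_fun_Times[OF F IH(2)])
  finally have 1: "gen_fun (Fill (insert p P) A) (?w (insert p P)) = (\<Prod>p\<in>insert p P. gen_fun (A p) (\<lambda>n. smul n (v p)))"
    using insert.hyps IH by simp
  have "fin_fibers (Fill (insert p P) A) (?w (insert p P))"
    using fin_fibers_bij[OF bij, of "?w (insert p P)", OF w] fin_fibers_Times[OF F IH(2)] by blast
  with 1 show ?case by blast
qed

lemmas gen_fun_Fill = gen_fun_Fill_aux[THEN conjunct1] and fin_fibers_Fill = gen_fun_Fill_aux[THEN conjunct2]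

section \<open>Profiles\<close>

text \<open>
  In column \<open>j\<close> call a vertex a particle if it is matched to the left, and give the vertex of ordinate
  \<open>Y\<^sub>j + n + 1/2\<close> the index \<open>n\<close>. A profile \<open>h\<close> counts particles: \<open>h y\<close> is the number of particles of index
  at least \<open>y\<close>, so that \<open>h y - h (y + 1)\<close> is \<open>1\<close> at a particle and \<open>0\<close> at a hole. The value \<open>- y\<close> far below
  encodes that there are as many particles above \<open>Y\<^sub>j\<close> as holes below. Profiles are the Maya diagrams of
  integer partitions, and \<open>area\<close> is the size of the partition.
\<close>

definition ground :: "int \<Rightarrow> int" where
  "ground y = max 0 (- y)"

definition profile :: "(int \<Rightarrow> int) \<Rightarrow> bool" where
  "profile h \<longleftrightarrow> (\<forall>y. h (y + 1) \<le> h y \<and> h y \<le> h (y + 1) + 1) \<and>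
     (\<exists>N. \<forall>y. N \<le> \<bar>y\<bar> \<longrightarrow> h y = ground y)"

definition area :: "(int \<Rightarrow> int) \<Rightarrow> int" where
  "area h = (\<Sum>y | h y \<noteq> ground y. h y - ground y)"

text \<open>
  Across a strip of type \<open>\<prec>'\<close> every particle moves up by \<open>0\<close> or \<open>1\<close>; across a strip of type \<open>\<prec>\<close> every hole
  moves down by \<open>0\<close> or \<open>1\<close>.
\<close>

fun step :: "diamond \<Rightarrow> (int \<Rightarrow> int) \<Rightarrow> (int \<Rightarrow> int) \<Rightarrow> bool" where
  "step Prec a b \<longleftrightarrow> (\<forall>y. a y \<le> b y \<and> b y \<le> a (y + 1) + 1)"
| "step Prec' a b \<longleftrightarrow> (\<forall>y. a y \<le> b y \<and> b y \<le> a (y - 1))"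
| "step Succ a b \<longleftrightarrow> (\<forall>y. b y \<le> a y \<and> a y \<le> b (y + 1) + 1)"
| "step Succ' a b \<longleftrightarrow> (\<forall>y. b y \<le> a y \<and> a y \<le> b (y - 1))"

lemma profileI:
  assumes "\<And>y. h (y + 1) \<le> h y" "\<And>y. h y \<le> h (y + 1) + 1"
    "\<And>y. N \<le> \<bar>y\<bar> \<Longrightarrow> h y = ground y"
  shows "profile h"
  using assms unfolding profile_def by blast

lemma profile_dec: "profile h \<Longrightarrow> h (y + 1) \<le> h y"
  and profile_lip: "profile h \<Longrightarrow> h y \<le> h (y + 1) + 1"
  by (auto simp: profile_def)

lemma profile_dec': "profile h \<Longrightarrow> h y \<le> h (y - 1)"
  and profile_lip': "profile h \<Longrightarrow> h (y - 1) \<le> h y + 1"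
  using profile_dec[of h "y - 1"] profile_lip[of h "y - 1"] by auto

lemma profile_ground: "profile ground"
  by (rule profileI[where N = 0]) (auto simp: ground_def)

lemma profile_antimono: "x \<le> y \<Longrightarrow> profile h \<Longrightarrow> h y \<le> h x"
proof (induction y rule: int_ge_induct)
  case (step i)
  then show ?case using profile_dec[of h i] by auto
qed auto

lemma profile_lipschitz: "x \<le> y \<Longrightarrow> profile h \<Longrightarrow> h x \<le> h y + (y - x)"
proof (induction y rule: int_ge_induct)
  case (step i)
  then show ?case using profile_lip[of h i] by auto
qed auto

lemma profile_bound:
  assumes "profile h"
  obtains N where "N > 0" "\<And>y. N \<le> \<bar>y\<bar> \<Longrightarrow> h y = ground y"
proof -
  obtain N where "\<And>y. N \<le> \<bar>y\<bar> \<Longrightarrow> h y = ground y" using assms by (auto simp: profile_def)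
  then show ?thesis by (intro that[of "max N 1"]) auto
qed

lemma profile_bound2:
  assumes "profile h" "profile h'"
  obtains N where "N > 0" "\<And>y. N \<le> \<bar>y\<bar> \<Longrightarrow> h y = ground y" "\<And>y. N \<le> \<bar>y\<bar> \<Longrightarrow> h' y = ground y"
proof -
  obtain N N' where "N > 0" "\<And>y. N \<le> \<bar>y\<bar> \<Longrightarrow> h y = ground y" "\<And>y. N' \<le> \<bar>y\<bar> \<Longrightarrow> h' y = ground y"
    using assms by (metis profile_bound)
  then show ?thesis by (intro that[of "max N N'"]) auto
qed

text \<open>Towards large indices \<open>h\<close> decreases to 0, and coming from the far left,
  where it is \<open>- y\<close>, it drops by at most 1 per step.\<close>

lemma profile_ge_ground:
  assumes "profile h"
  shows "ground y \<le> h y"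
proof -
  obtain N where N: "N > 0" "\<And>y. N \<le> \<bar>y\<bar> \<Longrightarrow> h y = ground y" using profile_bound[OF assms] by metis
  have "h (max N y) \<le> h y" using profile_antimono[OF _ assms, of y "max N y"] by auto
  moreover have "h (max N y) = 0" using N by (subst N(2)) (auto simp: ground_def)
  moreover have "h (min (-N) y) \<le> h y + (y - min (-N) y)" using profile_lipschitz[OF _ assms, of "min (-N) y" y] by auto
  moreover have "h (min (-N) y) = - min (-N) y" using N by (subst N(2)) (auto simp: ground_def)
  ultimately show ?thesis by (auto simp: ground_def)
qed

text \<open>Any symmetric window that contains all deviations from \<open>ground\<close> gives the
  same sum, so areas of several profiles can be combined termwise over a common window.\<close>

lemma area_window:
  assumes "\<And>y. N \<le> \<bar>y\<bar> \<Longrightarrow> h y = ground y"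
  shows "area h = (\<Sum>y\<in>{-N..N}. h y - ground y)"
  unfolding area_def
proof (rule sum.mono_neutral_left)
  show "{y. h y \<noteq> ground y} \<subseteq> {-N..N}"
  proof
    fix y assume "y \<in> {y. h y \<noteq> ground y}"
    then have "\<not> N \<le> \<bar>y\<bar>" using assms by auto
    then show "y \<in> {-N..N}" by auto
  qed
qed auto

lemma area_nonneg: "profile h \<Longrightarrow> area h \<ge> 0"
  unfolding area_def by (rule sum_nonneg) (use profile_ge_ground in force)

lemma area_ground [simp]: "area ground = 0"
  by (simp add: area_def)

lemma area_upd:
  assumes "profile h" "profile (h(n := v))"
  shows "area (h(n := v)) = area h + v - h n"
proof -
  obtain N where N: "N > 0" "\<And>y. N \<le> \<bar>y\<bar> \<Longrightarrow> h y = ground y" using profile_bound[OF assms(1)] by metis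
  let ?M = "max N (\<bar>n\<bar> + 1)"
  have M: "area h = (\<Sum>y\<in>{-?M..?M}. h y - ground y)"
    by (rule area_window) (use N in auto)
  have "area (h(n := v)) = (\<Sum>y\<in>{-?M..?M}. (h(n := v)) y - ground y)"
    by (rule area_window) (use N in auto)
  also have "\<dots> = (\<Sum>y\<in>{-?M..?M}. (h y - ground y) + (if y = n then v - h n else 0))"
    by (rule sum.cong) auto
  also have "\<dots> = area h + (v - h n)"
    unfolding M sum.distrib by (subst sum.delta) auto
  finally show ?thesis by simp
qed

section \<open>Conjugation\<close>

text \<open>Conjugation of the partition: the diagram is read backwards with particles and holes
  exchanged, index \<open>n\<close> becoming \<open>- n - 1\<close>. It turns primed steps into
  unprimed ones, which saves one of the exchange arguments.\<close>

definition conj_profile :: "(int \<Rightarrow> int) \<Rightarrow> (int \<Rightarrow> int)" where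
  "conj_profile h y = h (- y) - y"

lemma conj_conj [simp]: "conj_profile (conj_profile h) = h"
  by (auto simp: conj_profile_def)

lemma profile_conj_imp: "profile h \<Longrightarrow> profile (conj_profile h)"
proof -
  assume h: "profile h"
  obtain N where N: "N > 0" "\<And>y. N \<le> \<bar>y\<bar> \<Longrightarrow> h y = ground y" using profile_bound[OF h] by metis
  show ?thesis
  proof (rule profileI[where N = N])
    fix y
    show "conj_profile h (y + 1) \<le> conj_profile h y" "conj_profile h y \<le> conj_profile h (y + 1) + 1"
      using profile_dec[OF h, of "- y - 1"] profile_lip[OF h, of "- y - 1"] by (auto simp: conj_profile_def)
    show "conj_profile h y = ground y" if "N \<le> \<bar>y\<bar>"
      using N(2)[of "- y"] that by (auto simp: conj_profile_def ground_def)
  qed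
qed

lemma profile_conj [simp]: "profile (conj_profile h) \<longleftrightarrow> profile h"
  using profile_conj_imp[of h] profile_conj_imp[of "conj_profile h"] by auto

lemma area_conj: "profile h \<Longrightarrow> area (conj_profile h) = area h"
proof -
  assume h: "profile h"
  obtain N where N: "N > 0" "\<And>y. N \<le> \<bar>y\<bar> \<Longrightarrow> h y = ground y" using profile_bound[OF h] by metis
  have "area (conj_profile h) = (\<Sum>y\<in>{-N..N}. conj_profile h y - ground y)"
    by (rule area_window) (use N in \<open>auto simp: conj_profile_def ground_def\<close>)
  also have "\<dots> = (\<Sum>y\<in>{-N..N}. h y - ground y)"
    by (rule sum.reindex_bij_witness[where i = uminus and j = uminus]) (auto simp: conj_profile_def ground_def)
  also have "\<dots> = area h" by (rule area_window[symmetric]) (use N in auto)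
  finally show ?thesis .
qed

lemma step_Prec_conj: "step Prec (conj_profile a) (conj_profile b) \<longleftrightarrow> step Prec' a b"
proof -
  have "(\<forall>y. a (- y) \<le> b (- y) \<and> b (- y) \<le> a (- y - 1)) \<longleftrightarrow> (\<forall>y. a y \<le> b y \<and> b y \<le> a (y - 1))"
    by (metis minus_minus)
  then show ?thesis by (simp add: conj_profile_def algebra_simps)
qed

section \<open>Positions of the particles\<close>

definition positions :: "(nat \<Rightarrow> int) \<Rightarrow> bool" where
  "positions p \<longleftrightarrow> (\<forall>i. p (Suc i) < p i) \<and> (\<exists>N. \<forall>i\<ge>N. p i = - int i - 1)"

text \<open>\<open>p i\<close> is the position of the \<open>i\<close>-th highest particle (counting from \<open>0\<close>), so the parts of the
  partition are \<open>p i + i + 1\<close>.\<close>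

definition galois :: "(int \<Rightarrow> int) \<Rightarrow> (nat \<Rightarrow> int) \<Rightarrow> bool" where
  "galois h p \<longleftrightarrow> (\<forall>y i. int i < h y \<longleftrightarrow> y \<le> p i)"

lemma positions_ge:
  assumes "positions p"
  shows "p i \<ge> - int i - 1"
proof -
  obtain N where N: "\<And>i. i \<ge> N \<Longrightarrow> p i = - int i - 1" using assms by (auto simp: positions_def)
  have "p i \<ge> p (i + n) + int n" for n
  proof (induction n)
    case (Suc n)
    have "p (Suc (i + n)) < p (i + n)" using assms by (auto simp: positions_def)
    then show ?case using Suc by simp
  qed simp
  from this[of N] N[of "i + N"] show ?thesis by simp
qed

lemma positions_mono:
  assumes "positions p" "i \<le> j"
  shows "p j + int j \<le> p i + int i"
  using assms(2)
proof (induction j rule: dec_induct)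
  case (step n)
  have "p (Suc n) < p n" using assms by (auto simp: positions_def)
  then show ?case using step by simp
qed simp

text \<open>The number of particles at or above \<open>y\<close> is the first \<open>i\<close> with
  \<open>p i < y\<close>, because \<open>p\<close> is decreasing.\<close>

lemma galois_profile_ex:
  assumes p: "positions p"
  shows "\<exists>h. profile h \<and> galois h p"
proof -
  obtain N where N: "\<And>i. i \<ge> N \<Longrightarrow> p i = - int i - 1" using assms by (auto simp: positions_def)
  define h where "h y = int (LEAST i. p i < y)" for y
  have ex: "\<exists>i. p i < y" for y
    using N[of "N + nat (- y)"] by (intro exI[of _ "N + nat (- y)"]) auto
  have L1: "p (LEAST i. p i < y) < y" for y using LeastI_ex[OF ex] .
  have anti: "p j \<le> p i" if "i \<le> j" for i j
    using positions_mono[OF p that] that by auto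
  have gal: "int i < h y \<longleftrightarrow> y \<le> p i" for i y
  proof
    assume "int i < h y"
    then show "y \<le> p i" unfolding h_def using not_less_Least[of i "\<lambda>i. p i < y"] by auto
  next
    assume *: "y \<le> p i"
    show "int i < h y"
    proof (rule ccontr)
      assume "\<not> int i < h y"
      then have "p i \<le> p (LEAST i. p i < y)" unfolding h_def by (intro anti) auto
      with L1[of y] * show False by auto
    qed
  qed
  have h0: "h y \<ge> 0" for y by (simp add: h_def)
  have le_iff: "h y \<le> z \<longleftrightarrow> (0 \<le> z \<and> p (nat z) < y)" for y z
    using gal[of "nat z" y] h0[of y] by auto
  have ge_iff: "h y \<ge> z \<longleftrightarrow> (z \<le> 0 \<or> y \<le> p (nat (z - 1)))" for y z
    using gal[of "nat (z - 1)" y] h0[of y] by (cases "z \<le> 0") auto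
  have "profile h"
  proof (rule profileI[where N = "max (int N) (p 0 + 1) + 1"])
    fix y
    show "h (y + 1) \<le> h y" using L1[of y] by (subst le_iff) (auto simp: h_def)
    have "p (Suc (LEAST i. p i < y + 1)) < p (LEAST i. p i < y + 1)" using p by (auto simp: positions_def)
    then show "h y \<le> h (y + 1) + 1"
      using L1[of "y + 1"] by (subst le_iff) (auto simp: h_def nat_add_distrib)
    show "h y = ground y" if *: "max (int N) (p 0 + 1) + 1 \<le> \<bar>y\<bar>"
    proof (cases "y > 0")
      case True
      then have "h y \<le> 0" using * by (subst le_iff) auto
      then show ?thesis using h0[of y] True by (auto simp: ground_def)
    next
      case False
      then have "y \<le> - int N - 1" using * by auto
      then have "h y \<le> - y" "h y \<ge> - y"
        using N[of "nat (- y)"] N[of "nat (- y - 1)"] by (auto simp: le_iff ge_iff)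
      then show ?thesis using False by (auto simp: ground_def)
    qed
  qed
  then show ?thesis using gal unfolding galois_def by blast
qed

text \<open>\<open>p i\<close> is the largest \<open>y\<close> with
  \<open>int i < h y\<close>.\<close>

lemma galois_positions_ex:
  assumes h: "profile h"
  shows "\<exists>p. positions p \<and> galois h p"
proof -
  obtain N where N: "N > 0" "\<And>y. N \<le> \<bar>y\<bar> \<Longrightarrow> h y = ground y" using profile_bound[OF h] by metis
  have ex1: "\<exists>q. \<forall>y. int i < h y \<longleftrightarrow> y \<le> q" for i
  proof -
    \<comment> \<open>The cut at \<open>- N - int i\<close> makes the set finite without losing its
      maximum: there \<open>h\<close> has the value \<open>N + int i\<close>, which already exceeds
      \<open>int i\<close>.\<close>
    let ?S = "{y. int i < h y \<and> y \<ge> - N - int i}"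
    have fin: "finite ?S"
    proof (rule finite_subset)
      show "?S \<subseteq> {- N - int i..N}"
      proof
        fix y assume y: "y \<in> ?S"
        have "\<not> y > N" using N(1) N(2)[of y] y by (auto simp: ground_def)
        then show "y \<in> {- N - int i..N}" using y by auto
      qed
    qed simp
    have low: "int i < h (- N - int i)"
      using N(1) by (subst N(2)) (auto simp: ground_def)
    then have ne: "?S \<noteq> {}" by auto
    have "int i < h y \<longleftrightarrow> y \<le> Max ?S" for y
    proof
      assume "int i < h y"
      show "y \<le> Max ?S"
      proof (cases "y \<ge> - N - int i")
        case True
        then show ?thesis using \<open>int i < h y\<close> fin by (intro Max_ge) auto
      next
        case False
        have "- N - int i \<le> Max ?S" using low fin by (intro Max_ge) auto
        then show ?thesis using False by auto
      qed
    next
      assume "y \<le> Max ?S"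
      then have "h (Max ?S) \<le> h y" using profile_antimono[OF _ h] by blast
      moreover have "int i < h (Max ?S)" using Max_in[OF fin ne] by auto
      ultimately show "int i < h y" by auto
    qed
    then show ?thesis by blast
  qed
  then obtain p where p: "\<And>i y. int i < h y \<longleftrightarrow> y \<le> p i" by metis
  have "p (Suc i) < p i" for i
  proof -
    have "int (Suc i) < h (p (Suc i))" using p[of "Suc i" "p (Suc i)"] by simp
    then have "int i < h (p (Suc i) + 1)" using profile_lip[OF h, of "p (Suc i)"] by simp
    then show ?thesis using p[of i "p (Suc i) + 1"] by auto
  qed
  moreover have "p i = - int i - 1" if "i \<ge> nat N" for i
  proof -
    have "int i < h (- int i - 1)" "\<not> int i < h (- int i)"
      using that N(1) N(2)[of "- int i - 1"] N(2)[of "- int i"] by (auto simp: ground_def)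
    then show ?thesis unfolding p by auto
  qed
  ultimately show ?thesis using p unfolding positions_def galois_def by blast
qed

lemma galois_unique_profile:
  assumes "galois h p" "galois h' p" "profile h" "profile h'"
  shows "h = h'"
proof
  fix y
  have *: "int i < h y \<longleftrightarrow> int i < h' y" for i using assms by (simp add: galois_def)
  have "h y \<ge> 0" "h' y \<ge> 0" using assms profile_ge_ground[of h y] profile_ge_ground[of h' y] by (auto simp: ground_def)
  then show "h y = h' y" using *[of "nat (h y)"] *[of "nat (h' y)"] by auto
qed

lemma galois_unique_positions: "galois h p \<Longrightarrow> galois h p' \<Longrightarrow> p = p'"
  unfolding galois_def by (metis order_antisym order_refl ext)

lemma galois_bij:
  obtains f where "bij_betw f {h. profile h} {p. positions p}" "\<And>h. profile h \<Longrightarrow> galois h (f h)"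
    "\<And>h. profile h \<Longrightarrow> positions (f h)"
proof -
  obtain f where f: "\<And>h. profile h \<Longrightarrow> positions (f h) \<and> galois h (f h)"
    using galois_positions_ex by metis
  have "bij_betw f {h. profile h} {p. positions p}"
    unfolding bij_betw_def inj_on_def
    using f galois_unique_profile galois_unique_positions galois_profile_ex
    by (auto simp: image_iff) metis+
  with f that show ?thesis by blast
qed

text \<open>Double counting of the cells of the Young diagram: \<open>?D i y\<close> says that
  particle \<open>i\<close> has passed site \<open>y\<close> on its way up from its ground position
  \<open>- int i - 1\<close>, which is the cell of content \<open>y\<close> in row \<open>i\<close>.
  Rows sum to the parts, and the cells of content \<open>y\<close> number
  \<open>h y - ground y\<close>.\<close>

lemma area_positions:
  assumes h: "profile h" and p: "positions p" and g: "galois h p" and N: "\<And>i. i \<ge> N \<Longrightarrow> p i = - int i - 1"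
  shows "area h = (\<Sum>i<N. p i + int i + 1)"
proof -
  obtain K where K: "K > 0" "\<And>y. K \<le> \<bar>y\<bar> \<Longrightarrow> h y = ground y" using profile_bound[OF h] by metis
  let ?D = "\<lambda>i y. - int i - 1 < y \<and> y \<le> p i"
  have D: "?D i y \<longleftrightarrow> ground y \<le> int i \<and> int i < h y" for i y
    using g by (auto simp: galois_def ground_def)
  have row: "p i + int i + 1 = (\<Sum>y\<in>{-K..K}. if ?D i y then 1 else 0)" if "i < N" for i
  proof -
    have "y \<in> {-K..K}" if "?D i y" for y
    proof (rule ccontr)
      assume "y \<notin> {-K..K}"
      then have "h y = ground y" by (intro K(2)) auto
      then show False using that unfolding D by auto
    qed
    then have "{y \<in> {-K..K}. ?D i y} = {- int i - 1 <..p i}" by auto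
    moreover have "(\<Sum>y\<in>{-K..K}. if ?D i y then 1 else 0) = int (card {y \<in> {-K..K}. ?D i y})"
      by (subst sum.inter_filter[symmetric]) auto
    ultimately show ?thesis using positions_ge[OF p, of i] by simp
  qed
  have col: "h y - ground y = (\<Sum>i<N. if ?D i y then 1 else 0)" for y
  proof -
    have "i < N" if "?D i y" for i
    proof (rule ccontr)
      assume "\<not> i < N"
      then show False using N[of i] that by auto
    qed
    then have "{i \<in> {..<N}. ?D i y} = {i. ?D i y}" by auto
    also have "\<dots> = {nat (ground y)..<nat (h y)}"
      unfolding D by (auto simp: nat_le_iff zless_nat_eq_int_zless)
    finally have "{i \<in> {..<N}. ?D i y} = {nat (ground y)..<nat (h y)}" .
    moreover have "(\<Sum>i<N. if ?D i y then 1 else 0) = int (card {i \<in> {..<N}. ?D i y})"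
      by (subst sum.inter_filter[symmetric]) auto
    moreover have "0 \<le> ground y" by (simp add: ground_def)
    ultimately show ?thesis using profile_ge_ground[OF h, of y] by (simp add: of_nat_diff nat_mono)
  qed
  have "area h = (\<Sum>y\<in>{-K..K}. h y - ground y)" by (rule area_window) (use K in auto)
  also have "\<dots> = (\<Sum>y\<in>{-K..K}. \<Sum>i<N. if ?D i y then 1 else 0)" using col by simp
  also have "\<dots> = (\<Sum>i<N. \<Sum>y\<in>{-K..K}. if ?D i y then 1 else 0)" by (rule sum.swap)
  also have "\<dots> = (\<Sum>i<N. p i + int i + 1)" using row by (intro sum.cong) auto
  finally show ?thesis .
qed

text \<open>In terms of parts, the right-hand side says that each part of \<open>a\<close> lies
  between two consecutive parts of \<open>b\<close>, so that the skew shape of \<open>b\<close> over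
  \<open>a\<close> is a horizontal strip.\<close>

lemma step_Prec_positions:
  assumes g: "galois a p" "galois b q" and ab: "profile a" "profile b"
  shows "step Prec a b \<longleftrightarrow> (\<forall>i. p i \<le> q i \<and> q (Suc i) < p i)"
proof
  assume s: "step Prec a b"
  show "\<forall>i. p i \<le> q i \<and> q (Suc i) < p i"
  proof
    fix i
    have "int i < a (p i)" using g(1) by (simp add: galois_def)
    also have "a (p i) \<le> b (p i)" using s by simp
    finally have 1: "p i \<le> q i" using g(2) by (simp add: galois_def)
    have "int (Suc i) < b (q (Suc i))" using g(2) by (simp add: galois_def del: of_nat_Suc)
    also have "b (q (Suc i)) \<le> a (q (Suc i) + 1) + 1" using s by simp
    finally have "int i < a (q (Suc i) + 1)" by simp
    then have "q (Suc i) + 1 \<le> p i" using g(1) by (simp add: galois_def)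
    with 1 show "p i \<le> q i \<and> q (Suc i) < p i" by simp
  qed
next
  assume s: "\<forall>i. p i \<le> q i \<and> q (Suc i) < p i"
  have nn: "a y \<ge> 0" "b y \<ge> 0" for y
    using ab profile_ge_ground[of a y] profile_ge_ground[of b y] by (auto simp: ground_def)
  have "a y \<le> b y" for y
  proof (rule ccontr)
    assume "\<not> a y \<le> b y"
    then have "y \<le> p (nat (b y))" using g(1) nn[of y] by (auto simp: galois_def simp flip: g(1)[unfolded galois_def, rule_format])
    also have "\<dots> \<le> q (nat (b y))" using s by simp
    finally have "int (nat (b y)) < b y" using g(2) unfolding galois_def by blast
    then show False using nn[of y] by simp
  qed
  moreover have "b y \<le> a (y + 1) + 1" for y
  proof (rule ccontr)
    let ?i = "nat (a (y + 1))"
    assume "\<not> b y \<le> a (y + 1) + 1"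
    then have "int (Suc ?i) < b y" using nn[of "y + 1"] by auto
    then have "y \<le> q (Suc ?i)" using g(2) by (simp add: galois_def del: of_nat_Suc)
    also have "\<dots> < p ?i" using s by simp
    finally have "int ?i < a (y + 1)" using g(1) unfolding galois_def by (metis zless_imp_add1_zle)
    then show False using nn[of "y + 1"] by simp
  qed
  ultimately show "step Prec a b" by simp
qed

section \<open>Exchanging an up-step and a down-step\<close>

definition ups :: "diamond set" where "ups = {Prec, Prec'}"
definition downs :: "diamond set" where "downs = {Succ, Succ'}"

definition sandwich :: "diamond \<Rightarrow> diamond \<Rightarrow> (int \<Rightarrow> int) \<Rightarrow> (int \<Rightarrow> int) \<Rightarrow> (int \<Rightarrow> int) set" where
  "sandwich a b l m = {h. profile h \<and> step a l h \<and> step b h m}"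

text \<open>The exponents occurring in the expansion of the factor of a pair: \<open>1 + x\<close>
  in one case, the geometric series in the other.\<close>

definition multiplicities :: "diamond \<Rightarrow> diamond \<Rightarrow> nat set" where
  "multiplicities a b = (if eps a b = 1 then {0, 1} else UNIV)"

definition exchange :: "diamond \<Rightarrow> diamond \<Rightarrow> (int \<Rightarrow> int) \<Rightarrow> (int \<Rightarrow> int) \<Rightarrow>
    ((int \<Rightarrow> int) \<Rightarrow> (int \<Rightarrow> int) \<times> nat) \<Rightarrow> bool" where
  "exchange a b l m f \<longleftrightarrow>
     bij_betw f (sandwich a b l m) (sandwich b a l m \<times> multiplicities a b) \<and>
     (\<forall>h\<in>sandwich a b l m. area h + area (fst (f h)) = area l + area m + int (snd (f h)))"

section \<open>Exchange of steps of mixed type\<close>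

lemma sum_telescope_int:
  fixes f :: "int \<Rightarrow> int"
  assumes "a \<le> b"
  shows "(\<Sum>y\<in>{a..b}. f (y + 1) - f y) = f (b + 1) - f a"
  using assms
proof (induction b rule: int_ge_induct)
  case (step i)
  have "{a..i + 1} = insert (i + 1) {a..i}" using step by auto
  then show ?case using step by simp
qed simp

text \<open>One element of \<open>A\<close> is set aside and the others are identified with
  \<open>B\<close>; \<open>n\<close> records whether the element set aside is present.\<close>

lemma bij_Pow_split:
  assumes "finite A" "finite B" "card A = Suc (card B)"
  obtains G where "bij_betw G (Pow B \<times> {0, 1 :: nat}) (Pow A)"
    "\<And>T n. T \<subseteq> B \<Longrightarrow> n \<in> {0, 1} \<Longrightarrow> card (G (T, n)) = card T + n"
proof -
  obtain a where a: "a \<in> A" using assms by fastforce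
  have "card B = card (A - {a})" using assms a by simp
  then obtain g where g: "bij_betw g B (A - {a})"
    using assms finite_same_card_bij[of B "A - {a}"] by auto
  have gi: "inj_on g B" "g ` B = A - {a}" using g by (auto simp: bij_betw_def)
  define G where "G = (\<lambda>(T, n :: nat). g ` T \<union> (if n = 1 then {a} else {}))"
  define G' where "G' = (\<lambda>S. (B \<inter> g -` S, if a \<in> S then 1 else 0 :: nat))"
  have ga: "g x \<noteq> a" "g x \<in> A" if "x \<in> B" for x using gi that by auto
  have "bij_betw G (Pow B \<times> {0, 1}) (Pow A)"
  proof (rule bij_betw_byWitness[where f' = G'])
    show "\<forall>x\<in>Pow B \<times> {0, 1}. G' (G x) = x"
    proof
      fix x assume "x \<in> Pow B \<times> {0, 1 :: nat}"
      then obtain T n where x: "x = (T, n)" "T \<subseteq> B" "n \<in> {0, 1}" by auto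
      have "a \<notin> g ` T" using ga x by auto
      then have "a \<in> G x \<longleftrightarrow> n = 1" by (auto simp: G_def x(1))
      moreover have "b \<in> B \<inter> g -` G x \<longleftrightarrow> b \<in> T" for b
      proof (cases "b \<in> B")
        case True
        then have "g b \<in> g ` T \<longleftrightarrow> b \<in> T" by (rule inj_on_image_mem_iff[OF gi(1) _ x(2)])
        then show ?thesis using True ga(1)[OF True] by (simp add: G_def x(1))
      qed (use x(2) in auto)
      ultimately show "G' (G x) = x" using x(1,3) unfolding G'_def by auto
    qed
    show "\<forall>S\<in>Pow A. G (G' S) = S"
    proof
      fix S assume S: "S \<in> Pow A"
      have "g ` (B \<inter> g -` S) = g ` B \<inter> S" by auto
      then have "g ` (B \<inter> g -` S) = S - {a}" using gi(2) S by auto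
      then show "G (G' S) = S" by (auto simp: G_def G'_def)
    qed
    show "G ` (Pow B \<times> {0, 1}) \<subseteq> Pow A" using ga a by (auto simp: G_def)
    show "G' ` Pow A \<subseteq> Pow B \<times> {0, 1}" by (auto simp: G'_def split: if_splits)
  qed
  moreover have "card (G (T, n)) = card T + n" if "T \<subseteq> B" "n \<in> {0, 1}" for T n
  proof -
    have "card (g ` T) = card T" using gi(1) that inj_on_subset card_image by metis
    moreover have "a \<notin> g ` T" "finite (g ` T)" using ga that assms(2) by (auto intro: finite_subset)
    ultimately show ?thesis using that by (auto simp: G_def)
  qed
  ultimately show ?thesis using that by blast
qed

text \<open>Where \<open>lo\<close> and \<open>hi\<close> differ there are two choices, elsewhere
  one. Both parametrizations are provided because in the area identity the size of the set is added
  to the lower bound on one side of the exchange and subtracted from the upper bound on the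
  other.\<close>

lemma bij_Pow_functions:
  fixes lo hi :: "int \<Rightarrow> int"
  assumes "\<And>y. lo y \<le> hi y" "\<And>y. hi y \<le> lo y + 1"
  shows "bij_betw (\<lambda>S y. lo y + (if y \<in> S then 1 else 0)) (Pow {y. lo y < hi y}) {h. \<forall>y. lo y \<le> h y \<and> h y \<le> hi y}"
    "bij_betw (\<lambda>S y. hi y - (if y \<in> S then 1 else 0)) (Pow {y. lo y < hi y}) {h. \<forall>y. lo y \<le> h y \<and> h y \<le> hi y}"
proof -
  have eq: "lo y = hi y \<or> hi y = lo y + 1" for y using assms[of y] by auto
  show "bij_betw (\<lambda>S y. lo y + (if y \<in> S then 1 else 0)) (Pow {y. lo y < hi y}) {h. \<forall>y. lo y \<le> h y \<and> h y \<le> hi y}"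
  proof (rule bij_betw_byWitness[where f' = "\<lambda>h. {y. lo y < h y}"])
    show "\<forall>h\<in>{h. \<forall>y. lo y \<le> h y \<and> h y \<le> hi y}. (\<lambda>y. lo y + (if y \<in> {y. lo y < h y} then 1 else 0)) = h"
    proof (intro ballI ext)
      fix h y assume "h \<in> {h. \<forall>y. lo y \<le> h y \<and> h y \<le> hi y}"
      then have "lo y \<le> h y \<and> h y \<le> hi y" by auto
      then show "lo y + (if y \<in> {y. lo y < h y} then 1 else 0) = h y" using eq[of y] by auto
    qed
    show "(\<lambda>h. {y. lo y < h y}) ` {h. \<forall>y. lo y \<le> h y \<and> h y \<le> hi y} \<subseteq> Pow {y. lo y < hi y}"
      by (auto intro: less_le_trans)
  qed (use assms in auto)
  show "bij_betw (\<lambda>S y. hi y - (if y \<in> S then 1 else 0)) (Pow {y. lo y < hi y}) {h. \<forall>y. lo y \<le> h y \<and> h y \<le> hi y}"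
  proof (rule bij_betw_byWitness[where f' = "\<lambda>h. {y. h y < hi y}"])
    show "\<forall>h\<in>{h. \<forall>y. lo y \<le> h y \<and> h y \<le> hi y}. (\<lambda>y. hi y - (if y \<in> {y. h y < hi y} then 1 else 0)) = h"
    proof (intro ballI ext)
      fix h y assume "h \<in> {h. \<forall>y. lo y \<le> h y \<and> h y \<le> hi y}"
      then have "lo y \<le> h y \<and> h y \<le> hi y" by auto
      then show "hi y - (if y \<in> {y. h y < hi y} then 1 else 0) = h y" using eq[of y] by auto
    qed
    show "(\<lambda>h. {y. h y < hi y}) ` {h. \<forall>y. lo y \<le> h y \<and> h y \<le> hi y} \<subseteq> Pow {y. lo y < hi y}"
      by (auto intro: le_less_trans)
  qed (use assms in auto)
qed

lemma area_shift:
  assumes "\<And>y. N \<le> \<bar>y\<bar> \<Longrightarrow> h y = ground y" "\<And>y. N \<le> \<bar>y\<bar> \<Longrightarrow> g y = ground y"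
    "\<And>y. h y = g y + c * (if y \<in> S then 1 else 0)" "S \<subseteq> {-N..N}"
  shows "area h = area g + c * int (card S)"
proof -
  have "area h = (\<Sum>y\<in>{-N..N}. (g y - ground y) + c * (if y \<in> S then 1 else 0))"
    using area_window[of N h] assms by (simp add: algebra_simps)
  also have "\<dots> = area g + c * (\<Sum>y\<in>{-N..N}. if y \<in> S then 1 else 0)"
    unfolding sum.distrib sum_distrib_left using area_window[of N g] assms by simp
  also have "(\<Sum>y\<in>{-N..N}. if y \<in> S then 1 else 0) = int (card S)"
    using assms(4) by (simp add: sum.If_cases Int_absorb1)
  finally show ?thesis .
qed

text \<open>For mixed types the admissible heights at different positions are independent choices between at
  most two values. The numbers of free positions on the two sides differ by one, since the difference telescopes.\<close>

lemma exchange_Prec_Succ':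
  assumes l: "profile l" and m: "profile m"
  shows "\<exists>f. exchange Prec Succ' l m f"
proof -
  obtain N where N: "N > 0" "\<And>y. N \<le> \<bar>y\<bar> \<Longrightarrow> l y = ground y" "\<And>y. N \<le> \<bar>y\<bar> \<Longrightarrow> m y = ground y"
    using profile_bound2[OF l m] by metis
  \<comment> \<open>The bounds at \<open>y\<close> involve \<open>l (y + 1)\<close> and
    \<open>m (y - 1)\<close>, so they agree with \<open>ground\<close> only one position further
    out.\<close>
  define K where "K = N + 1"
  define lo hi lo' hi' where "lo y = max (l y) (m y)" and "hi y = min (l (y + 1) + 1) (m (y - 1))"
    and "lo' y = max (l (y + 1)) (m (y - 1) - 1)" and "hi' y = min (l y) (m y)" for y
  note defs = lo_def hi_def lo'_def hi'_def
  have K: "lo y = ground y" "hi y = ground y" "lo' y = ground y" "hi' y = ground y"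
    "l y = ground y" "m y = ground y" if "K \<le> \<bar>y\<bar>" for y
  proof -
    have "l y = ground y" "m y = ground y" "l (y + 1) = ground (y + 1)" "m (y - 1) = ground (y - 1)"
      using that N by (auto simp: K_def)
    then show "lo y = ground y" "hi y = ground y" "lo' y = ground y" "hi' y = ground y"
      "l y = ground y" "m y = ground y"
      using that N(1) by (auto simp: defs K_def ground_def)
  qed
  have bounds: "hi y \<le> lo y + 1" "hi' y \<le> lo' y + 1" for y
    using profile_dec[OF l, of y] profile_lip[OF l, of y] profile_dec'[OF m, of y] profile_lip'[OF m, of y]
    by (auto simp: defs)
  have prof: "profile h" if "\<forall>y. lo y \<le> h y \<and> h y \<le> hi y" for h
  proof (rule profileI[where N = K])
    fix y
    have "lo y \<le> h y" "h y \<le> hi y" "lo (y + 1) \<le> h (y + 1)" "h (y + 1) \<le> hi (y + 1)" using that by auto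
    then show "h (y + 1) \<le> h y" "h y \<le> h (y + 1) + 1" by (auto simp: defs)
    show "h y = ground y" if "K \<le> \<bar>y\<bar>" using K[OF that] \<open>lo y \<le> h y\<close> \<open>h y \<le> hi y\<close> by simp
  qed
  have prof': "profile h" if "\<forall>y. lo' y \<le> h y \<and> h y \<le> hi' y" for h
  proof (rule profileI[where N = K])
    fix y
    have "lo' y \<le> h y" "h y \<le> hi' y" "lo' (y + 1) \<le> h (y + 1)" "h (y + 1) \<le> hi' (y + 1)" using that by auto
    then show "h (y + 1) \<le> h y" "h y \<le> h (y + 1) + 1" by (auto simp: defs)
    show "h y = ground y" if "K \<le> \<bar>y\<bar>" using K[OF that] \<open>lo' y \<le> h y\<close> \<open>h y \<le> hi' y\<close> by simp
  qed
  have steps: "step Prec l h \<and> step Succ' h m \<longleftrightarrow> (\<forall>y. lo y \<le> h y \<and> h y \<le> hi y)" for h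
    by (auto simp: defs)
  have b1: "sandwich Prec Succ' l m = {h. \<forall>y. lo y \<le> h y \<and> h y \<le> hi y}"
    unfolding sandwich_def using steps prof by blast
  have steps': "step Succ' l h \<and> step Prec h m \<longleftrightarrow> (\<forall>y. lo' y \<le> h y \<and> h y \<le> hi' y)" for h
  proof -
    have "(\<forall>y. h y \<le> l y \<and> l y \<le> h (y - 1)) \<longleftrightarrow> (\<forall>y. h y \<le> l y \<and> l (y + 1) \<le> h y)"
      by (metis add_diff_cancel diff_add_cancel)
    moreover have "(\<forall>y. h y \<le> m y \<and> m y \<le> h (y + 1) + 1) \<longleftrightarrow> (\<forall>y. h y \<le> m y \<and> m (y - 1) - 1 \<le> h y)"
      by (metis add_diff_cancel diff_add_cancel diff_le_eq)
    ultimately show ?thesis by (auto simp: defs)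
  qed
  have b2: "sandwich Succ' Prec l m = {h. \<forall>y. lo' y \<le> h y \<and> h y \<le> hi' y}"
    unfolding sandwich_def using steps' prof' by blast
  have mult: "multiplicities Prec Succ' = {0, 1}" by (simp add: multiplicities_def eps_def)
  \<comment> \<open>The nontrivial comparisons on the two sides are the same up to an index shift by
    one; the others hold for all profiles. Hence the two sandwiches are empty simultaneously, and in
    that case any function will do.\<close>
  have ne_iff: "(\<forall>y. lo y \<le> hi y) \<longleftrightarrow> (\<forall>y. lo' y \<le> hi' y)"
  proof -
    have "(\<forall>y. lo y \<le> hi y) \<longleftrightarrow> (\<forall>y. l y \<le> m (y - 1)) \<and> (\<forall>y. m y \<le> l (y + 1) + 1)"
      using profile_lip[OF l] profile_dec'[OF m] by (auto simp: defs)
    also have "\<dots> \<longleftrightarrow> (\<forall>y. l (y + 1) \<le> m y) \<and> (\<forall>y. m (y - 1) - 1 \<le> l y)"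
      by (metis add_diff_cancel diff_add_cancel diff_le_eq)
    also have "\<dots> \<longleftrightarrow> (\<forall>y. lo' y \<le> hi' y)"
      using profile_dec[OF l] profile_lip'[OF m] by (auto simp: defs algebra_simps)
    finally show ?thesis .
  qed
  show ?thesis
  proof (cases "\<forall>y. lo y \<le> hi y")
    case False
    then have "sandwich Prec Succ' l m = {}" "sandwich Succ' Prec l m = {}"
      using ne_iff unfolding b1 b2 by (auto dest: order_trans)
    then show ?thesis by (intro exI[of _ undefined]) (auto simp: exchange_def bij_betw_def)
  next
    case True
    then have le: "\<And>y. lo y \<le> hi y" "\<And>y. lo' y \<le> hi' y" using ne_iff by auto
    let ?A = "{y. lo y < hi y}" and ?B = "{y. lo' y < hi' y}"
    have sub: "?A \<subseteq> {-K..K}" "?B \<subseteq> {-K..K}"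
    proof -
      show "?A \<subseteq> {-K..K}"
      proof
        fix y assume "y \<in> ?A"
        then have "\<not> K \<le> \<bar>y\<bar>" using K(1,2) by force
        then show "y \<in> {-K..K}" by auto
      qed
      show "?B \<subseteq> {-K..K}"
      proof
        fix y assume "y \<in> ?B"
        then have "\<not> K \<le> \<bar>y\<bar>" using K(3,4) by force
        then show "y \<in> {-K..K}" by auto
      qed
    qed
    then have fin: "finite ?A" "finite ?B" by (auto intro: finite_subset)
    have cards: "int (card ?A) = (\<Sum>y\<in>{-K..K}. hi y - lo y)" "int (card ?B) = (\<Sum>y\<in>{-K..K}. hi' y - lo' y)"
    proof -
      have "hi y - lo y = (if y \<in> ?A then 1 else 0)" "hi' y - lo' y = (if y \<in> ?B then 1 else 0)" for y
        using le[of y] bounds[of y] by auto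
      then show "int (card ?A) = (\<Sum>y\<in>{-K..K}. hi y - lo y)" "int (card ?B) = (\<Sum>y\<in>{-K..K}. hi' y - lo' y)"
        using sub by (simp_all add: sum.If_cases Int_absorb1 del: mem_Collect_eq)
    qed
    \<comment> \<open>Maximum and minimum of two numbers add up to their sum, so
      \<open>lo y + hi' y = l y + m y\<close> and
      \<open>hi y + lo' y = l (y + 1) + m (y - 1)\<close>. The boundary terms of the telescoping sum
      are \<open>K\<close> for \<open>l\<close> and \<open>K + 1\<close> for \<open>m\<close>, which
      accounts for the extra free position.\<close>
    have "int (card ?A) - int (card ?B) = (\<Sum>y\<in>{-K..K}. (l (y + 1) - l y) + (m (y - 1) - m y))"
      unfolding cards sum_subtractf[symmetric] by (rule sum.cong) (auto simp: defs)
    also have "\<dots> = (\<Sum>y\<in>{-K..K}. l (y + 1) - l y) - (\<Sum>y\<in>{-K..K}. m (y + 1 - 1) - m (y - 1))"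
      unfolding sum.distrib by (simp add: sum_subtractf)
    also have "\<dots> = l (K + 1) - l (- K) - (m (K + 1 - 1) - m (- K - 1))"
      using N(1) by (subst (1 2) sum_telescope_int) (auto simp: K_def)
    also have "\<dots> = 1"
      using N(1) by (subst (1 2) K(5), simp add: K_def, simp add: K_def, subst (1 2) K(6)) (auto simp: K_def ground_def)
    finally have "card ?A = Suc (card ?B)" by linarith
    from bij_Pow_split[OF fin this] obtain G where G: "bij_betw G (Pow ?B \<times> {0, 1 :: nat}) (Pow ?A)"
      "\<And>T n. T \<subseteq> ?B \<Longrightarrow> n \<in> {0, 1} \<Longrightarrow> card (G (T, n)) = card T + n" by metis
    let ?F1 = "\<lambda>S y. lo y + (if y \<in> S then 1 else 0)" and ?F2 = "\<lambda>S y. hi' y - (if y \<in> S then 1 else 0)"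
    have F1: "bij_betw ?F1 (Pow ?A) (sandwich Prec Succ' l m)"
      unfolding b1 using bij_Pow_functions(1)[of lo hi] le bounds by simp
    have F2: "bij_betw ?F2 (Pow ?B) (sandwich Succ' Prec l m)"
      unfolding b2 using bij_Pow_functions(2)[of lo' hi'] le bounds by simp
    let ?f1 = "inv_into (Pow ?A) ?F1" and ?g = "inv_into (Pow ?B \<times> {0, 1}) G"
    have f1: "bij_betw ?f1 (sandwich Prec Succ' l m) (Pow ?A)" by (rule bij_betw_inv_into[OF F1])
    have g: "bij_betw ?g (Pow ?A) (Pow ?B \<times> {0, 1})" by (rule bij_betw_inv_into[OF G(1)])
    have F3: "bij_betw (map_prod ?F2 id) (Pow ?B \<times> {0, 1}) (sandwich Succ' Prec l m \<times> {0, 1})"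
      by (rule bij_betw_map_prod[OF F2 bij_betw_id])
    let ?f = "map_prod ?F2 id \<circ> (?g \<circ> ?f1)"
    have bij: "bij_betw ?f (sandwich Prec Succ' l m) (sandwich Succ' Prec l m \<times> {0, 1})"
      using bij_betw_trans[OF bij_betw_trans[OF f1 g] F3] by simp
    have "area h + area (fst (?f h)) = area l + area m + int (snd (?f h))" if h: "h \<in> sandwich Prec Succ' l m" for h
    proof -
      define S where "S = ?f1 h"
      obtain T n where Tn: "?g S = (T, n)" by fastforce
      have S: "S \<in> Pow ?A" "?F1 S = h" unfolding S_def
        using bij_betw_apply[OF f1 h] bij_betw_inv_into_right[OF F1 h] by blast+
      have T: "(T, n) \<in> Pow ?B \<times> {0, 1}" "G (T, n) = S"
        using bij_betw_apply[OF g S(1)] bij_betw_inv_into_right[OF G(1) S(1)] unfolding Tn by blast+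
      have "area h = area lo + 1 * int (card S)"
      proof (rule area_shift[where N = K])
        show "h y = ground y" if "K \<le> \<bar>y\<bar>" for y
          using K(1,2)[OF that] h unfolding b1 mem_Collect_eq by (metis order_antisym)
      qed (use S sub K in auto)
      moreover have "area (?F2 T) = area hi' + (- 1) * int (card T)"
      proof (rule area_shift[where N = K])
        have "T \<in> Pow ?B" using T(1) by blast
        then have "?F2 T \<in> sandwich Succ' Prec l m" by (rule bij_betw_apply[OF F2])
        then have "lo' y \<le> ?F2 T y \<and> ?F2 T y \<le> hi' y" for y unfolding b2 by blast
        then show "?F2 T y = ground y" if "K \<le> \<bar>y\<bar>" for y
          using K(3,4)[OF that] by (metis order_antisym)
      qed (use T sub K in auto)
      \<comment> \<open>Here \<open>lo\<close> and \<open>hi'\<close> are the pointwise maximum and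
        minimum of \<open>l\<close> and \<open>m\<close>.\<close>
      moreover have "area lo + area hi' = area l + area m"
      proof -
        have "area lo = (\<Sum>y\<in>{-K..K}. lo y - ground y)" "area hi' = (\<Sum>y\<in>{-K..K}. hi' y - ground y)"
          "area l = (\<Sum>y\<in>{-K..K}. l y - ground y)" "area m = (\<Sum>y\<in>{-K..K}. m y - ground y)"
          by (rule area_window, use K in auto)+
        then show ?thesis unfolding sum.distrib[symmetric]
          by (simp only: sum.distrib[symmetric]) (rule sum.cong, auto simp: defs)
      qed
      moreover have "card S = card T + n" using G(2)[of T n] T by auto
      moreover have "?f h = (?F2 T, n)" using Tn by (simp add: S_def)
      ultimately show ?thesis by simp
    qed
    then show ?thesis using bij unfolding exchange_def mult by (intro exI[of _ ?f] conjI ballI)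
  qed
qed

text \<open>Reading the three columns from right to left turns up-steps into down-steps of the same
  kind, so this is the previous case with \<open>l\<close> and \<open>m\<close>
  interchanged.\<close>

lemma exchange_Prec'_Succ:
  assumes l: "profile l" and m: "profile m"
  shows "\<exists>f. exchange Prec' Succ l m f"
proof -
  obtain f where "exchange Prec Succ' m l f" using exchange_Prec_Succ'[OF m l] by blast
  moreover have "sandwich Prec' Succ l m = sandwich Prec Succ' m l" "sandwich Succ Prec' l m = sandwich Succ' Prec m l"
    "multiplicities Prec' Succ = multiplicities Prec Succ'"
    by (auto simp: sandwich_def multiplicities_def eps_def)
  ultimately have "exchange Prec' Succ l m f" by (auto simp: exchange_def)
  then show ?thesis by blast
qed

section \<open>Exchange of steps of equal type\<close>

lemma positions_eventually:
  assumes "positions p"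
  obtains N where "\<And>i. i \<ge> N \<Longrightarrow> p i = - int i - 1"
  using assms unfolding positions_def by metis

lemma bij_betw_restrict_iff:
  assumes F: "bij_betw F A B" and iff: "\<And>h. h \<in> A \<Longrightarrow> F h \<in> X \<longleftrightarrow> h \<in> S" and sub: "X \<subseteq> B" "S \<subseteq> A"
  shows "bij_betw F S X"
proof -
  have "F ` S = X"
  proof
    show "F ` S \<subseteq> X" using iff sub by auto
    show "X \<subseteq> F ` S"
    proof
      fix x assume x: "x \<in> X"
      then obtain h where "h \<in> A" "x = F h" using F sub unfolding bij_betw_def by blast
      then show "x \<in> F ` S" using iff x by blast
    qed
  qed
  then show ?thesis using bij_betw_subset[OF F sub(2)] by simp
qed

text \<open>For equal types each position is confined to an interval, and reflecting it in that interval
  exchanges the two sides; only the highest particle is unconfined, which gives the factor \<open>n\<close>.\<close>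

lemma exchange_Prec_Succ:
  assumes l: "profile l" and m: "profile m"
  shows "\<exists>f. exchange Prec Succ l m f"
proof -
  obtain F where F: "bij_betw F {h. profile h} {p. positions p}" and Fg: "\<And>h. profile h \<Longrightarrow> galois h (F h)"
    and Fp: "\<And>h. profile h \<Longrightarrow> positions (F h)" using galois_bij by metis
  define p q where "p = F l" and "q = F m"
  have pq: "positions p" "positions q" "galois l p" "galois m q" using Fg Fp l m by (auto simp: p_def q_def)
  define mx mn where "mx i = max (p i) (q i)" and "mn i = min (p i) (q i)" for i
  define X where "X = {r. positions r \<and> (\<forall>i. mx i \<le> r i \<and> r (Suc i) < mn i)}"
  define Y where "Y = {r. positions r \<and> (\<forall>i. r i \<le> mn i \<and> mx (Suc i) < r i)}"
  have XF: "bij_betw F (sandwich Prec Succ l m) X"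
  proof -
    have "F h \<in> X \<longleftrightarrow> h \<in> sandwich Prec Succ l m" if "profile h" for h
    proof -
      have "step Succ h m \<longleftrightarrow> step Prec m h" by simp
      then show ?thesis using that Fg[OF that] Fp[OF that] pq l m
          step_Prec_positions[of l p h "F h"] step_Prec_positions[of m q h "F h"]
        by (auto simp: sandwich_def X_def mx_def mn_def simp del: step.simps)
    qed
    then show ?thesis by (intro bij_betw_restrict_iff[OF F]) (auto simp: X_def sandwich_def)
  qed
  have YF: "bij_betw F (sandwich Succ Prec l m) Y"
  proof -
    have "F h \<in> Y \<longleftrightarrow> h \<in> sandwich Succ Prec l m" if "profile h" for h
    proof -
      have "step Succ l h \<longleftrightarrow> step Prec h l" by simp
      then show ?thesis using that Fg[OF that] Fp[OF that] pq l m
          step_Prec_positions[of h "F h" l p] step_Prec_positions[of h "F h" m q]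
        by (auto simp: sandwich_def Y_def mx_def mn_def simp del: step.simps)
    qed
    then show ?thesis by (intro bij_betw_restrict_iff[OF F]) (auto simp: Y_def sandwich_def)
  qed
  \<comment> \<open>Particle \<open>Suc i\<close> of \<open>r\<close> ranges over
    \<open>{mx (Suc i)..<mn i}\<close> and particle \<open>i\<close> of the other side over
    \<open>{mx (Suc i)<..mn i}\<close>. The reflection exchanges the open and the closed end and
    shifts the particle numbers by one, which leaves particle 0 of \<open>r\<close> over: it is only
    bounded below, by \<open>mx 0\<close>.\<close>
  define T where "T r = (\<lambda>i. mx (Suc i) + mn i - r (Suc i), nat (r 0 - mx 0))" for r :: "nat \<Rightarrow> int"
  define T' where "T' x = (\<lambda>i. case i of 0 \<Rightarrow> mx 0 + int (snd x) | Suc i \<Rightarrow> mx (Suc i) + mn i - fst x i)"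
    for x :: "(nat \<Rightarrow> int) \<times> nat"
  obtain N where N: "\<And>i. i \<ge> N \<Longrightarrow> p i = - int i - 1" "\<And>i. i \<ge> N \<Longrightarrow> q i = - int i - 1"
  proof -
    obtain N1 N2 where "\<And>i. i \<ge> N1 \<Longrightarrow> p i = - int i - 1" "\<And>i. i \<ge> N2 \<Longrightarrow> q i = - int i - 1"
      using positions_eventually pq(1,2) by metis
    then show ?thesis by (intro that[of "max N1 N2"]) auto
  qed
  have mN: "mx i = - int i - 1" "mn i = - int i - 1" if "i \<ge> N" for i
    using N[OF that] by (auto simp: mx_def mn_def)
  have mnx: "mn (Suc i) \<le> mx (Suc i)" "mn i \<le> mx i" for i by (auto simp: mx_def mn_def)
  have T: "bij_betw T X (Y \<times> UNIV)"
  proof (rule bij_betw_byWitness[where f' = T'])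
    show "\<forall>r\<in>X. T' (T r) = r"
      by (auto simp: T'_def T_def X_def fun_eq_iff split: nat.split)
    show "\<forall>x\<in>Y \<times> UNIV. T (T' x) = x"
      by (auto simp: T'_def T_def)
    show "T ` X \<subseteq> Y \<times> UNIV"
    proof (clarsimp simp: T_def)
      fix r assume "r \<in> X"
      then have r: "positions r" "\<And>i. mx i \<le> r i" "\<And>i. r (Suc i) < mn i" by (auto simp: X_def)
      let ?s = "\<lambda>i. mx (Suc i) + mn i - r (Suc i)"
      have s: "?s i \<le> mn i" "mx (Suc i) < ?s i" for i using r(2)[of "Suc i"] r(3)[of i] by auto
      have "?s (Suc i) < ?s i" for i using s(1)[of "Suc i"] s(2)[of i] mnx[of i] by linarith
      moreover have "?s i = - int i - 1" if "i \<ge> N" for i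
        using mN[of i] mN[of "Suc i"] r(2)[of "Suc i"] r(3)[of i] that by auto
      ultimately have "positions ?s" unfolding positions_def by blast
      then show "?s \<in> Y" using s by (auto simp: Y_def)
    qed
    show "T' ` (Y \<times> UNIV) \<subseteq> X"
    proof clarify
      fix s :: "nat \<Rightarrow> int" and n :: nat assume "s \<in> Y"
      then have s: "positions s" "\<And>i. s i \<le> mn i" "\<And>i. mx (Suc i) < s i" by (auto simp: Y_def)
      let ?r = "T' (s, n)"
      have r0: "?r 0 = mx 0 + int n" and rS: "\<And>i. ?r (Suc i) = mx (Suc i) + mn i - s i" by (auto simp: T'_def)
      have r: "mx i \<le> ?r i" "?r (Suc i) < mn i" for i
        using s(2)[of "i - 1"] s(3)[of i] r0 rS[of i] rS[of "i - 1"] by (cases i; auto)+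
      have "?r (Suc i) < ?r i" for i using r(1)[of "i"] r(2)[of i] mnx[of i] by linarith
      moreover have "?r i = - int i - 1" if "i \<ge> Suc N" for i
        using mN[of i] mN[of "i - 1"] s(2)[of "i - 1"] s(3)[of "i - 1"] rS[of "i - 1"] that by (cases i) auto
      ultimately have "positions ?r" unfolding positions_def by blast
      then show "?r \<in> X" using r by (auto simp: X_def)
    qed
  qed
  let ?F' = "inv_into (sandwich Succ Prec l m) F"
  have F': "bij_betw ?F' Y (sandwich Succ Prec l m)" by (rule bij_betw_inv_into[OF YF])
  let ?f = "map_prod ?F' id \<circ> (T \<circ> F)"
  have bij: "bij_betw ?f (sandwich Prec Succ l m) (sandwich Succ Prec l m \<times> UNIV)"
    using bij_betw_trans[OF bij_betw_trans[OF XF T] bij_betw_map_prod[OF F', of id UNIV UNIV]] by simp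
  have "area h + area (fst (?f h)) = area l + area m + int (snd (?f h))" if h: "h \<in> sandwich Prec Succ l m" for h
  proof -
    let ?r = "F h" let ?s = "fst (T ?r)" let ?g = "fst (?f h)"
    have rX: "?r \<in> X" using XF h by (auto dest: bij_betwE)
    then have sY: "?s \<in> Y" using T by (auto dest!: bij_betwE)
    have g: "?g \<in> sandwich Succ Prec l m" using bij_betw_apply[OF bij h] by (simp only: mem_Times_iff)
    have gs: "F ?g = ?s" using bij_betw_inv_into_right[OF YF sY] by simp
    have hp: "profile h" "profile ?g" using h g by (auto simp: sandwich_def)
    have r: "positions ?r" "\<And>i. mx i \<le> ?r i" "\<And>i. ?r (Suc i) < mn i" using rX by (auto simp: X_def)
    have s: "positions ?s" "\<And>i. ?s i \<le> mn i" "\<And>i. mx (Suc i) < ?s i" using sY by (auto simp: Y_def)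
    \<comment> \<open>The upper bound for \<open>?r i\<close> is \<open>mn (i - 1)\<close>, so
      \<open>?r\<close> reaches its ground positions one index later than the others.\<close>
    have rN: "?r i = - int i - 1" if "i \<ge> Suc N" for i
      using mN[of i] mN[of "i - 1"] r(2)[of i] r(3)[of "i - 1"] that by (cases i) auto
    have sN: "?s i = - int i - 1" if "i \<ge> N" for i
      using mN[of i] mN[of "Suc i"] s(2)[of i] s(3)[of i] that by auto
    have ah: "area h = (\<Sum>i<Suc N. ?r i + int i + 1)"
      by (rule area_positions[OF hp(1) r(1) Fg[OF hp(1)] rN])
    have ag: "area ?g = (\<Sum>i<N. ?s i + int i + 1)"
      using gs Fg[OF hp(2)] by (intro area_positions[OF hp(2) s(1) _ sN]) auto
    have al: "area l = (\<Sum>i<N. p i + int i + 1)" "area m = (\<Sum>i<N. q i + int i + 1)"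
      by (rule area_positions[OF l pq(1,3) N(1)] area_positions[OF m pq(2,4) N(2)]; assumption)+
    have "(\<Sum>i<N. ?r (Suc i) + int (Suc i) + 1) + (\<Sum>i<N. ?s i + int i + 1)
        = (\<Sum>i<N. (mx (Suc i) + int (Suc i) + 1) + (mn i + int i + 1))"
      unfolding sum.distrib[symmetric] by (rule sum.cong) (auto simp: T_def)
    also have "\<dots> = (\<Sum>i<N. mx (Suc i) + int (Suc i) + 1) + (\<Sum>i<N. mn i + int i + 1)"
      by (rule sum.distrib)
    \<comment> \<open>Shifting the index drops the summand at 0 and adds the one at
      \<open>N\<close>, which vanishes.\<close>
    also have "(\<Sum>i<N. mx (Suc i) + int (Suc i) + 1) = (\<Sum>i<N. mx i + int i + 1) - (mx 0 + 1)"
      using sum.lessThan_Suc_shift[of "\<lambda>i. mx i + int i + 1" N] mN[of N] by simp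
    finally have "area h + area ?g = (?r 0 - mx 0) + ((\<Sum>i<N. mx i + int i + 1) + (\<Sum>i<N. mn i + int i + 1))"
      unfolding ah ag sum.lessThan_Suc_shift by simp
    also have "(\<Sum>i<N. mx i + int i + 1) + (\<Sum>i<N. mn i + int i + 1) = area l + area m"
      unfolding al sum.distrib[symmetric] by (rule sum.cong) (auto simp: mx_def mn_def)
    also have "?r 0 - mx 0 = int (snd (?f h))"
      using r(2)[of 0] by (simp add: T_def)
    finally show ?thesis by simp
  qed
  moreover have "multiplicities Prec Succ = UNIV" by (simp add: multiplicities_def eps_def)
  ultimately show ?thesis using bij unfolding exchange_def by (intro exI[of _ ?f]) auto
qed

text \<open>Conjugation preserves areas and carries both primed sandwiches to unprimed ones, so the
  previous bijection can be transported.\<close>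

lemma exchange_Prec'_Succ':
  assumes l: "profile l" and m: "profile m"
  shows "\<exists>f. exchange Prec' Succ' l m f"
proof -
  let ?c = conj_profile
  obtain f where f: "exchange Prec Succ (?c l) (?c m) f"
    using exchange_Prec_Succ[of "?c l" "?c m"] l m by auto
  have st: "step Succ (?c a) (?c b) \<longleftrightarrow> step Succ' a b" for a b
    using step_Prec_conj[of b a] by simp
  have c1: "bij_betw ?c (sandwich Prec' Succ' l m) (sandwich Prec Succ (?c l) (?c m))"
    by (rule bij_betw_byWitness[where f' = ?c])
       (auto simp: sandwich_def step_Prec_conj[symmetric] st[symmetric] simp del: step.simps)
  have c2: "bij_betw ?c (sandwich Succ Prec (?c l) (?c m)) (sandwich Succ' Prec' l m)"
    by (rule bij_betw_byWitness[where f' = ?c])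
       (auto simp: sandwich_def step_Prec_conj[symmetric] st[symmetric] simp del: step.simps)
  let ?f = "map_prod ?c id \<circ> (f \<circ> ?c)"
  have mult: "multiplicities Prec' Succ' = UNIV" "multiplicities Prec Succ = UNIV" by (simp_all add: multiplicities_def eps_def)
  have fb: "bij_betw f (sandwich Prec Succ (?c l) (?c m)) (sandwich Succ Prec (?c l) (?c m) \<times> UNIV)"
    using f by (simp add: exchange_def mult)
  have "bij_betw ?f (sandwich Prec' Succ' l m) (sandwich Succ' Prec' l m \<times> UNIV)"
    using bij_betw_trans[OF bij_betw_trans[OF c1 fb] bij_betw_map_prod[OF c2, of id UNIV UNIV]] by simp
  moreover have "area h + area (fst (?f h)) = area l + area m + int (snd (?f h))" if h: "h \<in> sandwich Prec' Succ' l m" for h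
  proof -
    have ch: "?c h \<in> sandwich Prec Succ (?c l) (?c m)" using c1 h by (auto dest: bij_betwE)
    then have "f (?c h) \<in> sandwich Succ Prec (?c l) (?c m) \<times> UNIV" using fb by (auto dest!: bij_betwE)
    then have "profile (fst (f (?c h)))" by (auto simp: sandwich_def)
    moreover have "area (?c h) + area (fst (f (?c h))) = area (?c l) + area (?c m) + int (snd (f (?c h)))"
      using f ch by (simp add: exchange_def)
    moreover have "profile h" using h by (simp add: sandwich_def)
    ultimately show ?thesis using l m by (simp add: area_conj)
  qed
  ultimately show ?thesis unfolding exchange_def mult by (intro exI[of _ ?f]) auto
qed

lemma exchange_ex:
  assumes "a \<in> ups" "b \<in> downs" "profile l" "profile m"
  shows "\<exists>f. exchange a b l m f"
  using assms exchange_Prec_Succ exchange_Prec_Succ' exchange_Prec'_Succ exchange_Prec'_Succ'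
  unfolding ups_def downs_def by blast

section \<open>Sequences of profiles\<close>

text \<open>The outer columns stay at \<open>ground\<close>, because no bounded face is centred on
  \<open>V_col 0\<close> or \<open>V_col k\<close>. Columns beyond \<open>k\<close> are fixed as
  well, so that every sequence has a single representative.\<close>

definition Config :: "nat \<Rightarrow> (nat \<Rightarrow> diamond) \<Rightarrow> (nat \<Rightarrow> int \<Rightarrow> int) set" where
  "Config k d = {H. (\<forall>j. profile (H j)) \<and> H 0 = ground \<and> (\<forall>j\<ge>k. H j = ground) \<and>
     (\<forall>j<k. step (d (Suc j)) (H j) (H (Suc j)))}"

definition pairs :: "nat \<Rightarrow> (nat \<Rightarrow> diamond) \<Rightarrow> (nat \<times> nat) set" where
  "pairs k d = {(i, j). 1 \<le> i \<and> i < j \<and> j \<le> k \<and> d i \<in> ups \<and> d j \<in> downs}"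

definition mults :: "(nat \<Rightarrow> diamond) \<Rightarrow> nat \<times> nat \<Rightarrow> nat set" where
  "mults d = (\<lambda>(i, j). multiplicities (d i) (d j))"

abbreviation Fillings :: "nat \<Rightarrow> (nat \<Rightarrow> diamond) \<Rightarrow> (nat \<times> nat \<Rightarrow> nat) set" where
  "Fillings k d \<equiv> Fill (pairs k d) (mults d)"

text \<open>In the filling picture, \<open>a (i, j)\<close> is the exponent contributed by the factor of the pair \<open>(i, j)\<close>, and
  \<open>load k d a l\<close> is the resulting exponent of \<open>x\<^sub>l\<close>.\<close>

definition load :: "nat \<Rightarrow> (nat \<Rightarrow> diamond) \<Rightarrow> (nat \<times> nat \<Rightarrow> nat) \<Rightarrow> nat \<Rightarrow> int" where
  "load k d a l = (\<Sum>p\<in>pairs k d. int (a p) * (if fst p \<le> l \<and> l < snd p then 1 else 0))"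

lemma finite_pairs [simp]: "finite (pairs k d)"
  by (rule finite_subset[of _ "{..k} \<times> {..k}"]) (auto simp: pairs_def)

lemma up_or_down: "x \<in> ups \<longleftrightarrow> x \<notin> downs"
  by (cases x) (auto simp: ups_def downs_def)

lemma ground_const_config: "(\<lambda>_. ground) \<in> Config k d"
proof -
  have "step x ground ground" for x by (cases x) (auto simp: ground_def)
  then show ?thesis by (auto simp: Config_def profile_ground)
qed

lemma step_down_ground: "x \<in> downs \<Longrightarrow> step x ground h \<Longrightarrow> profile h \<Longrightarrow> h = ground"
  and step_up_ground: "x \<in> ups \<Longrightarrow> step x h ground \<Longrightarrow> profile h \<Longrightarrow> h = ground"
  using profile_ge_ground[of h] by (auto simp: ups_def downs_def intro!: ext antisym)

text \<open>The step into the first column \<open>r\<close> that is not \<open>ground\<close> must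
  be an up-step and the step out of the last such column \<open>s\<close> a down-step, so
  \<open>(r, Suc s)\<close> would be a pair.\<close>

lemma Config_trivial:
  assumes "pairs k d = {}"
  shows "Config k d = {\<lambda>_. ground}"
proof -
  have "H j = ground" if H: "H \<in> Config k d" for H j
  proof (rule ccontr)
    assume "H j \<noteq> ground"
    let ?S = "{j. H j \<noteq> ground}"
    have sub: "?S \<subseteq> {0<..<k}"
    proof
      fix i assume "i \<in> ?S"
      then have "i \<noteq> 0" "\<not> k \<le> i" using H by (auto simp: Config_def intro: ccontr)
      then show "i \<in> {0<..<k}" by auto
    qed
    then have fin: "finite ?S" and ne: "?S \<noteq> {}" using \<open>H j \<noteq> ground\<close> by (auto intro: finite_subset)
    define r where "r = Min ?S"
    define s where "s = Max ?S"
    have rs: "r \<in> ?S" "s \<in> ?S" "r \<le> s" using Min_in[OF fin ne] Max_in[OF fin ne] fin by (auto simp: r_def s_def)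
    then have "0 < r" "r < k" "0 < s" "s < k" using sub by auto
    obtain r' where r': "r = Suc r'" using \<open>0 < r\<close> by (cases r) auto
    have "r' \<notin> ?S" using fin Min_le[of ?S r'] unfolding r_def[symmetric] r' by auto
    moreover have "step (d (Suc r')) (H r') (H (Suc r'))" using H \<open>r < k\<close> r' by (auto simp: Config_def)
    ultimately have "step (d r) ground (H r)" using r' by simp
    then have up: "d r \<in> ups" using step_down_ground[of "d r" "H r"] rs H by (auto simp: up_or_down Config_def)
    have "Suc s \<notin> ?S" using fin Max_ge[of ?S "Suc s"] unfolding s_def[symmetric] by auto
    moreover have "step (d (Suc s)) (H s) (H (Suc s))" using H \<open>s < k\<close> by (auto simp: Config_def)
    ultimately have "step (d (Suc s)) (H s) ground" by simp
    then have "d (Suc s) \<in> downs" using step_up_ground[of "d (Suc s)" "H s"] rs H by (auto simp: up_or_down Config_def)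
    then have "(r, Suc s) \<in> pairs k d" using up \<open>0 < r\<close> \<open>s < k\<close> rs by (auto simp: pairs_def)
    then show False using assms by simp
  qed
  then have "Config k d \<subseteq> {\<lambda>_. ground}" by (auto intro!: ext)
  then show ?thesis using ground_const_config by blast
qed

section \<open>Exchanging two adjacent letters of the word\<close>

definition swap_adj :: "nat \<Rightarrow> nat \<Rightarrow> nat" where
  "swap_adj i j = (if j = i then Suc i else if j = Suc i then i else j)"

lemma swap_adj_invol [simp]: "swap_adj i (swap_adj i j) = j" by (auto simp: swap_adj_def)

text \<open>The transposition matches up all pairs of the two words except
  \<open>(i, Suc i)\<close>, whose letters end up in the order down, up.\<close>

lemma pairs_swap:
  assumes "1 \<le> i" "Suc i \<le> k" "d i \<in> ups" "d (Suc i) \<in> downs"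
  shows "pairs k d = insert (i, Suc i) (map_prod (swap_adj i) (swap_adj i) ` pairs k (d \<circ> swap_adj i))"
    "(i, Suc i) \<notin> map_prod (swap_adj i) (swap_adj i) ` pairs k (d \<circ> swap_adj i)"
proof -
  have e1: "(p, q) \<in> map_prod (swap_adj i) (swap_adj i) ` pairs k (d \<circ> swap_adj i) \<longleftrightarrow> (swap_adj i p, swap_adj i q) \<in> pairs k (d \<circ> swap_adj i)" for p q
  proof
    assume "(swap_adj i p, swap_adj i q) \<in> pairs k (d \<circ> swap_adj i)"
    then have "map_prod (swap_adj i) (swap_adj i) (swap_adj i p, swap_adj i q) \<in> map_prod (swap_adj i) (swap_adj i) ` pairs k (d \<circ> swap_adj i)"
      by (rule imageI)
    then show "(p, q) \<in> map_prod (swap_adj i) (swap_adj i) ` pairs k (d \<circ> swap_adj i)" by simp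
  qed auto
  have e2: "(swap_adj i p, swap_adj i q) \<in> pairs k (d \<circ> swap_adj i) \<longleftrightarrow> (p, q) \<in> pairs k d \<and> (p, q) \<noteq> (i, Suc i)" for p q
  proof -
    have "d i \<notin> downs" "d (Suc i) \<notin> ups" using assms up_or_down by auto
    show ?thesis
    proof (cases "d p \<in> ups \<and> d q \<in> downs")
      case True
      then have "p \<noteq> Suc i" "q \<noteq> i" using \<open>d i \<notin> downs\<close> \<open>d (Suc i) \<notin> ups\<close> by auto
      then have "1 \<le> swap_adj i p \<and> swap_adj i p < swap_adj i q \<and> swap_adj i q \<le> k \<longleftrightarrow> 1 \<le> p \<and> p < q \<and> q \<le> k \<and> (p, q) \<noteq> (i, Suc i)"
        using assms(1,2) unfolding swap_adj_def by (cases "p = i"; cases "q = Suc i") auto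
      then show ?thesis using True by (simp add: pairs_def)
    qed (auto simp: pairs_def)
  qed
  have *: "(p, q) \<in> map_prod (swap_adj i) (swap_adj i) ` pairs k (d \<circ> swap_adj i) \<longleftrightarrow> (p, q) \<in> pairs k d \<and> (p, q) \<noteq> (i, Suc i)" for p q
    by (rule trans[OF e1 e2])
  show "(i, Suc i) \<notin> map_prod (swap_adj i) (swap_adj i) ` pairs k (d \<circ> swap_adj i)" using *[of i "Suc i"] by simp
  show "pairs k d = insert (i, Suc i) (map_prod (swap_adj i) (swap_adj i) ` pairs k (d \<circ> swap_adj i))"
  proof (intro set_eqI)
    fix x :: "nat \<times> nat"
    have "(i, Suc i) \<in> pairs k d" using assms by (auto simp: pairs_def)
    then show "x \<in> pairs k d \<longleftrightarrow> x \<in> insert (i, Suc i) (map_prod (swap_adj i) (swap_adj i) ` pairs k (d \<circ> swap_adj i))"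
      using *[of "fst x" "snd x"] by (cases "x = (i, Suc i)") auto
  qed
qed

text \<open>If no up-letter between \<open>p\<close> and \<open>q\<close> were directly followed by
  a down-letter, the letters from \<open>p\<close> to \<open>q\<close> would all be ups.\<close>

lemma adjacent_pair:
  assumes "(p, q) \<in> pairs k d"
  obtains i where "1 \<le> i" "Suc i \<le> k" "d i \<in> ups" "d (Suc i) \<in> downs"
proof -
  have "\<exists>i. p \<le> i \<and> Suc i \<le> q \<and> d i \<in> ups \<and> d (Suc i) \<in> downs"
  proof (rule ccontr)
    assume no: "\<not> ?thesis"
    have "p + n \<le> q \<Longrightarrow> d (p + n) \<in> ups" for n
    proof (induction n)
      case (Suc n)
      then show ?case using no up_or_down[of "d (Suc (p + n))"] by auto
    qed (use assms in \<open>auto simp: pairs_def\<close>)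
    from this[of "q - p"] show False using assms up_or_down[of "d q"] by (auto simp: pairs_def)
  qed
  then obtain i where "p \<le> i" "Suc i \<le> q" "d i \<in> ups" "d (Suc i) \<in> downs" by blast
  then show ?thesis using assms by (intro that[of i]) (auto simp: pairs_def)
qed

text \<open>Only column \<open>i\<close> is touched. With all other columns fixed it ranges over a
  \<open>sandwich\<close> between its two neighbours, and the exchanged word prescribes the sandwich
  with the two types in the other order.\<close>

lemma Config_swap:
  assumes i: "1 \<le> i" "Suc i \<le> k" "d i \<in> ups" "d (Suc i) \<in> downs"
  obtains f where "bij_betw f (Config k d) (Config k (d \<circ> swap_adj i) \<times> multiplicities (d i) (d (Suc i)))"
    "\<And>H l. H \<in> Config k d \<Longrightarrow> l \<noteq> i \<Longrightarrow> fst (f H) l = H l"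
    "\<And>H. H \<in> Config k d \<Longrightarrow> area (H i) + area (fst (f H) i) = area (H (i - 1)) + area (H (Suc i)) + int (snd (f H))"
proof -
  let ?a = "d i" and ?b = "d (Suc i)"
  let ?A = "multiplicities ?a ?b"
  obtain g where g: "\<And>l m. profile l \<Longrightarrow> profile m \<Longrightarrow> exchange ?a ?b l m (g l m)"
    using exchange_ex[OF i(3,4)] by metis
  define f where "f H = (H(i := fst (g (H (i - 1)) (H (Suc i)) (H i))), snd (g (H (i - 1)) (H (Suc i)) (H i)))"
    for H :: "nat \<Rightarrow> int \<Rightarrow> int"
  define f' where "f' x = (fst x)(i := inv_into (sandwich ?a ?b (fst x (i - 1)) (fst x (Suc i)))
      (g (fst x (i - 1)) (fst x (Suc i))) (fst x i, snd x))" for x :: "(nat \<Rightarrow> int \<Rightarrow> int) \<times> nat"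
  have gb: "bij_betw (g l m) (sandwich ?a ?b l m) (sandwich ?b ?a l m \<times> ?A)" if "profile l" "profile m" for l m
    using g[OF that] by (simp add: exchange_def)
  have mem1: "H i \<in> sandwich ?a ?b (H (i - 1)) (H (Suc i))" if "H \<in> Config k d" for H
  proof -
    obtain i' where "i = Suc i'" using i(1) by (cases i) auto
    then show ?thesis using that i(2) by (auto simp: Config_def sandwich_def)
  qed
  have mem2: "H i \<in> sandwich ?b ?a (H (i - 1)) (H (Suc i))" if "H \<in> Config k (d \<circ> swap_adj i)" for H
  proof -
    obtain i' where "i = Suc i'" using i(1) by (cases i) auto
    then show ?thesis using that i(2)
      by (auto simp: Config_def sandwich_def swap_adj_def dest: spec[of _ "Suc i'"] spec[of _ i'])
  qed
  have Config1: "H(i := h) \<in> Config k (d \<circ> swap_adj i)" if "H \<in> Config k d" "h \<in> sandwich ?b ?a (H (i - 1)) (H (Suc i))" for H h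
  proof -
    have "step ((d \<circ> swap_adj i) (Suc j)) ((H(i := h)) j) ((H(i := h)) (Suc j))" if "j < k" for j
      using \<open>H \<in> Config k d\<close> \<open>h \<in> _\<close> that i by (auto simp: Config_def sandwich_def swap_adj_def)
    then show ?thesis using that i by (auto simp: Config_def sandwich_def)
  qed
  have Config2: "H(i := h) \<in> Config k d" if "H \<in> Config k (d \<circ> swap_adj i)" "h \<in> sandwich ?a ?b (H (i - 1)) (H (Suc i))" for H h
  proof -
    have "step (d (Suc j)) ((H(i := h)) j) ((H(i := h)) (Suc j))" if "j < k" for j
    proof -
      have "step ((d \<circ> swap_adj i) (Suc j)) (H j) (H (Suc j))" using \<open>H \<in> Config k (d \<circ> swap_adj i)\<close> that by (auto simp: Config_def)
      then show ?thesis
        using \<open>h \<in> _\<close> that i by (auto simp: sandwich_def swap_adj_def split: if_splits)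
    qed
    then show ?thesis using that i by (auto simp: Config_def sandwich_def)
  qed
  have prof: "profile (H j)" if "H \<in> Config k d \<or> H \<in> Config k (d \<circ> swap_adj i)" for H j
    using that by (auto simp: Config_def)
  have bij: "bij_betw f (Config k d) (Config k (d \<circ> swap_adj i) \<times> ?A)"
  proof (rule bij_betw_byWitness[where f' = f'])
    show "\<forall>H\<in>Config k d. f' (f H) = H"
    proof
      fix H assume H: "H \<in> Config k d"
      note b = gb[OF prof[of H "i - 1"] prof[of H "Suc i"]]
      have "inv_into (sandwich ?a ?b (H (i - 1)) (H (Suc i))) (g (H (i - 1)) (H (Suc i))) (g (H (i - 1)) (H (Suc i)) (H i)) = H i"
        using bij_betw_inv_into_left[OF b mem1[OF H]] H by auto
      then show "f' (f H) = H" using i by (auto simp: f_def f'_def)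
    qed
    show "\<forall>x\<in>Config k (d \<circ> swap_adj i) \<times> ?A. f (f' x) = x"
    proof
      fix x assume "x \<in> Config k (d \<circ> swap_adj i) \<times> ?A"
      then obtain H n where x: "x = (H, n)" "H \<in> Config k (d \<circ> swap_adj i)" "n \<in> ?A" by auto
      have "(H i, n) \<in> sandwich ?b ?a (H (i - 1)) (H (Suc i)) \<times> ?A" using mem2[OF x(2)] x by auto
      then have "g (H (i - 1)) (H (Suc i)) (inv_into (sandwich ?a ?b (H (i - 1)) (H (Suc i))) (g (H (i - 1)) (H (Suc i))) (H i, n)) = (H i, n)"
        using bij_betw_inv_into_right[OF gb[OF prof[of H "i - 1"] prof[of H "Suc i"]]] x(2) by blast
      then show "f (f' x) = x" using i by (auto simp: f_def f'_def x(1))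
    qed
    show "f ` Config k d \<subseteq> Config k (d \<circ> swap_adj i) \<times> ?A"
    proof (rule image_subsetI)
      fix H assume H: "H \<in> Config k d"
      have "g (H (i - 1)) (H (Suc i)) (H i) \<in> sandwich ?b ?a (H (i - 1)) (H (Suc i)) \<times> ?A"
        using bij_betw_apply[OF gb[OF prof[of H "i - 1"] prof[of H "Suc i"]] mem1[OF H]] H by blast
      then show "f H \<in> Config k (d \<circ> swap_adj i) \<times> ?A" using Config1[OF H] unfolding f_def mem_Times_iff by auto
    qed
    show "f' ` (Config k (d \<circ> swap_adj i) \<times> ?A) \<subseteq> Config k d"
    proof (rule image_subsetI)
      fix x assume "x \<in> Config k (d \<circ> swap_adj i) \<times> ?A"
      then obtain H n where xHn: "x = (H, n)" and x: "H \<in> Config k (d \<circ> swap_adj i)" "n \<in> ?A" by auto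
      have "(H i, n) \<in> sandwich ?b ?a (H (i - 1)) (H (Suc i)) \<times> ?A" using mem2[OF x(1)] x by auto
      then have "inv_into (sandwich ?a ?b (H (i - 1)) (H (Suc i))) (g (H (i - 1)) (H (Suc i))) (H i, n) \<in> sandwich ?a ?b (H (i - 1)) (H (Suc i))"
        using bij_betw_apply[OF bij_betw_inv_into[OF gb[OF prof[of H "i - 1"] prof[of H "Suc i"]]]] x(1) by blast
      then show "f' x \<in> Config k d" using Config2[OF x(1)] unfolding f'_def xHn by auto
    qed
  qed
  show ?thesis
  proof (rule that[OF bij])
    show "fst (f H) l = H l" if "l \<noteq> i" for H l using that by (simp add: f_def)
    show "area (H i) + area (fst (f H) i) = area (H (i - 1)) + area (H (Suc i)) + int (snd (f H))" if "H \<in> Config k d" for H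
      using g[OF prof[of H "i - 1"] prof[of H "Suc i"]] mem1[OF that] that by (simp add: exchange_def f_def)
  qed
qed

text \<open>The counterpart of \<open>Config_swap\<close> for fillings: the number produced by the
  exchange becomes the entry at \<open>(i, Suc i)\<close>, and the loads obey the identities that
  the areas obey there.\<close>

lemma Fillings_swap:
  assumes i: "1 \<le> i" "Suc i \<le> k" "d i \<in> ups" "d (Suc i) \<in> downs"
  obtains f where "bij_betw f (Fillings k (d \<circ> swap_adj i) \<times> multiplicities (d i) (d (Suc i))) (Fillings k d)"
    "\<And>x l. l \<noteq> i \<Longrightarrow> load k d (f x) l = load k (d \<circ> swap_adj i) (fst x) l"
    "\<And>x. load k d (f x) i + load k (d \<circ> swap_adj i) (fst x) i
        = load k (d \<circ> swap_adj i) (fst x) (i - 1) + load k (d \<circ> swap_adj i) (fst x) (Suc i) + int (snd x)"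
proof -
  let ?t = "map_prod (swap_adj i) (swap_adj i)" and ?d = "d \<circ> swap_adj i"
  let ?A = "multiplicities (d i) (d (Suc i))"
  note P = pairs_swap[where k = k and d = d, OF i]
  have tt: "?t (?t p) = p" for p by (cases p) auto
  have injt: "inj_on ?t (pairs k ?d)" unfolding inj_on_def by (metis tt)
  have tm: "p \<in> ?t ` pairs k ?d \<longleftrightarrow> ?t p \<in> pairs k ?d" for p
  proof
    assume "p \<in> ?t ` pairs k ?d"
    then show "?t p \<in> pairs k ?d" by (elim imageE) (simp only: tt)
  next
    assume "?t p \<in> pairs k ?d"
    then have "?t (?t p) \<in> ?t ` pairs k ?d" by (rule imageI)
    then show "p \<in> ?t ` pairs k ?d" by (simp only: tt)
  qed
  have mem: "p \<in> pairs k d \<longleftrightarrow> p = (i, Suc i) \<or> ?t p \<in> pairs k ?d" for p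
    by (subst P(1)) (simp only: insert_iff tm)
  have nmem: "?t (i, Suc i) \<notin> pairs k ?d" using P(2) tm by blast
  have m: "mults d p = mults ?d (?t p)" for p by (auto simp: mults_def case_prod_beta)
  have mi: "mults d (i, Suc i) = ?A" by (simp add: mults_def)
  define f where "f x = (\<lambda>p. if p = (i, Suc i) then snd x else fst x (?t p))" for x :: "(nat \<times> nat \<Rightarrow> nat) \<times> nat"
  \<comment> \<open>The swap takes \<open>(i, Suc i)\<close> to the reversed pair, which lies
    outside \<open>pairs k ?d\<close>, so the default value 0 has to be put there.\<close>
  define f' where "f' a = (\<lambda>p. if ?t p = (i, Suc i) then 0 else a (?t p), a (i, Suc i))" for a :: "nat \<times> nat \<Rightarrow> nat"
  have tp: "?t p = (i, Suc i) \<longleftrightarrow> p = ?t (i, Suc i)" for p by (metis tt)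
  have bij: "bij_betw f (Fillings k ?d \<times> ?A) (Fillings k d)"
  proof (rule bij_betw_byWitness[where f' = f'])
    show "\<forall>x\<in>Fillings k ?d \<times> ?A. f' (f x) = x"
    proof clarify
      fix a n assume a: "a \<in> Fillings k ?d"
      have "a (?t (i, Suc i)) = 0" using a nmem unfolding Fill_def by blast
      then have "fst (f' (f (a, n))) = a" unfolding f_def f'_def tp by (intro ext) (simp only: fst_conv snd_conv tt split: if_split, auto)
      then show "f' (f (a, n)) = (a, n)" by (simp add: f_def f'_def)
    qed
    show "\<forall>a\<in>Fillings k d. f (f' a) = a" by (auto simp: f_def f'_def tt fun_eq_iff simp del: map_prod_simp)
    show "f ` (Fillings k ?d \<times> ?A) \<subseteq> Fillings k d"
    proof (rule image_subsetI)
      fix x assume x: "x \<in> Fillings k ?d \<times> ?A"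
      have "f x p \<in> mults d p" if p: "p \<in> pairs k d" for p
      proof (cases "p = (i, Suc i)")
        case True
        have "f x (i, Suc i) = snd x" by (simp add: f_def)
        moreover have "snd x \<in> ?A" using x unfolding mem_Times_iff by blast
        ultimately show ?thesis unfolding True mi by (simp only:)
      next
        case False
        then have "?t p \<in> pairs k ?d" using p mem[of p] by simp
        then have "fst x (?t p) \<in> mults ?d (?t p)" using x unfolding Fill_def mem_Times_iff by simp
        then show ?thesis using False m[of p] unfolding f_def by simp
      qed
      moreover have "f x p = 0" if p: "p \<notin> pairs k d" for p
      proof -
        have "p \<noteq> (i, Suc i)" "?t p \<notin> pairs k ?d" using p mem[of p] by simp_all
        then show ?thesis using x unfolding f_def Fill_def mem_Times_iff by (simp del: split_paired_All)
      qed
      ultimately show "f x \<in> Fillings k d" unfolding Fill_def by blast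
    qed
    show "f' ` Fillings k d \<subseteq> Fillings k ?d \<times> ?A"
    proof (rule image_subsetI)
      fix a assume a: "a \<in> Fillings k d"
      have "a (i, Suc i) \<in> ?A" using a mem[of "(i, Suc i)"] mi unfolding Fill_def by blast
      moreover have "a (?t p) \<in> mults ?d p" "?t p \<noteq> (i, Suc i)" if "p \<in> pairs k ?d" for p
        using a mem[of "?t p"] m[of "?t p"] that nmem unfolding Fill_def tp tt by auto
      moreover have "a (?t p) = 0" if "p \<notin> pairs k ?d" "?t p \<noteq> (i, Suc i)" for p
        using a mem[of "?t p"] that unfolding Fill_def tt by (simp del: split_paired_All)
      ultimately show "f' a \<in> Fillings k ?d \<times> ?A"
        unfolding f'_def Fill_def mem_Times_iff by auto
    qed
  qed
  have load_f: "load k d (f x) l = int (snd x) * (if l = i then 1 else 0) +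
      (\<Sum>p\<in>pairs k ?d. int (fst x p) * (if swap_adj i (fst p) \<le> l \<and> l < swap_adj i (snd p) then 1 else 0))" for x l
  proof -
    have "load k d (f x) l = int (snd x) * (if l = i then 1 else 0) +
        (\<Sum>p\<in>?t ` pairs k ?d. int (f x p) * (if fst p \<le> l \<and> l < snd p then 1 else 0))"
      unfolding load_def P(1) using P(2) by (subst sum.insert) (auto simp: f_def)
    also have "(\<Sum>p\<in>?t ` pairs k ?d. int (f x p) * (if fst p \<le> l \<and> l < snd p then 1 else 0)) =
       (\<Sum>p\<in>pairs k ?d. int (f x (?t p)) * (if swap_adj i (fst p) \<le> l \<and> l < swap_adj i (snd p) then 1 else 0))"
      by (subst sum.reindex[OF injt]) simp
    also have "\<dots> = (\<Sum>p\<in>pairs k ?d. int (fst x p) * (if swap_adj i (fst p) \<le> l \<and> l < swap_adj i (snd p) then 1 else 0))"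
    proof (rule sum.cong[OF refl])
      fix p assume "p \<in> pairs k ?d"
      then have "?t p \<noteq> (i, Suc i)" using nmem unfolding tp by blast
      then have "f x (?t p) = fst x p" unfolding f_def tt by simp
      then show "int (f x (?t p)) * (if swap_adj i (fst p) \<le> l \<and> l < swap_adj i (snd p) then 1 else 0) =
        int (fst x p) * (if swap_adj i (fst p) \<le> l \<and> l < swap_adj i (snd p) then 1 else 0)" by simp
    qed
    finally show ?thesis .
  qed
  show ?thesis
  proof (rule that[OF bij])
    fix x l assume l: "l \<noteq> i"
    show "load k d (f x) l = load k ?d (fst x) l"
      unfolding load_f load_def[of k ?d] using l
      by (simp, intro sum.cong) (auto simp: swap_adj_def pairs_def)
  next
    fix x :: "(nat \<times> nat \<Rightarrow> nat) \<times> nat"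
    \<comment> \<open>In the exchanged word \<open>i\<close> is a down and \<open>Suc i\<close> an
      up, so no pair starts at \<open>i\<close> or ends at \<open>Suc i\<close>. A pair that starts
      at \<open>Suc i\<close> or ends at \<open>i\<close> gains column \<open>i\<close> by the swap;
      for every other pair the indicator is constant on \<open>i - 1\<close>, \<open>i\<close>,
      \<open>Suc i\<close>.\<close>
    have edge_ind: "(if swap_adj i p \<le> i \<and> i < swap_adj i q then 1 else 0 :: int) + (if p \<le> i \<and> i < q then 1 else 0)
       = (if p \<le> i - 1 \<and> i - 1 < q then 1 else 0) + (if p \<le> Suc i \<and> Suc i < q then 1 else 0)"
      if "(p, q) \<in> pairs k ?d" for p q
    proof -
      have "d i \<notin> downs" "d (Suc i) \<notin> ups" using i up_or_down by auto
      then show ?thesis using that i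
        by (cases "p = i"; cases "p = Suc i"; cases "q = i"; cases "q = Suc i") (auto simp: pairs_def swap_adj_def)
    qed
    have "(\<Sum>p\<in>pairs k ?d. int (fst x p) * (if swap_adj i (fst p) \<le> i \<and> i < swap_adj i (snd p) then 1 else 0)) + load k ?d (fst x) i
       = load k ?d (fst x) (i - 1) + load k ?d (fst x) (Suc i)"
      unfolding load_def sum.distrib[symmetric] distrib_left[symmetric]
    proof (rule sum.cong[OF refl])
      fix p assume "p \<in> pairs k ?d"
      then show "int (fst x p) * ((if swap_adj i (fst p) \<le> i \<and> i < swap_adj i (snd p) then 1 else 0) + (if fst p \<le> i \<and> i < snd p then 1 else 0)) =
         int (fst x p) * ((if fst p \<le> i - 1 \<and> i - 1 < snd p then 1 else 0) + (if fst p \<le> Suc i \<and> Suc i < snd p then 1 else 0))"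
        using edge_ind[of "fst p" "snd p"] by simp
    qed
    then show "load k d (f x) i + load k ?d (fst x) i = load k ?d (fst x) (i - 1) + load k ?d (fst x) (Suc i) + int (snd x)"
      unfolding load_f by simp
  qed
qed

text \<open>Induction on the number of pairs, which drops by exactly one with each exchange of an
  adjacent up and down. Areas and loads satisfy the same identities under the exchange, so equality
  is passed on column by column.\<close>

theorem Config_Fillings:
  "\<exists>f. bij_betw f (Config k d) (Fillings k d) \<and> (\<forall>H\<in>Config k d. \<forall>l. load k d (f H) l = area (H l))"
proof (induction "card (pairs k d)" arbitrary: d)
  case 0
  then have e: "pairs k d = {}" by simp
  then have F: "Fillings k d = {\<lambda>_. 0}" by (auto simp: Fill_def)
  show ?case unfolding Config_trivial[OF e] F by (intro exI[of _ "\<lambda>_ _. 0"]) (auto simp: load_def)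
next
  case (Suc c)
  then obtain p q where "(p, q) \<in> pairs k d" by (metis card.empty nat.simps(3) ex_in_conv surj_pair)
  then obtain i where i: "1 \<le> i" "Suc i \<le> k" "d i \<in> ups" "d (Suc i) \<in> downs" by (rule adjacent_pair)
  let ?d = "d \<circ> swap_adj i" let ?A = "multiplicities (d i) (d (Suc i))"
  have "inj_on (map_prod (swap_adj i) (swap_adj i)) (pairs k ?d)"
    by (rule inj_on_inverseI[where g = "map_prod (swap_adj i) (swap_adj i)"]) (auto simp: case_prod_beta map_prod_def)
  then have "c = card (pairs k ?d)"
    using Suc(2) unfolding pairs_swap(1)[where k = k and d = d, OF i]
    by (subst (asm) card_insert_disjoint) (use pairs_swap(2)[where k = k and d = d, OF i] in \<open>auto simp: card_image\<close>)
  from Suc(1)[OF this] obtain f where f: "bij_betw f (Config k ?d) (Fillings k ?d)"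
    "\<And>H l. H \<in> Config k ?d \<Longrightarrow> load k ?d (f H) l = area (H l)" by blast
  obtain g where g: "bij_betw g (Config k d) (Config k ?d \<times> ?A)"
    "\<And>H l. H \<in> Config k d \<Longrightarrow> l \<noteq> i \<Longrightarrow> fst (g H) l = H l"
    "\<And>H. H \<in> Config k d \<Longrightarrow> area (H i) + area (fst (g H) i) = area (H (i - 1)) + area (H (Suc i)) + int (snd (g H))"
    using Config_swap[where k = k and d = d, OF i] by blast
  obtain e where e: "bij_betw e (Fillings k ?d \<times> ?A) (Fillings k d)"
    "\<And>x l. l \<noteq> i \<Longrightarrow> load k d (e x) l = load k ?d (fst x) l"
    "\<And>x. load k d (e x) i + load k ?d (fst x) i = load k ?d (fst x) (i - 1) + load k ?d (fst x) (Suc i) + int (snd x)"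
    using Fillings_swap[where k = k and d = d, OF i] by blast
  let ?f = "e \<circ> (map_prod f id \<circ> g)"
  have "bij_betw ?f (Config k d) (Fillings k d)"
    by (rule bij_betw_trans[OF bij_betw_trans[OF g(1) bij_betw_map_prod[OF f(1) bij_betw_id]] e(1)])
  moreover have "load k d (?f H) l = area (H l)" if H: "H \<in> Config k d" for H l
  proof -
    have gH: "fst (g H) \<in> Config k ?d" using bij_betw_apply[OF g(1) H] by (simp add: mem_Times_iff)
    have L: "load k ?d (fst (map_prod f id (g H))) l = area (fst (g H) l)" for l using f(2)[OF gH] by simp
    show ?thesis
    proof (cases "l = i")
      case False
      then show ?thesis using e(2)[OF False, of "map_prod f id (g H)"] L[of l] g(2)[OF H False] by simp
    next
      case True
      have "fst (g H) (i - 1) = H (i - 1)" "fst (g H) (Suc i) = H (Suc i)" using g(2)[OF H] i by auto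
      then show ?thesis unfolding True
        using e(3)[of "map_prod f id (g H)"] g(3)[OF H] unfolding L by simp
    qed
  qed
  ultimately show ?case by blast
qed

section \<open>The graph in coordinates\<close>

text \<open>
  Strip \<open>j\<close> lies between \<open>V\<^sub>j\<close> and \<open>V\<^bsub>j+1\<^esub>\<close> and contains \<open>W\<^bsub>j+1\<^esub>\<close>, which is therefore indexed by \<open>j\<close> below. Every
  vertex of \<open>W\<^bsub>j+1\<^esub>\<close> has three edges: the horizontal one and the ones to its upper and lower diagonal neighbours.
\<close>

datatype kind = Hz | Up | Dn

definition primed :: "diamond \<Rightarrow> bool" where
  "primed x \<longleftrightarrow> x \<in> {Prec', Succ'}"

text \<open>A vertex of index \<open>n\<close> between the columns has its diagonal neighbours at
  ordinates higher and lower by 1/2; as \<open>Y_ord\<close> changes by 1/2 across the strip, their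
  indices are \<open>n + shift x\<close> and \<open>n + shift x - 1\<close>.\<close>

definition shift :: "diamond \<Rightarrow> int" where
  "shift x = (if x \<in> {Prec, Prec'} then 1 else 0)"

definition Vp :: "(nat \<Rightarrow> diamond) \<Rightarrow> nat \<Rightarrow> int \<Rightarrow> point" where
  "Vp d j n = (3/2 * real j, Y_ord d j + real_of_int n + 1/2)"

text \<open>Ordinates are measured from the \<open>Y_ord\<close> of the column reached by the
  horizontal edge, so that this edge preserves the index.\<close>

definition Wp :: "(nat \<Rightarrow> diamond) \<Rightarrow> nat \<Rightarrow> int \<Rightarrow> point" where
  "Wp d j n = (if primed (d (Suc j)) then (3/2 * real j + 1, Y_ord d j + real_of_int n + 1/2)
     else (3/2 * real j + 1/2, Y_ord d (Suc j) + real_of_int n + 1/2))"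

definition end_col :: "(nat \<Rightarrow> diamond) \<Rightarrow> nat \<Rightarrow> kind \<Rightarrow> nat" where
  "end_col d j c = (if primed (d (Suc j)) \<longleftrightarrow> c = Hz then j else Suc j)"

definition end_idx :: "(nat \<Rightarrow> diamond) \<Rightarrow> nat \<Rightarrow> int \<Rightarrow> kind \<Rightarrow> int" where
  "end_idx d j n c = (case c of Hz \<Rightarrow> n | Up \<Rightarrow> n + shift (d (Suc j)) | Dn \<Rightarrow> n + shift (d (Suc j)) - 1)"

definition edge :: "(nat \<Rightarrow> diamond) \<Rightarrow> nat \<Rightarrow> int \<Rightarrow> kind \<Rightarrow> edge" where
  "edge d j n c = {Wp d j n, Vp d (end_col d j c) (end_idx d j n c)}"

lemma Y_Suc: "Y_ord d (Suc j) = (if primed (d (Suc j)) then Y_ord d j + 1/2 - real_of_int (shift (d (Suc j)))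
    else Y_ord d j - 1/2 + real_of_int (shift (d (Suc j))))"
  by (cases "d (Suc j)") (auto simp: primed_def shift_def Y_ord.simps(2))

text \<open>Every letter changes \<open>Y_ord\<close> by plus or minus 1/2. Hence
  \<open>Y_ord d j + 1/2\<close> lies in the coset of ordinates of \<open>V_col j\<close>, and
  integer indices enumerate the column.\<close>

lemma Y_parity: "\<exists>m. Y_ord d j = real j / 2 + real_of_int m"
proof (induction j)
  case 0
  then show ?case by (intro exI[of _ 0]) simp
next
  case (Suc j)
  then obtain m where m: "Y_ord d j = real j / 2 + real_of_int m" by auto
  show ?case unfolding Y_Suc m
    by (cases "primed (d (Suc j))")
       (auto intro: exI[of _ "m - shift (d (Suc j))"] exI[of _ "m - 1 + shift (d (Suc j))"] simp: field_simps)
qed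

lemma Ints_shift_iff:
  assumes "a - b \<in> \<int>"
  shows "y - a \<in> \<int> \<longleftrightarrow> (\<exists>n. y = b + real_of_int n)"
proof
  assume "y - a \<in> \<int>"
  then have "y - a + (a - b) \<in> \<int>" using assms by (rule Ints_add)
  then obtain n where "y - b = real_of_int n" by (auto elim: Ints_cases)
  then show "\<exists>n. y = b + real_of_int n" by (intro exI[of _ n]) simp
next
  assume "\<exists>n. y = b + real_of_int n"
  then obtain n where "y = b + real_of_int n" ..
  then have "y - a = real_of_int n - (a - b)" by simp
  then show "y - a \<in> \<int>" using assms by (simp only: Ints_diff Ints_of_int)
qed

lemma V_col_eq: "V_col j = range (Vp d j)"
proof -
  obtain m where m: "Y_ord d j = real j / 2 + real_of_int m" using Y_parity by blast
  have "(real j + 1) / 2 - (Y_ord d j + 1/2) = real_of_int (- m)" unfolding m by (simp add: field_simps)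
  then have "(real j + 1) / 2 - (Y_ord d j + 1/2) \<in> \<int>" by (metis Ints_of_int)
  note * = Ints_shift_iff[OF this]
  show ?thesis unfolding V_col_def * by (auto simp: Vp_def image_iff algebra_simps)
qed

lemma W_col_eq: "W_col d (Suc j) = range (Wp d j)"
proof (cases "primed (d (Suc j))")
  case True
  obtain m where m: "Y_ord d j = real j / 2 + real_of_int m" using Y_parity by blast
  have "real (Suc j) / 2 - (Y_ord d j + 1/2) = real_of_int (- m)" unfolding m by (simp add: field_simps)
  then have "real (Suc j) / 2 - (Y_ord d j + 1/2) \<in> \<int>" by (metis Ints_of_int)
  note * = Ints_shift_iff[OF this]
  have "d (Suc j) \<notin> {Prec, Succ}" using True by (auto simp: primed_def)
  then show ?thesis unfolding W_col_def * using True by (auto simp: Wp_def image_iff algebra_simps)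
next
  case False
  obtain m where m: "Y_ord d (Suc j) = real (Suc j) / 2 + real_of_int m" using Y_parity by blast
  have "(real (Suc j) + 1) / 2 - (Y_ord d (Suc j) + 1/2) = real_of_int (- m)" unfolding m by (simp add: field_simps)
  then have "(real (Suc j) + 1) / 2 - (Y_ord d (Suc j) + 1/2) \<in> \<int>" by (metis Ints_of_int)
  note * = Ints_shift_iff[OF this]
  have "d (Suc j) \<in> {Prec, Succ}" using False by (cases "d (Suc j)") (auto simp: primed_def)
  then show ?thesis unfolding W_col_def * using False by (auto simp: Wp_def image_iff algebra_simps)
qed

section \<open>Distinctness of vertices, and edges as triples of strip, index and kind\<close>

lemma Vp_eq_iff [simp]: "Vp d j n = Vp d i m \<longleftrightarrow> j = i \<and> n = m"
  by (auto simp: Vp_def)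

lemma Wp_eq_iff [simp]: "Wp d j n = Wp d i m \<longleftrightarrow> j = i \<and> n = m"
proof
  assume eq: "Wp d j n = Wp d i m"
  have "fst (Wp d j n) = fst (Wp d i m)" using eq by simp
  then have "3 * real j + (if primed (d (Suc j)) then 1 else 0) = 3 * real i + (if primed (d (Suc i)) then 1 else 0)"
    by (auto simp: Wp_def split: if_splits)
  then have "3 * j + (if primed (d (Suc j)) then 1 else 0) = 3 * i + (if primed (d (Suc i)) then 1 else 0)"
    by (auto split: if_splits)
  then have "j = i" by (auto split: if_splits)
  with eq show "j = i \<and> n = m" by (auto simp: Wp_def split: if_splits)
qed auto

text \<open>Doubled abscissae are divisible by 3 on the \<open>V\<close>-columns and congruent to 1
  or 2 modulo 3 on the \<open>W\<close>-columns.\<close>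

lemma Vp_neq_Wp [simp]: "Vp d j n \<noteq> Wp d i m" "Wp d i m \<noteq> Vp d j n"
proof -
  show "Vp d j n \<noteq> Wp d i m"
  proof
    assume "Vp d j n = Wp d i m"
    then have "fst (Vp d j n) = fst (Wp d i m)" by simp
    then have "real (3 * j) = real (3 * i + (if primed (d (Suc i)) then 2 else 1))"
      by (auto simp: Vp_def Wp_def split: if_splits)
    then have "3 * j = 3 * i + (if primed (d (Suc i)) then 2 else 1)" by (simp only: of_nat_eq_iff)
    then show False by (auto split: if_splits) presburger+
  qed
  then show "Wp d i m \<noteq> Vp d j n" by metis
qed

lemma edge_eq_iff: "edge d j n c = edge d j' n' c' \<longleftrightarrow> j = j' \<and> n = n' \<and> c = c'"
proof
  assume "edge d j n c = edge d j' n' c'"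
  then have *: "j = j'" "n = n'" "end_col d j c = end_col d j' c'" "end_idx d j n c = end_idx d j' n' c'"
    by (auto simp: edge_def doubleton_eq_iff)
  then show "j = j' \<and> n = n' \<and> c = c'"
    by (cases c; cases c') (auto simp: end_col_def end_idx_def split: if_splits)
qed auto

lemma W_cols: "(\<Union>j\<in>{1..k}. W_col d j) = {Wp d j n | j n. j < k}"
proof -
  have "{1..k} = Suc ` {..<k}" by (auto simp: image_iff) (metis Suc_pred' lessThan_iff not_less_eq_eq Suc_le_lessD less_eq_Suc_le Suc_le_D)
  then show ?thesis by (auto simp: W_col_eq)
qed

lemma V_cols: "(\<Union>j\<in>{0..k}. V_col j) = {Vp d j n | j n. j \<le> k}"
  by (auto simp: V_col_eq[of _ d])

lemma verts_eq: "verts k d = {Vp d j n | j n. j \<le> k} \<union> {Wp d j n | j n. j < k}"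
  unfolding verts_def W_cols V_cols[of k d] ..

lemma end_col_le: "j < k \<Longrightarrow> end_col d j c \<le> k"
  by (auto simp: end_col_def)

text \<open>Comparing doubled abscissae modulo 3 forces both vertices into the same strip and
  decides, according to \<open>primed\<close>, between the horizontal and the diagonal
  differences.\<close>

lemma Wp_minus_Vp_iff:
  "Wp d i n - Vp d j m \<in> {(1, 0), (1/2, 1/2), (1/2, - (1/2))} \<longleftrightarrow>
     i = j \<and> (\<exists>c. end_col d i c = j \<and> end_idx d i n c = m)" (is "?L \<longleftrightarrow> ?R")
proof
  assume L: ?L
  then have "fst (Wp d i n) - fst (Vp d j m) = 1 \<or> fst (Wp d i n) - fst (Vp d j m) = 1/2"
    by (auto simp: prod_eq_iff)
  then have "real (3 * i + (if primed (d (Suc i)) then 2 else 1)) = real (3 * j + 2) \<or>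
     real (3 * i + (if primed (d (Suc i)) then 2 else 1)) = real (3 * j + 1)"
    by (auto simp: Vp_def Wp_def split: if_splits)
  then have "3 * i + (if primed (d (Suc i)) then 2 else 1) = 3 * j + 2 \<or> 3 * i + (if primed (d (Suc i)) then 2 else 1) = 3 * j + 1"
    by (simp only: of_nat_eq_iff)
  then have ij: "i = j" by (auto split: if_splits)
  show ?R
  proof (cases "primed (d (Suc i))")
    case True
    then have "n = m" using L unfolding ij by (auto simp: Wp_def Vp_def)
    then show ?thesis using ij True by (auto simp: end_col_def end_idx_def intro!: exI[of _ Hz])
  next
    case False
    let ?s = "shift (d (Suc j))"
    have eq: "Wp d j n - Vp d j m = (1/2, real_of_int (n + ?s - m) - 1/2)"
      using False unfolding ij by (simp add: Wp_def Vp_def Y_Suc)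
    have "real_of_int (n + ?s - m) - 1/2 = 1/2 \<or> real_of_int (n + ?s - m) - 1/2 = - (1/2)"
      using L unfolding ij eq by (simp del: of_int_add of_int_diff)
    then have "real_of_int (n + ?s - 1) = real_of_int m \<or> real_of_int (n + ?s) = real_of_int m" by force
    then have "n + ?s - 1 = m \<or> n + ?s = m" by (simp only: of_int_eq_iff)
    then have "end_idx d i n Dn = m \<or> end_idx d i n Up = m" by (simp add: end_idx_def ij)
    moreover have "end_col d i Dn = j" "end_col d i Up = j" using False by (simp_all add: end_col_def ij)
    ultimately show ?thesis using ij by blast
  qed
next
  assume ?R
  then obtain c where c: "i = j" "end_col d i c = j" "end_idx d i n c = m" by auto
  then show ?L by (cases c) (auto simp: end_col_def end_idx_def Wp_def Vp_def Y_Suc split: if_splits)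
qed

lemma Vp_minus_Wp_iff:
  "Vp d j m - Wp d i n \<in> {(1, 0), (1/2, 1/2), (1/2, - (1/2))} \<longleftrightarrow>
     j = Suc i \<and> (\<exists>c. end_col d i c = j \<and> end_idx d i n c = m)" (is "?L \<longleftrightarrow> ?R")
proof
  assume L: ?L
  then have "fst (Vp d j m) - fst (Wp d i n) = 1 \<or> fst (Vp d j m) - fst (Wp d i n) = 1/2"
    by (auto simp: prod_eq_iff)
  then have "real (3 * i + (if primed (d (Suc i)) then 2 else 1) + 2) = real (3 * j) \<or>
     real (3 * i + (if primed (d (Suc i)) then 2 else 1) + 1) = real (3 * j)"
    by (auto simp: Vp_def Wp_def split: if_splits)
  then have "3 * i + (if primed (d (Suc i)) then 2 else 1) + 2 = 3 * j \<or> 3 * i + (if primed (d (Suc i)) then 2 else 1) + 1 = 3 * j"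
    by (simp only: of_nat_eq_iff)
  then have ij: "j = Suc i" by (auto split: if_splits)
  show ?R
  proof (cases "primed (d (Suc i))")
    case True
    let ?s = "shift (d (Suc i))"
    have eq: "Vp d (Suc i) m - Wp d i n = (1/2, 1/2 - real_of_int (n + ?s - m))"
      using True by (simp add: Wp_def Vp_def Y_Suc field_simps)
    have "1/2 - real_of_int (n + ?s - m) = 1/2 \<or> 1/2 - real_of_int (n + ?s - m) = - (1/2)"
      using L unfolding ij eq by (simp del: of_int_add of_int_diff)
    then have "real_of_int (n + ?s - 1) = real_of_int m \<or> real_of_int (n + ?s) = real_of_int m" by force
    then have "n + ?s - 1 = m \<or> n + ?s = m" by (simp only: of_int_eq_iff)
    then have "end_idx d i n Dn = m \<or> end_idx d i n Up = m" by (simp add: end_idx_def ij)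
    moreover have "end_col d i Dn = j" "end_col d i Up = j" using True by (simp_all add: end_col_def ij)
    ultimately show ?thesis using ij by blast
  next
    case False
    then have "n = m" using L unfolding ij by (auto simp: Wp_def Vp_def)
    then show ?thesis using ij False by (auto simp: end_col_def end_idx_def intro!: exI[of _ Hz])
  qed
next
  assume ?R
  then obtain c where c: "j = Suc i" "end_col d i c = j" "end_idx d i n c = m" by auto
  then show ?L by (cases c) (auto simp: end_col_def end_idx_def Wp_def Vp_def Y_Suc add_divide_distrib split: if_splits)
qed

lemma edges_eq: "edges k d = {edge d j n c | j n c. j < k}"
proof (intro set_eqI iffI)
  fix e assume "e \<in> edges k d"
  then obtain u v where e: "e = {u, v}" and uv: "u \<in> verts k d" "v \<in> verts k d"
    and diff: "v - u \<in> {(1, 0), (1/2, 1/2), (1/2, - (1/2))}"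
    and bip: "u \<in> (\<Union>j\<in>{0..k}. V_col j) \<longleftrightarrow> v \<in> (\<Union>j\<in>{1..k}. W_col d j)"
    unfolding edges_def by blast
  show "e \<in> {edge d j n c | j n c. j < k}"
  proof (cases "u \<in> (\<Union>j\<in>{0..k}. V_col j)")
    case True
    then obtain j m where u: "u = Vp d j m" unfolding V_cols[of k d] by blast
    from True bip obtain i n where v: "v = Wp d i n" "i < k" unfolding W_cols by blast
    from diff obtain c where "end_col d i c = j" "end_idx d i n c = m" unfolding u v Wp_minus_Vp_iff by blast
    then have "e = edge d i n c" unfolding e u v edge_def by auto
    then show ?thesis using v by blast
  next
    case False
    then obtain i n where u: "u = Wp d i n" "i < k" using uv unfolding verts_def W_cols by blast
    from False bip obtain j m where v: "v = Vp d j m" using uv unfolding verts_def V_cols[of k d] by blast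
    from diff obtain c where "end_col d i c = j" "end_idx d i n c = m" unfolding u v Vp_minus_Wp_iff by blast
    then have "e = edge d i n c" unfolding e u v edge_def by auto
    then show ?thesis using u by blast
  qed
next
  fix e assume "e \<in> {edge d j n c | j n c. j < k}"
  then obtain i n c where e: "e = edge d i n c" and i: "i < k" by blast
  let ?v = "Vp d (end_col d i c) (end_idx d i n c)" and ?w = "Wp d i n"
  have V: "?v \<in> (\<Union>j\<in>{0..k}. V_col j)" unfolding V_cols[of k d] using end_col_le[OF i] by blast
  have W: "?w \<in> (\<Union>j\<in>{1..k}. W_col d j)" unfolding W_cols using i by blast
  have nV: "?w \<notin> (\<Union>j\<in>{0..k}. V_col j)" unfolding V_cols[of k d] using Vp_neq_Wp by blast
  have nW: "?v \<notin> (\<Union>j\<in>{1..k}. W_col d j)" unfolding W_cols using Vp_neq_Wp by blast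
  have vw: "?v \<in> verts k d" "?w \<in> verts k d" unfolding verts_def using V W by blast+
  have "end_col d i c = i \<or> end_col d i c = Suc i" by (auto simp: end_col_def)
  then show "e \<in> edges k d"
  proof
    assume "end_col d i c = i"
    then have "?w - ?v \<in> {(1, 0), (1/2, 1/2), (1/2, - (1/2))}" by (subst Wp_minus_Vp_iff) auto
    moreover have "e = {?v, ?w}" unfolding e edge_def by blast
    ultimately show ?thesis unfolding edges_def using vw V W by blast
  next
    assume "end_col d i c = Suc i"
    then have "?v - ?w \<in> {(1, 0), (1/2, 1/2), (1/2, - (1/2))}" by (subst Vp_minus_Wp_iff) auto
    moreover have "e = {?w, ?v}" unfolding e edge_def by blast
    ultimately show ?thesis unfolding edges_def using vw nV nW by blast
  qed
qed

lemma verts_V [simp]: "Vp d j n \<in> verts k d \<longleftrightarrow> j \<le> k"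
  and verts_W [simp]: "Wp d j n \<in> verts k d \<longleftrightarrow> j < k"
  by (auto simp: verts_eq)

lemma V_col_V [simp]: "Vp d j n \<in> V_col i \<longleftrightarrow> i = j"
  and V_col_W [simp]: "Wp d j n \<notin> V_col i"
  by (auto simp: V_col_eq[of i d])

section \<open>Faces\<close>

text \<open>No edge is vertical, so every segment is the graph of an affine function of the
  abscissa; the slopes that occur are 0, 1 and -1.\<close>

lemma hull_segment_graph:
  fixes x0 x1 y0 y1 m :: real
  assumes "x0 < x1" "y1 - y0 = m * (x1 - x0)"
  shows "(x, y) \<in> convex hull {(x0, y0), (x1, y1)} \<longleftrightarrow> x0 \<le> x \<and> x \<le> x1 \<and> y = y0 + m * (x - x0)"
proof -
  have "(x, y) \<in> closed_segment (x0, y0) (x1, y1) \<longleftrightarrow>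
     (\<exists>u. 0 \<le> u \<and> u \<le> 1 \<and> x = x0 + u * (x1 - x0) \<and> y = y0 + u * (y1 - y0))"
    unfolding in_segment by (auto simp: algebra_simps)
  also have "\<dots> \<longleftrightarrow> x0 \<le> x \<and> x \<le> x1 \<and> y = y0 + m * (x - x0)"
  proof
    assume "\<exists>u. 0 \<le> u \<and> u \<le> 1 \<and> x = x0 + u * (x1 - x0) \<and> y = y0 + u * (y1 - y0)"
    then obtain u where u: "0 \<le> u" "u \<le> 1" "x = x0 + u * (x1 - x0)" "y = y0 + u * (y1 - y0)" by blast
    have "u * (x1 - x0) \<ge> 0" "u * (x1 - x0) \<le> x1 - x0"
      using u assms(1) by (auto intro: mult_left_le_one_le)
    then show "x0 \<le> x \<and> x \<le> x1 \<and> y = y0 + m * (x - x0)" using u assms(2) by simp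
  next
    assume *: "x0 \<le> x \<and> x \<le> x1 \<and> y = y0 + m * (x - x0)"
    define u where "u = (x - x0) / (x1 - x0)"
    have u: "u * (x1 - x0) = x - x0" using assms(1) by (simp add: u_def)
    have "0 \<le> u" "u \<le> 1" using * assms(1) by (auto simp: u_def divide_simps)
    moreover have "y = y0 + u * (y1 - y0)" using * unfolding assms(2) by (simp add: u[symmetric] ac_simps)
    ultimately show "\<exists>u. 0 \<le> u \<and> u \<le> 1 \<and> x = x0 + u * (x1 - x0) \<and> y = y0 + u * (y1 - y0)" using u
      by (intro exI[of _ u]) auto
  qed
  finally show ?thesis by (simp add: segment_convex_hull)
qed

lemma hull_edge_unprimed:
  assumes "\<not> primed (d (Suc j))"
  shows "(x, y) \<in> convex hull (edge d j n Hz) \<longleftrightarrow> 3/2 * real j + 1/2 \<le> x \<and> x \<le> 3/2 * real j + 3/2 \<and>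
      y = Y_ord d (Suc j) + real_of_int n + 1/2"
    "(x, y) \<in> convex hull (edge d j n Up) \<longleftrightarrow> 3/2 * real j \<le> x \<and> x \<le> 3/2 * real j + 1/2 \<and>
      y = Y_ord d (Suc j) + real_of_int n + 1 - (x - 3/2 * real j)"
    "(x, y) \<in> convex hull (edge d j n Dn) \<longleftrightarrow> 3/2 * real j \<le> x \<and> x \<le> 3/2 * real j + 1/2 \<and>
      y = Y_ord d (Suc j) + real_of_int n + (x - 3/2 * real j)"
proof -
  let ?X = "3/2 * real j" and ?c = "Y_ord d (Suc j) + real_of_int n"
  have e: "edge d j n Hz = {(?X + 1/2, ?c + 1/2), (?X + 3/2, ?c + 1/2)}"
    "edge d j n Up = {(?X, ?c + 1), (?X + 1/2, ?c + 1/2)}" "edge d j n Dn = {(?X, ?c), (?X + 1/2, ?c + 1/2)}"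
    using assms by (auto simp: edge_def Wp_def Vp_def end_col_def end_idx_def Y_Suc field_simps)
  show "(x, y) \<in> convex hull (edge d j n Hz) \<longleftrightarrow> ?X + 1/2 \<le> x \<and> x \<le> ?X + 3/2 \<and> y = ?c + 1/2"
    unfolding e by (subst hull_segment_graph[where m = 0]) auto
  show "(x, y) \<in> convex hull (edge d j n Up) \<longleftrightarrow> ?X \<le> x \<and> x \<le> ?X + 1/2 \<and> y = ?c + 1 - (x - ?X)"
    unfolding e by (subst hull_segment_graph[where m = "-1"]) auto
  show "(x, y) \<in> convex hull (edge d j n Dn) \<longleftrightarrow> ?X \<le> x \<and> x \<le> ?X + 1/2 \<and> y = ?c + (x - ?X)"
    unfolding e by (subst hull_segment_graph[where m = 1]) auto
qed

lemma hull_edge_primed: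
  assumes "primed (d (Suc j))"
  shows "(x, y) \<in> convex hull (edge d j n Hz) \<longleftrightarrow> 3/2 * real j \<le> x \<and> x \<le> 3/2 * real j + 1 \<and>
      y = Y_ord d j + real_of_int n + 1/2"
    "(x, y) \<in> convex hull (edge d j n Up) \<longleftrightarrow> 3/2 * real j + 1 \<le> x \<and> x \<le> 3/2 * real j + 3/2 \<and>
      y = Y_ord d j + real_of_int n + 1/2 + (x - (3/2 * real j + 1))"
    "(x, y) \<in> convex hull (edge d j n Dn) \<longleftrightarrow> 3/2 * real j + 1 \<le> x \<and> x \<le> 3/2 * real j + 3/2 \<and>
      y = Y_ord d j + real_of_int n + 1/2 - (x - (3/2 * real j + 1))"
proof -
  let ?X = "3/2 * real j" and ?c = "Y_ord d j + real_of_int n"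
  have e: "edge d j n Hz = {(?X, ?c + 1/2), (?X + 1, ?c + 1/2)}"
    "edge d j n Up = {(?X + 1, ?c + 1/2), (?X + 3/2, ?c + 1)}" "edge d j n Dn = {(?X + 1, ?c + 1/2), (?X + 3/2, ?c)}"
    using assms by (auto simp: edge_def Wp_def Vp_def end_col_def end_idx_def Y_Suc field_simps)
  show "(x, y) \<in> convex hull (edge d j n Hz) \<longleftrightarrow> ?X \<le> x \<and> x \<le> ?X + 1 \<and> y = ?c + 1/2"
    unfolding e by (subst hull_segment_graph[where m = 0]) auto
  show "(x, y) \<in> convex hull (edge d j n Up) \<longleftrightarrow> ?X + 1 \<le> x \<and> x \<le> ?X + 3/2 \<and> y = ?c + 1/2 + (x - (?X + 1))"
    unfolding e by (subst hull_segment_graph[where m = 1]) auto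
  show "(x, y) \<in> convex hull (edge d j n Dn) \<longleftrightarrow> ?X + 1 \<le> x \<and> x \<le> ?X + 3/2 \<and> y = ?c + 1/2 - (x - (?X + 1))"
    unfolding e by (subst hull_segment_graph[where m = "-1"]) auto
qed

lemma hull_edge_strip:
  assumes "(x, y) \<in> convex hull (edge d j n c)"
  shows "3/2 * real j \<le> x" "x \<le> 3/2 * real j + 3/2"
  using assms by (cases "primed (d (Suc j))"; cases c; auto simp: hull_edge_primed hull_edge_unprimed)+

lemma vertex_on_edge:
  assumes "k \<ge> 1" "v \<in> verts k d"
  obtains j n c where "j < k" "v \<in> edge d j n c"
proof -
  from assms(2) consider (V) i m where "v = Vp d i m" "i < k" | (last) m where "v = Vp d k m" | (W) i m where "v = Wp d i m" "i < k"
    unfolding verts_eq by (auto simp: le_less)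
  then show ?thesis
  proof cases
    case V
    show ?thesis
    proof (cases "primed (d (Suc i))")
      case True
      then have "v \<in> edge d i m Hz" using V by (simp add: edge_def end_col_def end_idx_def)
      then show ?thesis using that V by blast
    next
      case False
      then have "v \<in> edge d i (m - shift (d (Suc i))) Up" using V by (simp add: edge_def end_col_def end_idx_def)
      then show ?thesis using that V by blast
    qed
  next
    case last
    obtain i where i: "k = Suc i" using assms(1) by (cases k) auto
    show ?thesis
    proof (cases "primed (d (Suc i))")
      case False
      then have "v \<in> edge d i m Hz" using last i by (simp add: edge_def end_col_def end_idx_def)
      then show ?thesis using that i by blast
    next
      case True
      then have "v \<in> edge d i (m - shift (d (Suc i))) Up" using last i by (simp add: edge_def end_col_def end_idx_def)
      then show ?thesis using that i by blast
    qed
  next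
    case W
    then have "v \<in> edge d i m Hz" by (simp add: edge_def)
    then show ?thesis using that W by blast
  qed
qed

lemma drawing_iff:
  assumes "k \<ge> 1"
  shows "z \<in> drawing k d \<longleftrightarrow> (\<exists>j n c. j < k \<and> z \<in> convex hull (edge d j n c))"
proof
  assume "z \<in> drawing k d"
  then consider "z \<in> verts k d" | "z \<in> (\<Union>e\<in>edges k d. convex hull e)" unfolding drawing_def by blast
  then show "\<exists>j n c. j < k \<and> z \<in> convex hull (edge d j n c)"
  proof cases
    case 1
    then obtain j n c where "j < k" "z \<in> edge d j n c" using vertex_on_edge[OF assms] by metis
    then show ?thesis using hull_inc by metis
  qed (auto simp: edges_eq)
next
  assume "\<exists>j n c. j < k \<and> z \<in> convex hull (edge d j n c)"
  then show "z \<in> drawing k d" unfolding drawing_def edges_eq by blast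
qed

section \<open>Cells, their convexity and closure\<close>

text \<open>The distance from the centre line of a face to its left tip. If \<open>d j\<close> is
  primed, the tip is a vertex of the \<open>W\<close>-column at distance 1/2; otherwise two
  horizontal edges of length 1 come first and the tip is a vertex of the previous
  \<open>V\<close>-column at distance 3/2. The right side is the mirror image.\<close>

definition ext_left :: "(nat \<Rightarrow> diamond) \<Rightarrow> nat \<Rightarrow> real" where
  "ext_left d j = (if primed (d j) then 1/2 else 3/2)"

definition ext_right :: "(nat \<Rightarrow> diamond) \<Rightarrow> nat \<Rightarrow> real" where
  "ext_right d j = (if primed (d (Suc j)) then 3/2 else 1/2)"

text \<open>
  The face around \<open>(3j/2, Y\<^sub>j + n)\<close>, between the vertices \<open>n - 1\<close> and \<open>n\<close> of \<open>V\<^sub>j\<close>. For \<open>j = 0\<close> and \<open>j = k\<close> the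
  condition towards the outside is dropped, so that these cells are unbounded.
\<close>

definition cell :: "nat \<Rightarrow> (nat \<Rightarrow> diamond) \<Rightarrow> nat \<Rightarrow> int \<Rightarrow> point set" where
  "cell k d j n = {(x, y). \<bar>y - (Y_ord d j + real_of_int n)\<bar> < 1/2 \<and>
     (0 < j \<longrightarrow> \<bar>y - (Y_ord d j + real_of_int n)\<bar> < x - 3/2 * real j + ext_left d j) \<and>
     (j < k \<longrightarrow> \<bar>y - (Y_ord d j + real_of_int n)\<bar> < 3/2 * real j + ext_right d j - x)}"

definition closed_cell :: "nat \<Rightarrow> (nat \<Rightarrow> diamond) \<Rightarrow> nat \<Rightarrow> int \<Rightarrow> point set" where
  "closed_cell k d j n = {(x, y). \<bar>y - (Y_ord d j + real_of_int n)\<bar> \<le> 1/2 \<and>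
     (0 < j \<longrightarrow> \<bar>y - (Y_ord d j + real_of_int n)\<bar> \<le> x - 3/2 * real j + ext_left d j) \<and>
     (j < k \<longrightarrow> \<bar>y - (Y_ord d j + real_of_int n)\<bar> \<le> 3/2 * real j + ext_right d j - x)}"

lemma ext_bounds: "1/2 \<le> ext_left d j" "ext_left d j \<le> 3/2" "1/2 \<le> ext_right d j" "ext_right d j \<le> 3/2"
  by (auto simp: ext_left_def ext_right_def)

lemma ext_sum: "ext_right d j + ext_left d (Suc j) = 2"
  by (simp add: ext_left_def ext_right_def)

lemma open_cell: "open (cell k d j n)"
proof -
  have "open {z :: point. \<bar>snd z - (Y_ord d j + real_of_int n)\<bar> < 1/2 \<and>
     (0 < j \<longrightarrow> \<bar>snd z - (Y_ord d j + real_of_int n)\<bar> < fst z - 3/2 * real j + ext_left d j) \<and>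
     (j < k \<longrightarrow> \<bar>snd z - (Y_ord d j + real_of_int n)\<bar> < 3/2 * real j + ext_right d j - fst z)}"
    by (intro open_Collect_conj open_Collect_imp open_Collect_less closed_Collect_const continuous_intros)
  then show ?thesis unfolding cell_def case_prod_beta .
qed

lemma closed_closed_cell: "closed (closed_cell k d j n)"
proof -
  have "closed {z :: point. \<bar>snd z - (Y_ord d j + real_of_int n)\<bar> \<le> 1/2 \<and>
     (0 < j \<longrightarrow> \<bar>snd z - (Y_ord d j + real_of_int n)\<bar> \<le> fst z - 3/2 * real j + ext_left d j) \<and>
     (j < k \<longrightarrow> \<bar>snd z - (Y_ord d j + real_of_int n)\<bar> \<le> 3/2 * real j + ext_right d j - fst z)}"
    by (intro closed_Collect_conj closed_Collect_imp closed_Collect_le open_Collect_const continuous_intros)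
  then show ?thesis unfolding closed_cell_def case_prod_beta .
qed

lemma abs_convex_comb:
  fixes a b u :: real
  assumes "0 \<le> u" "u \<le> 1"
  shows "\<bar>(1 - u) * a + u * b\<bar> \<le> (1 - u) * \<bar>a\<bar> + u * \<bar>b\<bar>"
  using assms abs_triangle_ineq[of "(1 - u) * a" "u * b"] by (simp add: abs_mult)

text \<open>The absolute value is convex, and the strict inequalities at \<open>p\<close> survive
  because \<open>p\<close> has positive weight. This one fact gives both the convexity of the cell
  and, along segments from the centre, its closure.\<close>

lemma cell_comb:
  assumes p: "p \<in> cell k d j n" and z: "z \<in> closed_cell k d j n" and u: "0 \<le> u" "u < 1"
  shows "(1 - u) *\<^sub>R p + u *\<^sub>R z \<in> cell k d j n"
proof -
  obtain p1 p2 z1 z2 where pz: "p = (p1, p2)" "z = (z1, z2)" by fastforce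
  let ?c = "Y_ord d j + real_of_int n"
  let ?y = "(1 - u) * p2 + u * z2" and ?x = "(1 - u) * p1 + u * z1"
  have "?y - ?c = (1 - u) * (p2 - ?c) + u * (z2 - ?c)" by (simp add: algebra_simps)
  then have abs: "\<bar>?y - ?c\<bar> \<le> (1 - u) * \<bar>p2 - ?c\<bar> + u * \<bar>z2 - ?c\<bar>" using abs_convex_comb[of u] u by simp
  have lt: "(1 - u) * \<bar>p2 - ?c\<bar> + u * \<bar>z2 - ?c\<bar> < (1 - u) * a + u * b" if "\<bar>p2 - ?c\<bar> < a" "\<bar>z2 - ?c\<bar> \<le> b" for a b
    using that u by (intro add_less_le_mono mult_strict_left_mono mult_left_mono) auto
  have "\<bar>?y - ?c\<bar> < (1 - u) * (1/2) + u * (1/2)"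
    using p z unfolding pz cell_def closed_cell_def by (intro le_less_trans[OF abs lt]) auto
  then have "\<bar>?y - ?c\<bar> < 1/2" by (simp add: field_simps)
  moreover have "\<bar>?y - ?c\<bar> < ?x - 3/2 * real j + ext_left d j" if "0 < j"
  proof -
    have "\<bar>?y - ?c\<bar> < (1 - u) * (p1 - 3/2 * real j + ext_left d j) + u * (z1 - 3/2 * real j + ext_left d j)"
      using p z that unfolding pz cell_def closed_cell_def by (intro le_less_trans[OF abs lt]) auto
    also have "\<dots> = ?x - 3/2 * real j + ext_left d j" by (simp add: field_simps)
    finally show ?thesis .
  qed
  moreover have "\<bar>?y - ?c\<bar> < 3/2 * real j + ext_right d j - ?x" if "j < k"
  proof -
    have "\<bar>?y - ?c\<bar> < (1 - u) * (3/2 * real j + ext_right d j - p1) + u * (3/2 * real j + ext_right d j - z1)"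
      using p z that unfolding pz cell_def closed_cell_def by (intro le_less_trans[OF abs lt]) auto
    also have "\<dots> = 3/2 * real j + ext_right d j - ?x" by (simp add: field_simps)
    finally show ?thesis .
  qed
  ultimately show ?thesis unfolding pz cell_def by simp
qed

lemma cell_subset_closed: "cell k d j n \<subseteq> closed_cell k d j n"
  unfolding cell_def closed_cell_def by auto

lemma convex_cell: "convex (cell k d j n)"
  unfolding convex_alt
proof (intro ballI allI impI)
  fix x y u assume *: "x \<in> cell k d j n" "y \<in> cell k d j n" "0 \<le> u \<and> u \<le> (1 :: real)"
  show "(1 - u) *\<^sub>R x + u *\<^sub>R y \<in> cell k d j n"
    using cell_comb[OF *(1) subsetD[OF cell_subset_closed *(2)], of u] * by (cases "u = 1") auto
qed

lemma centre_in_cell: "(3/2 * real j, Y_ord d j + real_of_int n) \<in> cell k d j n"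
  using ext_bounds[of d j] by (auto simp: cell_def)

lemma closure_cell: "closure (cell k d j n) = closed_cell k d j n"
proof
  show "closure (cell k d j n) \<subseteq> closed_cell k d j n"
    by (rule closure_minimal[OF cell_subset_closed closed_closed_cell])
  show "closed_cell k d j n \<subseteq> closure (cell k d j n)"
  proof
    fix z assume z: "z \<in> closed_cell k d j n"
    define p :: point where "p = (3/2 * real j, Y_ord d j + real_of_int n)"
    let ?s = "\<lambda>i. (1 - (1 - inverse (real (Suc i)))) *\<^sub>R p + (1 - inverse (real (Suc i))) *\<^sub>R z"
    have "?s i \<in> cell k d j n" for i
      unfolding p_def by (rule cell_comb[OF centre_in_cell z]) (auto simp: field_simps)
    moreover have "?s \<longlonglongrightarrow> (1 - (1 - 0)) *\<^sub>R p + (1 - 0) *\<^sub>R z"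
      by (intro tendsto_intros LIMSEQ_inverse_real_of_nat)
    ultimately show "z \<in> closure (cell k d j n)" unfolding closure_sequential by (intro exI[of _ ?s]) auto
  qed
qed

text \<open>Relative to the centre of a cell, edges lie at an unknown integer offset; these cases
  are how integrality enters the linear arithmetic over the reals.\<close>

lemma int_real_cases:
  "real_of_int q \<ge> 0 \<or> real_of_int q \<le> -1" "real_of_int q \<ge> 1 \<or> real_of_int q = 0 \<or> real_of_int q \<le> -1"
  by (cases "q \<ge> 0"; cases "q = 0"; auto)+

lemma half_integer_abs: "\<bar>real_of_int q + 1/2\<bar> \<ge> 1/2"
  by (cases "q \<ge> 0") auto

text \<open>For adjacent columns the two extents add up to 2 over a distance of 3/2, so the two
  vertical distances sum to less than 1/2, whereas the centres differ in height by an odd multiple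
  of 1/2. Columns two or more apart are separated by their extents alone.\<close>

lemma cells_disjoint:
  assumes "z \<in> cell k d j n" "z \<in> cell k d i m" "j \<le> k" "i \<le> k"
  shows "j = i \<and> n = m"
  using assms
proof (induction j i arbitrary: n m rule: linorder_wlog)
  case (sym a b)
  then show ?case by blast
next
  case (le j i)
  obtain x y where z: "z = (x, y)" by fastforce
  consider "i = j" | "i = Suc j" | "i \<ge> Suc (Suc j)" using le by linarith
  then show ?case
  proof cases
    case 1
    have "\<bar>y - (Y_ord d j + real_of_int n)\<bar> < 1/2" "\<bar>y - (Y_ord d j + real_of_int m)\<bar> < 1/2"
      using le unfolding z 1 cell_def by simp_all
    then have "\<bar>real_of_int (n - m)\<bar> < 1" by linarith
    then have "n = m" by linarith
    then show ?thesis using 1 by simp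
  next
    case 2
    let ?s = "shift (d (Suc j))"
    have near: "\<bar>y - (Y_ord d j + real_of_int n)\<bar> < 3/2 * real j + ext_right d j - x"
      "\<bar>y - (Y_ord d (Suc j) + real_of_int m)\<bar> < x - 3/2 * real (Suc j) + ext_left d (Suc j)"
      using le unfolding z 2 cell_def by (auto)
    have "\<bar>y - (Y_ord d j + real_of_int n)\<bar> + \<bar>y - (Y_ord d (Suc j) + real_of_int m)\<bar> < 1/2"
    proof -
      have "a + b < 1/2" if "a < X + r - x" "b < x - X' + l" "r + l = 2" "X' = X + 3/2" for a b X X' r l :: real
        using that by linarith
      from this[OF near ext_sum[of d j]] show ?thesis by (simp)
    qed
    then have lt: "\<bar>Y_ord d (Suc j) + real_of_int m - (Y_ord d j + real_of_int n)\<bar> < 1/2"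
      by linarith
    show ?thesis
    proof (cases "primed (d (Suc j))")
      case True
      then have "\<bar>real_of_int (m - n - ?s) + 1/2\<bar> < 1/2" using lt by (simp add: Y_Suc algebra_simps)
      then show ?thesis using half_integer_abs[of "m - n - ?s"] by linarith
    next
      case False
      then have "\<bar>real_of_int (m - n + ?s - 1) + 1/2\<bar> < 1/2" using lt by (simp add: Y_Suc algebra_simps)
      then show ?thesis using half_integer_abs[of "m - n + ?s - 1"] by linarith
    qed
  next
    case 3
    then have "real i \<ge> real j + 2" by linarith
    moreover have "x < 3/2 * real j + ext_right d j" "3/2 * real i - ext_left d i < x"
      using le 3 unfolding z cell_def by auto
    ultimately show ?thesis using ext_bounds[of d j] ext_bounds[of d i] by linarith
  qed
qed

text \<open>Only the two strips next to the centre line can meet the cell. There the height of the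
  edge over the centre is an integer \<open>q\<close>, up to a function of the abscissa, and the
  inequalities of the cell exclude every value of \<open>q\<close>.\<close>

lemma cell_disjoint_edge:
  assumes z: "z \<in> cell k d j n" and e: "z \<in> convex hull (edge d i m c)" and "j \<le> k" "i < k"
  shows False
proof -
  obtain x y where xy: "z = (x, y)" by fastforce
  have x: "3/2 * real i \<le> x" "x \<le> 3/2 * real i + 3/2" using hull_edge_strip e unfolding xy by blast+
  let ?c = "Y_ord d j + real_of_int n"
  have half: "\<bar>y - ?c\<bar> < 1/2" using z unfolding xy cell_def by simp
  have left: "\<bar>y - ?c\<bar> < x - 3/2 * real j + ext_left d j" if "0 < j" using z that unfolding xy cell_def by simp
  have right: "\<bar>y - ?c\<bar> < 3/2 * real j + ext_right d j - x" if "j < k" using z that unfolding xy cell_def by simp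
  have "i = j \<or> Suc i = j"
  proof (rule ccontr)
    assume "\<not> ?thesis"
    then consider "i \<ge> Suc j" | "j \<ge> i + 2" by linarith
    then show False
    proof cases
      case 1
      then have "real i \<ge> real j + 1" "j < k" using \<open>i < k\<close> by linarith+
      then show ?thesis using right x ext_bounds(4)[of d j] by force
    next
      case 2
      then have "real j \<ge> real i + 2" "0 < j" by linarith+
      then show ?thesis using left x ext_bounds(2)[of d j] by force
    qed
  qed
  then show False
  proof
    assume ij: "i = j"
    let ?t = "x - 3/2 * real j" and ?s = "shift (d (Suc j))"
    have "j < k" using ij \<open>i < k\<close> by simp
    note right = right[OF this]
    have t: "0 \<le> ?t" using x ij by simp
    show False
    proof (cases "primed (d (Suc j))")
      case True
      define q where "q = m - n"
      have b: "ext_right d j = 3/2" using True by (simp add: ext_right_def)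
      have y: "(c = Hz \<and> y - ?c = real_of_int q + 1/2) \<or> (c = Up \<and> y - ?c = real_of_int q + ?t - 1/2 \<and> ?t \<ge> 1)
         \<or> (c = Dn \<and> y - ?c = real_of_int q + 3/2 - ?t \<and> ?t \<ge> 1)"
        using e True unfolding xy ij by (cases c) (auto simp: hull_edge_primed q_def)
      have "real_of_int q \<ge> 0 \<or> real_of_int q \<le> -1" by (rule int_real_cases)
      then show False using y half right b t by (elim disjE conjE) linarith+
    next
      case False
      define q where "q = m - n + ?s"
      have b: "ext_right d j = 1/2" using False by (simp add: ext_right_def)
      have y: "(c = Hz \<and> ?t \<ge> 1/2) \<or> (c = Up \<and> y - ?c = real_of_int q + 1/2 - ?t)
         \<or> (c = Dn \<and> y - ?c = real_of_int q - 1/2 + ?t)"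
        using e False unfolding xy ij by (cases c) (auto simp: hull_edge_unprimed q_def Y_Suc)
      have "real_of_int q \<ge> 1 \<or> real_of_int q = 0 \<or> real_of_int q \<le> -1" by (rule int_real_cases)
      then show False using y half right b t by (elim disjE conjE) linarith+
    qed
  next
    assume ij: "Suc i = j"
    let ?t = "x - 3/2 * real i" and ?s = "shift (d (Suc i))"
    have "0 < j" using ij by simp
    note left = left[OF this]
    have t: "0 \<le> ?t" "?t \<le> 3/2" using x by auto
    have X: "3/2 * real j = 3/2 * real i + 3/2" using ij by auto
    show False
    proof (cases "primed (d (Suc i))")
      case True
      define q where "q = m - n + ?s"
      have b: "ext_left d j = 1/2" using True ij by (simp add: ext_left_def)
      have y: "(c = Hz \<and> ?t \<le> 1) \<or> (c = Up \<and> y - ?c = real_of_int q + ?t - 1)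
         \<or> (c = Dn \<and> y - ?c = real_of_int q + 1 - ?t)"
        using e True unfolding xy ij[symmetric] by (cases c) (auto simp: hull_edge_primed q_def Y_Suc)
      have "real_of_int q \<ge> 1 \<or> real_of_int q = 0 \<or> real_of_int q \<le> -1" by (rule int_real_cases)
      then show False using y half left b t X by (elim disjE conjE) linarith+
    next
      case False
      define q where "q = m - n"
      have b: "ext_left d j = 3/2" using False ij by (simp add: ext_left_def)
      have y: "(c = Hz \<and> y - ?c = real_of_int q + 1/2) \<or> (c = Up \<and> y - ?c = real_of_int q + 1 - ?t \<and> ?t \<le> 1/2)
         \<or> (c = Dn \<and> y - ?c = real_of_int q + ?t \<and> ?t \<le> 1/2)"
        using e False unfolding xy ij[symmetric] by (cases c) (auto simp: hull_edge_unprimed q_def)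
      have "real_of_int q \<ge> 0 \<or> real_of_int q \<le> -1" by (rule int_real_cases)
      then show False using y half left b t X by (elim disjE conjE) linarith+
    qed
  qed
qed

lemma cellI:
  assumes "\<bar>y - (Y_ord d j + real_of_int n)\<bar> < 1/2"
    "0 < j \<Longrightarrow> \<bar>y - (Y_ord d j + real_of_int n)\<bar> < x - 3/2 * real j + ext_left d j"
    "j < k \<Longrightarrow> \<bar>y - (Y_ord d j + real_of_int n)\<bar> < 3/2 * real j + ext_right d j - x"
  shows "(x, y) \<in> cell k d j n"
  using assms by (simp add: cell_def)

lemma nearest_integer:
  obtains m :: int where "\<bar>y - (a + real_of_int m)\<bar> \<le> 1/2"
proof -
  have "\<bar>real_of_int (round (y - a)) - (y - a)\<bar> \<le> 1/2" by (rule of_int_round_abs_le)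
  then show ?thesis by (intro that[of "round (y - a)"]) linarith
qed

text \<open>Let \<open>u\<close> be the height over the nearest centre level of the column at which
  the horizontal edges end. Comparing \<open>\<bar>u\<bar>\<close> with the distance from the
  opposite side of the strip tells a cell of that column from one of the other column, equality
  being a diagonal edge; \<open>\<bar>u\<bar> = 1/2\<close> gives the horizontal edges.\<close>

lemma strip_covered:
  assumes i: "i < k" and x: "3/2 * real i \<le> x" "x \<le> 3/2 * real i + 3/2"
  shows "(\<exists>n c. (x, y) \<in> convex hull (edge d i n c)) \<or> (\<exists>j n. j \<le> k \<and> (x, y) \<in> cell k d j n)"
proof -
  let ?t = "x - 3/2 * real i" and ?s = "shift (d (Suc i))"
  have X: "3/2 * real (Suc i) = 3/2 * real i + 3/2" by simp
  have "i \<le> k" "Suc i \<le> k" using i by auto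
  show ?thesis
  proof (cases "primed (d (Suc i))")
    case False
    let ?Y = "Y_ord d (Suc i)"
    obtain m where m: "\<bar>y - (?Y + real_of_int m)\<bar> \<le> 1/2" by (rule nearest_integer)
    define u where "u = y - (?Y + real_of_int m)"
    have ext: "ext_right d i = 1/2" "ext_left d (Suc i) = 3/2" using False by (simp_all add: ext_right_def ext_left_def)
    have c1: "Y_ord d i + real_of_int (?s + m) = ?Y + real_of_int m + 1/2"
      and c2: "Y_ord d i + real_of_int (?s + m - 1) = ?Y + real_of_int m - 1/2"
      using False by (simp_all add: Y_Suc)
    note H = hull_edge_unprimed[where d = d and j = i, OF False]
    consider "u = 1/2" "?t \<ge> 1/2" | "u = -1/2" "?t \<ge> 1/2" | "\<bar>u\<bar> \<le> 1/2" "\<bar>u\<bar> > ?t" "u > 0" | "\<bar>u\<bar> \<le> 1/2" "\<bar>u\<bar> > ?t" "u < 0"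
      | "\<bar>u\<bar> < 1/2" "\<bar>u\<bar> < ?t" | "u = ?t" "?t \<le> 1/2" | "u = - ?t" "?t \<le> 1/2"
      using m x unfolding u_def[symmetric] by linarith
    then show ?thesis
    proof cases
      case 1
      then have "(x, y) \<in> convex hull (edge d i m Hz)" unfolding H using x by (simp add: u_def)
      then show ?thesis by blast
    next
      case 2
      then have "(x, y) \<in> convex hull (edge d i (m - 1) Hz)" unfolding H using x by (simp add: u_def)
      then show ?thesis by blast
    next
      case 3
      then have "(x, y) \<in> cell k d i (?s + m)"
        using x ext_bounds(1)[of d i] by (intro cellI; unfold c1 ext; unfold u_def) linarith+
      then show ?thesis using \<open>i \<le> k\<close> by blast
    next
      case 4
      then have "(x, y) \<in> cell k d i (?s + m - 1)"
        using x ext_bounds(1)[of d i] by (intro cellI; unfold c2 ext; unfold u_def) linarith+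
      then show ?thesis using \<open>i \<le> k\<close> by blast
    next
      case 5
      then have "(x, y) \<in> cell k d (Suc i) m"
        using x ext_bounds(3)[of d "Suc i"] X ext unfolding u_def by (intro cellI) linarith+
      then show ?thesis using \<open>Suc i \<le> k\<close> by blast
    next
      case 6
      then have "(x, y) \<in> convex hull (edge d i m Dn)" unfolding H using x unfolding u_def by linarith
      then show ?thesis by blast
    next
      case 7
      then have "(x, y) \<in> convex hull (edge d i (m - 1) Up)" unfolding H using x unfolding u_def by simp
      then show ?thesis by blast
    qed
  next
    case True
    let ?Y = "Y_ord d i"
    obtain m where m: "\<bar>y - (?Y + real_of_int m)\<bar> \<le> 1/2" by (rule nearest_integer)
    define u where "u = y - (?Y + real_of_int m)"
    have ext: "ext_right d i = 3/2" "ext_left d (Suc i) = 1/2" using True by (simp_all add: ext_right_def ext_left_def)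
    have c1: "Y_ord d (Suc i) + real_of_int (?s + m) = ?Y + real_of_int m + 1/2"
      and c2: "Y_ord d (Suc i) + real_of_int (?s + m - 1) = ?Y + real_of_int m - 1/2"
      using True by (simp_all add: Y_Suc)
    note H = hull_edge_primed[where d = d and j = i, OF True]
    let ?r = "3/2 - ?t"
    consider "u = 1/2" "?t \<le> 1" | "u = -1/2" "?t \<le> 1" | "\<bar>u\<bar> \<le> 1/2" "\<bar>u\<bar> > ?r" "u > 0" | "\<bar>u\<bar> \<le> 1/2" "\<bar>u\<bar> > ?r" "u < 0"
      | "\<bar>u\<bar> < 1/2" "\<bar>u\<bar> < ?r" | "u = ?r" "?r \<le> 1/2" | "u = - ?r" "?r \<le> 1/2"
      using m x unfolding u_def[symmetric] by linarith
    then show ?thesis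
    proof cases
      case 1
      then have "(x, y) \<in> convex hull (edge d i m Hz)" unfolding H using x by (simp add: u_def)
      then show ?thesis by blast
    next
      case 2
      then have "(x, y) \<in> convex hull (edge d i (m - 1) Hz)" unfolding H using x by (simp add: u_def)
      then show ?thesis by blast
    next
      case 3
      then have "(x, y) \<in> cell k d (Suc i) (?s + m)"
        using x X ext_bounds(3)[of d "Suc i"] by (intro cellI; unfold c1 ext; unfold u_def) linarith+
      then show ?thesis using \<open>Suc i \<le> k\<close> by blast
    next
      case 4
      then have "(x, y) \<in> cell k d (Suc i) (?s + m - 1)"
        using x X ext_bounds(3)[of d "Suc i"] by (intro cellI; unfold c2 ext; unfold u_def) linarith+
      then show ?thesis using \<open>Suc i \<le> k\<close> by blast
    next
      case 5
      then have "(x, y) \<in> cell k d i m"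
        using x ext_bounds(1)[of d i] ext unfolding u_def by (intro cellI) linarith+
      then show ?thesis using \<open>i \<le> k\<close> by blast
    next
      case 6
      then have "(x, y) \<in> convex hull (edge d i m Dn)" unfolding H using x unfolding u_def by linarith
      then show ?thesis by blast
    next
      case 7
      then have "(x, y) \<in> convex hull (edge d i (m - 1) Up)" unfolding H using x unfolding u_def by simp
      then show ?thesis by blast
    qed
  qed
qed

lemma plane_covered:
  assumes k: "k \<ge> 1"
  obtains "x < 0" | "x > 3/2 * real k" | "(x, y) \<in> drawing k d" | j n where "j \<le> k" "(x, y) \<in> cell k d j n"
proof (cases "0 \<le> x \<and> x \<le> 3/2 * real k")
  case True
  \<comment> \<open>The minimum with \<open>k - 1\<close> matters only on the right border, whose
    abscissa belongs to the last strip.\<close>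
  define i where "i = min (k - 1) (nat \<lfloor>2/3 * x\<rfloor>)"
  have i: "i < k" using k by (auto simp: i_def)
  have fl: "real (nat \<lfloor>2/3 * x\<rfloor>) \<le> 2/3 * x" "2/3 * x < real (nat \<lfloor>2/3 * x\<rfloor>) + 1"
  proof -
    have "real (nat \<lfloor>2/3 * x\<rfloor>) = real_of_int \<lfloor>2/3 * x\<rfloor>" using True by simp
    then show "real (nat \<lfloor>2/3 * x\<rfloor>) \<le> 2/3 * x" "2/3 * x < real (nat \<lfloor>2/3 * x\<rfloor>) + 1"
      using of_int_floor_le[of "2/3 * x"] floor_less_cancel real_of_int_floor_add_one_gt[of "2/3 * x"] by linarith+
  qed
  have "real i \<le> real (nat \<lfloor>2/3 * x\<rfloor>)" by (simp add: i_def)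
  then have 1: "3/2 * real i \<le> x" using fl by linarith
  have 2: "x \<le> 3/2 * real i + 3/2"
  proof (cases "nat \<lfloor>2/3 * x\<rfloor> \<le> k - 1")
    case True
    then have "i = nat \<lfloor>2/3 * x\<rfloor>" by (simp add: i_def)
    then show ?thesis using fl by linarith
  next
    case False
    then have "i = k - 1" by (simp add: i_def)
    then have "real i = real k - 1" using k by simp
    then show ?thesis using True by linarith
  qed
  show ?thesis using strip_covered[OF i 1 2, of y d] drawing_iff[OF k] i that by blast
next
  case False
  then show ?thesis using that(1,2) by linarith
qed

section \<open>The cells as bounded components of the complement\<close>

lemma cell_inter_drawing:
  assumes "k \<ge> 1" "j \<le> k"
  shows "cell k d j n \<inter> drawing k d = {}"
  using cell_disjoint_edge[of _ k d j n] assms drawing_iff[OF assms(1)] by blast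

lemma frontier_cell: "frontier (cell k d j n) = closed_cell k d j n - cell k d j n"
  unfolding frontier_def closure_cell using open_cell interior_open by blast

text \<open>A frontier point off the drawing would lie in some cell; being open, that cell would
  meet the given one and so coincide with it, but an open set contains none of its frontier.\<close>

lemma frontier_cell_subset:
  assumes k: "k \<ge> 1" and j: "0 < j" "j < k"
  shows "frontier (cell k d j n) \<subseteq> drawing k d"
proof
  fix z assume z: "z \<in> frontier (cell k d j n)"
  obtain x y where xy: "z = (x, y)" by fastforce
  have zc: "z \<in> closed_cell k d j n" "z \<notin> cell k d j n" using z unfolding frontier_cell by auto
  have "real j \<ge> 1" "real j \<le> real k - 1" using j by linarith+
  moreover have "\<bar>y - (Y_ord d j + real_of_int n)\<bar> \<le> x - 3/2 * real j + ext_left d j"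
     "\<bar>y - (Y_ord d j + real_of_int n)\<bar> \<le> 3/2 * real j + ext_right d j - x"
    using zc(1) j unfolding xy closed_cell_def by auto
  ultimately have x: "\<not> x < 0" "\<not> x > 3/2 * real k" using ext_bounds[of d j] by linarith+
  show "z \<in> drawing k d"
  proof (rule plane_covered[OF k, where x = x and y = y and d = d])
    fix i m assume im: "i \<le> k" "(x, y) \<in> cell k d i m"
    have "cell k d i m \<inter> closure (cell k d j n) \<noteq> {}" using im zc(1) unfolding closure_cell xy by blast
    then have "cell k d i m \<inter> cell k d j n \<noteq> {}" using open_Int_closure_eq_empty[OF open_cell] by blast
    then have "i = j \<and> m = n" using cells_disjoint[of _ k d i m j n] im j by auto
    then show ?thesis using im zc(2) xy by blast
  qed (use x xy in auto)
qed

text \<open>A larger connected set would have to cross the frontier of the cell, which belongs to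
  the drawing.\<close>

lemma cell_component:
  assumes k: "k \<ge> 1" and j: "0 < j" "j < k"
  shows "cell k d j n \<in> components (- drawing k d)"
  unfolding in_components_maximal
proof (intro conjI allI impI)
  show "cell k d j n \<noteq> {}" using centre_in_cell by blast
  show "cell k d j n \<subseteq> - drawing k d" using cell_inter_drawing[OF k, of j d n] j by auto
  show "connected (cell k d j n)" by (rule convex_connected[OF convex_cell])
  fix S assume S: "S \<noteq> {} \<and> cell k d j n \<subseteq> S \<and> S \<subseteq> - drawing k d \<and> connected S"
  show "S = cell k d j n"
  proof (rule ccontr)
    assume "S \<noteq> cell k d j n"
    then have "S \<inter> cell k d j n \<noteq> {}" "S - cell k d j n \<noteq> {}" using S centre_in_cell by blast+
    then have "S \<inter> frontier (cell k d j n) \<noteq> {}" using connected_Int_frontier S by blast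
    then show False using frontier_cell_subset[OF k j, of d n] S by blast
  qed
qed

lemma bounded_cell:
  assumes j: "0 < j" "j < k"
  shows "bounded (cell k d j n)"
proof (rule bounded_subset)
  let ?c = "Y_ord d j + real_of_int n"
  show "bounded ({3/2 * real j - 3/2..3/2 * real j + 3/2} \<times> {?c - 1/2..?c + 1/2})"
    by (intro bounded_Times bounded_closed_interval)
  show "cell k d j n \<subseteq> {3/2 * real j - 3/2..3/2 * real j + 3/2} \<times> {?c - 1/2..?c + 1/2}"
  proof clarify
    fix x y assume "(x, y) \<in> cell k d j n"
    then have "\<bar>y - ?c\<bar> < 1/2" "\<bar>y - ?c\<bar> < x - 3/2 * real j + ext_left d j" "\<bar>y - ?c\<bar> < 3/2 * real j + ext_right d j - x"
      using j unfolding cell_def by auto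
    then show "x \<in> {3/2 * real j - 3/2..3/2 * real j + 3/2} \<and> y \<in> {?c - 1/2..?c + 1/2}"
      using ext_bounds[of d j] unfolding atLeastAtMost_iff by (intro conjI) linarith+
  qed
qed

lemma not_bounded_if_far_points:
  assumes "\<And>r. \<exists>z\<in>S. fst z \<le> - r \<or> fst z \<ge> (r :: real)"
  shows "\<not> bounded (S :: point set)"
proof
  assume "bounded S"
  then obtain B where B: "\<And>z. z \<in> S \<Longrightarrow> norm z \<le> B" unfolding bounded_iff by blast
  obtain z where z: "z \<in> S" "fst z \<le> - (B + 1) \<or> fst z \<ge> B + 1" using assms[of "B + 1"] by blast
  have "\<bar>fst z\<bar> \<le> norm z" using norm_fst_le[of "fst z" "snd z"] by simp
  then show False using B[OF z(1)] z(2) by linarith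
qed

lemma drawing_range:
  assumes k: "k \<ge> 1" and "z \<in> drawing k d"
  shows "0 \<le> fst z" "fst z \<le> 3/2 * real k"
proof -
  obtain j n c where j: "j < k" "z \<in> convex hull (edge d j n c)" using assms drawing_iff by blast
  have "real j \<le> real k - 1" "0 \<le> real j" using j by linarith+
  then show "0 \<le> fst z" "fst z \<le> 3/2 * real k"
    using hull_edge_strip[of "fst z" "snd z" d j n c] j by (auto simp: algebra_simps)
qed

text \<open>A component contains every connected set of the complement that it meets. Applied to
  unbounded sets, this excludes the outer half-planes and the cells of the outer columns.\<close>

lemma bounded_component_meets:
  assumes "F \<in> components (- D)" "bounded F" "connected S" "S \<subseteq> - D" "z \<in> F" "z \<in> S"
  shows "bounded S"
proof -
  have "S \<subseteq> F" using components_maximal[OF assms(1,3,4)] assms(5,6) by blast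
  then show ?thesis using assms(2) bounded_subset by blast
qed

theorem bounded_faces_eq:
  assumes k: "k \<ge> 1"
  shows "bounded_faces k d = {cell k d j n | j n. 0 < j \<and> j < k}"
proof (intro set_eqI iffI)
  fix F assume "F \<in> {cell k d j n | j n. 0 < j \<and> j < k}"
  then show "F \<in> bounded_faces k d" unfolding bounded_faces_def using cell_component[OF k] bounded_cell by blast
next
  fix F assume "F \<in> bounded_faces k d"
  then have F: "F \<in> components (- drawing k d)" "bounded F" unfolding bounded_faces_def by auto
  obtain z where z: "z \<in> F" using in_components_nonempty[OF F(1)] by blast
  obtain x y where xy: "z = (x, y)" by fastforce
  have zD: "z \<notin> drawing k d" using in_components_subset[OF F(1)] z by blast
  show "F \<in> {cell k d j n | j n. 0 < j \<and> j < k}"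
  proof (rule plane_covered[OF k, where x = x and y = y and d = d])
    assume "x < 0"
    let ?S = "{z :: point. fst z < 0}"
    have "connected ?S"
    proof -
      have "?S = {..<0} \<times> UNIV" by auto
      then show ?thesis by (simp add: connected_Times)
    qed
    moreover have "?S \<subseteq> - drawing k d" using drawing_range[OF k] by force
    ultimately have "bounded ?S" using bounded_component_meets[OF F _ _ z] \<open>x < 0\<close> xy by auto
    moreover have "\<not> bounded ?S"
    proof (rule not_bounded_if_far_points)
      show "\<exists>z\<in>?S. fst z \<le> - r \<or> fst z \<ge> r" for r
        by (rule bexI[of _ "(min (- r) (- 1), 0)"]) auto
    qed
    ultimately show ?thesis by blast
  next
    assume "x > 3/2 * real k"
    let ?S = "{z :: point. fst z > 3/2 * real k}"
    have "connected ?S"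
    proof -
      have "?S = {3/2 * real k<..} \<times> UNIV" by auto
      then show ?thesis by (simp add: connected_Times)
    qed
    moreover have "?S \<subseteq> - drawing k d" using drawing_range[OF k] by force
    ultimately have "bounded ?S" using bounded_component_meets[OF F _ _ z] \<open>x > _\<close> xy by auto
    moreover have "\<not> bounded ?S"
    proof (rule not_bounded_if_far_points)
      show "\<exists>z\<in>?S. fst z \<le> - r \<or> fst z \<ge> r" for r
        by (rule bexI[of _ "(max r (3/2 * real k + 1), 0)"]) (auto simp: max_def)
    qed
    ultimately show ?thesis by blast
  next
    fix j n assume jn: "j \<le> k" "(x, y) \<in> cell k d j n"
    let ?c = "Y_ord d j + real_of_int n"
    have sub: "cell k d j n \<subseteq> - drawing k d" using cell_inter_drawing[OF k jn(1), of d n] by blast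
    have con: "connected (cell k d j n)" by (rule convex_connected[OF convex_cell])
    have bd: "bounded (cell k d j n)" using bounded_component_meets[OF F con sub z] jn xy by simp
    have "j \<noteq> 0"
    proof
      assume "j = 0"
      have "\<not> bounded (cell k d j n)"
      proof (rule not_bounded_if_far_points)
        fix r
        have "(min (- r) 0, ?c) \<in> cell k d j n"
          using ext_bounds(3)[of d j] \<open>j = 0\<close> by (intro cellI) auto
        then show "\<exists>z\<in>cell k d j n. fst z \<le> - r \<or> fst z \<ge> r" by force
      qed
      then show False using bd by blast
    qed
    moreover have "j \<noteq> k"
    proof
      assume "j = k"
      have "\<not> bounded (cell k d j n)"
      proof (rule not_bounded_if_far_points)
        fix r
        have "(max r (3/2 * real k), ?c) \<in> cell k d j n"
          using ext_bounds(1)[of d j] \<open>j = k\<close> by (intro cellI) auto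
        then show "\<exists>z\<in>cell k d j n. fst z \<le> - r \<or> fst z \<ge> r" by force
      qed
      then show False using bd by blast
    qed
    ultimately have j: "0 < j" "j < k" using jn(1) by auto
    have "F = cell k d j n"
      using components_eq[OF F(1) cell_component[OF k j, of d n]] z jn xy by blast
    then show ?thesis using j by blast
  qed (use zD xy in auto)
qed

section \<open>The boundary of a cell\<close>

lemma quarter_facts:
  "\<bar>real_of_int q + 1/2\<bar> \<le> 1/2 \<longleftrightarrow> q \<in> {-1, 0}"
  "\<bar>real_of_int q\<bar> \<le> 0 \<longleftrightarrow> q = 0"
proof -
  have "\<bar>real_of_int q + 1/2\<bar> \<le> 1/2 \<longleftrightarrow> -1 \<le> q \<and> q \<le> 0" by linarith
  then show "\<bar>real_of_int q + 1/2\<bar> \<le> 1/2 \<longleftrightarrow> q \<in> {-1, 0}" by auto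
qed simp

lemma closed_cell_bounds:
  assumes "(x, y) \<in> closed_cell k d j n" "0 < j" "j < k"
  shows "3/2 * real j - ext_left d j \<le> x" "x \<le> 3/2 * real j + ext_right d j"
  using assms unfolding closed_cell_def by auto

lemma V_in_closed_cell:
  assumes j: "0 < j" "j < k"
  shows "Vp d i m \<in> closed_cell k d j n \<longleftrightarrow>
    (i = j \<and> m \<in> {n - 1, n}) \<or>
    (Suc i = j \<and> \<not> primed (d j) \<and> m = n + shift (d j) - 1) \<or>
    (i = Suc j \<and> primed (d (Suc j)) \<and> m = n + shift (d (Suc j)) - 1)"
proof -
  consider "i = j" | "Suc i = j" | "i = Suc j" | "i + 2 \<le> j" | "j + 2 \<le> i" by linarith
  then show ?thesis
  proof cases
    case 1
    have "Vp d i m \<in> closed_cell k d j n \<longleftrightarrow> \<bar>real_of_int (m - n) + 1/2\<bar> \<le> 1/2"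
      using ext_bounds[of d j] 1 by (auto simp: Vp_def closed_cell_def algebra_simps)
    then show ?thesis using 1 unfolding quarter_facts by auto
  next
    case 2
    let ?s = "shift (d j)"
    have Y: "Y_ord d j = (if primed (d j) then Y_ord d i + 1/2 - real_of_int ?s else Y_ord d i - 1/2 + real_of_int ?s)"
      using Y_Suc[of d i] 2 by simp
    have X: "3/2 * real i - 3/2 * real j = - 3/2" using 2 by auto
    show ?thesis
    proof (cases "primed (d j)")
      case True
      have "Vp d i m \<notin> closed_cell k d j n"
        using closed_cell_bounds(1)[of "fst (Vp d i m)" "snd (Vp d i m)" k d j n] j True X
        by (auto simp: Vp_def ext_left_def)
      then show ?thesis using True 2 by auto
    next
      case False
      have "Vp d i m \<in> closed_cell k d j n \<longleftrightarrow> \<bar>real_of_int (m - n - ?s + 1)\<bar> \<le> 0"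
        using j X False ext_bounds(3)[of d j]
        by (auto simp: Vp_def closed_cell_def ext_left_def Y)
      then show ?thesis using False 2 unfolding quarter_facts by auto
    qed
  next
    case 3
    let ?s = "shift (d (Suc j))"
    have Y: "Y_ord d i = (if primed (d (Suc j)) then Y_ord d j + 1/2 - real_of_int ?s else Y_ord d j - 1/2 + real_of_int ?s)"
      using Y_Suc[of d j] 3 by simp
    have X: "3/2 * real i - 3/2 * real j = 3/2" using 3 by (simp add: field_simps)
    show ?thesis
    proof (cases "primed (d (Suc j))")
      case False
      have "Vp d i m \<notin> closed_cell k d j n"
        using closed_cell_bounds(2)[of "fst (Vp d i m)" "snd (Vp d i m)" k d j n] j False X
        by (auto simp: Vp_def ext_right_def)
      then show ?thesis using False 3 by auto
    next
      case True
      have "Vp d i m \<in> closed_cell k d j n \<longleftrightarrow> \<bar>real_of_int (m - n - ?s + 1)\<bar> \<le> 0"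
        using j X True ext_bounds(1)[of d j]
        by (auto simp: Vp_def closed_cell_def ext_right_def Y)
      then show ?thesis using True 3 unfolding quarter_facts by auto
    qed
  next
    case 4
    then have "real i + 2 \<le> real j" by linarith
    then have "Vp d i m \<notin> closed_cell k d j n"
      using closed_cell_bounds(1)[of "fst (Vp d i m)" "snd (Vp d i m)" k d j n] j ext_bounds(2)[of d j]
      by (auto simp: Vp_def)
    then show ?thesis using 4 by auto
  next
    case 5
    then have "real j + 2 \<le> real i" by linarith
    then have "Vp d i m \<notin> closed_cell k d j n"
      using closed_cell_bounds(2)[of "fst (Vp d i m)" "snd (Vp d i m)" k d j n] j ext_bounds(4)[of d j]
      by (auto simp: Vp_def)
    then show ?thesis using 5 by auto
  qed
qed

lemma W_in_closed_cell:
  assumes j: "0 < j" "j < k"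
  shows "Wp d i m \<in> closed_cell k d j n \<longleftrightarrow>
    (Suc i = j \<and> (if primed (d j) then m = n - shift (d j) else m \<in> {n - 1, n})) \<or>
    (i = j \<and> (if primed (d (Suc j)) then m \<in> {n - 1, n} else m = n - shift (d (Suc j))))"
proof -
  have Wx: "3/2 * real i + 1/2 \<le> fst (Wp d i m)" "fst (Wp d i m) \<le> 3/2 * real i + 1"
    by (auto simp: Wp_def)
  consider "i = j" | "Suc i = j" | "j + 1 \<le> i" | "i + 2 \<le> j" by linarith
  then show ?thesis
  proof cases
    case 1
    let ?s = "shift (d (Suc j))"
    show ?thesis
    proof (cases "primed (d (Suc j))")
      case True
      have "Wp d i m \<in> closed_cell k d j n \<longleftrightarrow> \<bar>real_of_int (m - n) + 1/2\<bar> \<le> 1/2"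
        using ext_bounds[of d j] 1 True j by (auto simp: Wp_def closed_cell_def ext_right_def algebra_simps)
      then show ?thesis using 1 True unfolding quarter_facts by auto
    next
      case False
      have "Wp d i m \<in> closed_cell k d j n \<longleftrightarrow> \<bar>real_of_int (m - n + ?s)\<bar> \<le> 0"
        using ext_bounds[of d j] 1 False j by (auto simp: Wp_def closed_cell_def ext_right_def Y_Suc)
      then show ?thesis using 1 False unfolding quarter_facts by auto
    qed
  next
    case 2
    let ?s = "shift (d j)"
    have Y: "Y_ord d j = (if primed (d j) then Y_ord d i + 1/2 - real_of_int ?s else Y_ord d i - 1/2 + real_of_int ?s)"
      using Y_Suc[of d i] 2 by simp
    have X: "3/2 * real j = 3/2 * real i + 3/2" using 2 by auto
    show ?thesis
    proof (cases "primed (d j)")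
      case True
      have "Wp d i m \<in> closed_cell k d j n \<longleftrightarrow> \<bar>real_of_int (m - n + ?s)\<bar> \<le> 0"
        unfolding closed_cell_def X using ext_bounds[of d j] 2 True j by (auto simp: Wp_def ext_left_def Y)
      then show ?thesis using 2 True unfolding quarter_facts by auto
    next
      case False
      have "Wp d i m \<in> closed_cell k d j n \<longleftrightarrow> \<bar>real_of_int (m - n) + 1/2\<bar> \<le> 1/2"
        unfolding closed_cell_def X using ext_bounds[of d j] 2 False j by (auto simp: Wp_def ext_left_def algebra_simps)
      then show ?thesis using 2 False unfolding quarter_facts by auto
    qed
  next
    case 3
    then have "real j + 1 \<le> real i" by linarith
    then have "Wp d i m \<notin> closed_cell k d j n"
      using closed_cell_bounds(2)[of "fst (Wp d i m)" "snd (Wp d i m)" k d j n] j ext_bounds(4)[of d j] Wx by auto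
    then show ?thesis using 3 by auto
  next
    case 4
    then have "real i + 2 \<le> real j" by linarith
    then have "Wp d i m \<notin> closed_cell k d j n"
      using closed_cell_bounds(1)[of "fst (Wp d i m)" "snd (Wp d i m)" k d j n] j ext_bounds(2)[of d j] Wx by auto
    then show ?thesis using 4 by auto
  qed
qed

text \<open>The closed cell is convex and no edge enters the open cell, so it suffices to test the
  two endpoints.\<close>

lemma hull_in_frontier_iff:
  assumes "k \<ge> 1" "j \<le> k" "i < k"
  shows "convex hull (edge d i m c) \<subseteq> frontier (cell k d j n) \<longleftrightarrow> edge d i m c \<subseteq> closed_cell k d j n"
proof
  assume "convex hull (edge d i m c) \<subseteq> frontier (cell k d j n)"
  then have "edge d i m c \<subseteq> frontier (cell k d j n)" using hull_subset by (rule order_trans[rotated])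
  then show "edge d i m c \<subseteq> closed_cell k d j n" unfolding frontier_cell by blast
next
  assume "edge d i m c \<subseteq> closed_cell k d j n"
  then have "convex hull (edge d i m c) \<subseteq> closed_cell k d j n"
    using convex_closure[OF convex_cell] unfolding closure_cell by (rule hull_minimal)
  moreover have "z \<notin> cell k d j n" if "z \<in> convex hull (edge d i m c)" for z
    using cell_disjoint_edge[OF _ that assms(2,3)] by metis
  ultimately show "convex hull (edge d i m c) \<subseteq> frontier (cell k d j n)"
    unfolding frontier_cell by blast
qed

definition left_edges :: "(nat \<Rightarrow> diamond) \<Rightarrow> nat \<Rightarrow> int \<Rightarrow> (int \<times> kind) set" where
  "left_edges d j n = (if primed (d j) then {(n - shift (d j), Up), (n - shift (d j), Dn)}
     else {(n - 1, Hz), (n, Hz), (n - 1, Up), (n, Dn)})"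

definition right_edges :: "(nat \<Rightarrow> diamond) \<Rightarrow> nat \<Rightarrow> int \<Rightarrow> (int \<times> kind) set" where
  "right_edges d j n = (if primed (d (Suc j)) then {(n - 1, Hz), (n, Hz), (n - 1, Up), (n, Dn)}
     else {(n - shift (d (Suc j)), Up), (n - shift (d (Suc j)), Dn)})"

lemma edge_in_closed_cell:
  assumes j: "0 < j" "j < k"
  shows "edge d i m c \<subseteq> closed_cell k d j n \<longleftrightarrow>
    (Suc i = j \<and> (m, c) \<in> left_edges d j n) \<or> (i = j \<and> (m, c) \<in> right_edges d j n)"
proof -
  have "edge d i m c \<subseteq> closed_cell k d j n \<longleftrightarrow>
      Wp d i m \<in> closed_cell k d j n \<and> Vp d (end_col d i c) (end_idx d i m c) \<in> closed_cell k d j n"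
    by (simp add: edge_def)
  also have "\<dots> \<longleftrightarrow> (Suc i = j \<and> (m, c) \<in> left_edges d j n) \<or> (i = j \<and> (m, c) \<in> right_edges d j n)"
    unfolding W_in_closed_cell[OF j] V_in_closed_cell[OF j]
    by (cases c) (auto simp: end_col_def end_idx_def left_edges_def right_edges_def)
  finally show ?thesis .
qed

theorem face_edges_cell:
  assumes j: "0 < j" "j < k"
  shows "face_edges k d (cell k d j n) =
    {edge d (j - 1) m c | m c. (m, c) \<in> left_edges d j n} \<union> {edge d j m c | m c. (m, c) \<in> right_edges d j n}"
proof -
  have "face_edges k d (cell k d j n) = {edge d i m c | i m c. i < k \<and> edge d i m c \<subseteq> closed_cell k d j n}"
    (is "_ = ?R")
  proof (intro set_eqI)
    fix e
    have "e \<in> face_edges k d (cell k d j n) \<longleftrightarrow>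
        (\<exists>i m c. e = edge d i m c \<and> i < k \<and> convex hull (edge d i m c) \<subseteq> frontier (cell k d j n))"
      unfolding face_edges_def edges_eq by blast
    also have "\<dots> \<longleftrightarrow> (\<exists>i m c. e = edge d i m c \<and> i < k \<and> edge d i m c \<subseteq> closed_cell k d j n)"
      by (intro ex_cong1 conj_cong refl hull_in_frontier_iff) (use j in auto)
    finally show "e \<in> face_edges k d (cell k d j n) \<longleftrightarrow> e \<in> ?R" by blast
  qed
  also have "\<dots> = {edge d (j - 1) m c | m c. (m, c) \<in> left_edges d j n} \<union> {edge d j m c | m c. (m, c) \<in> right_edges d j n}"
  proof (intro set_eqI iffI)
    fix e assume "e \<in> {edge d i m c | i m c. i < k \<and> edge d i m c \<subseteq> closed_cell k d j n}"
    then obtain i m c where e: "e = edge d i m c" "edge d i m c \<subseteq> closed_cell k d j n" by blast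
    from e(2) show "e \<in> {edge d (j - 1) m c | m c. (m, c) \<in> left_edges d j n} \<union> {edge d j m c | m c. (m, c) \<in> right_edges d j n}"
      unfolding edge_in_closed_cell[OF j] e(1) by auto
  next
    fix e assume "e \<in> {edge d (j - 1) m c | m c. (m, c) \<in> left_edges d j n} \<union> {edge d j m c | m c. (m, c) \<in> right_edges d j n}"
    then consider m c where "e = edge d (j - 1) m c" "(m, c) \<in> left_edges d j n" | m c where "e = edge d j m c" "(m, c) \<in> right_edges d j n"
      by blast
    then show "e \<in> {edge d i m c | i m c. i < k \<and> edge d i m c \<subseteq> closed_cell k d j n}"
    proof cases
      case 1
      moreover have "edge d (j - 1) m c \<subseteq> closed_cell k d j n" unfolding edge_in_closed_cell[OF j] using 1 j by auto
      moreover have "j - 1 < k" using j by auto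
      ultimately show ?thesis by blast
    next
      case 2
      moreover have "edge d j m c \<subseteq> closed_cell k d j n" unfolding edge_in_closed_cell[OF j] using 2 j by auto
      ultimately show ?thesis using j by blast
    qed
  qed
  finally show ?thesis .
qed

text \<open>The boundary has two vertices on the centre line and, in any other
  \<open>V\<close>-column, at most the tip of the face, so the column with two vertices is
  unique.\<close>

theorem face_abscissa_cell:
  assumes j: "0 < j" "j < k"
  shows "face_abscissa k d (cell k d j n) = 3/2 * real j"
proof -
  have k: "k \<ge> 1" using j by simp
  have col: "face_verts k d (cell k d j n) \<inter> V_col i = V_col i \<inter> closed_cell k d j n" if i: "i \<le> k" for i
  proof -
    have "V_col i \<subseteq> verts k d" using i unfolding verts_def by auto
    moreover have "verts k d \<inter> cell k d j n = {}"
      using cell_inter_drawing[OF k, of j d n] j unfolding drawing_def by auto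
    ultimately show ?thesis unfolding face_verts_def frontier_cell by blast
  qed
  have "(THE i. i \<le> k \<and> card (face_verts k d (cell k d j n) \<inter> V_col i) = 2) = j"
  proof (rule the_equality)
    have "V_col j \<inter> closed_cell k d j n = {Vp d j (n - 1), Vp d j n}"
      unfolding V_col_eq[of j d] using V_in_closed_cell[OF j, of d j _ n] by auto
    then show "j \<le> k \<and> card (face_verts k d (cell k d j n) \<inter> V_col j) = 2"
      using col[of j] j by simp
  next
    fix i assume i: "i \<le> k \<and> card (face_verts k d (cell k d j n) \<inter> V_col i) = 2"
    show "i = j"
    proof (rule ccontr)
      assume "i \<noteq> j"
      then have "\<exists>v. V_col i \<inter> closed_cell k d j n \<subseteq> {v}"
        unfolding V_col_eq[of i d] using V_in_closed_cell[OF j, of d i _ n]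
        by (intro exI[of _ "Vp d i (n + shift (d (if i = Suc j then Suc j else j)) - 1)"]) auto
      then obtain v where "V_col i \<inter> closed_cell k d j n \<subseteq> {v}" by blast
      from card_mono[OF _ this] show False using col[of i] i by simp
    qed
  qed
  then show ?thesis by (simp add: face_abscissa_def)
qed

section \<open>Matchings from height functions\<close>

text \<open>
  Every edge separates two cells, and \<open>edge_ind\<close> is their height difference, normalized so that the value \<open>1\<close>
  means that the edge is in the matching and \<open>0\<close> that it is not.
\<close>

definition edge_ind :: "(nat \<Rightarrow> diamond) \<Rightarrow> (nat \<Rightarrow> int \<Rightarrow> int) \<Rightarrow> nat \<Rightarrow> int \<Rightarrow> kind \<Rightarrow> int" where
  "edge_ind d H j n c = (let s = shift (d (Suc j)) in
     if primed (d (Suc j)) then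
       (case c of Hz \<Rightarrow> 1 - H j n + H j (n + 1) | Up \<Rightarrow> H (Suc j) (n + s) - H j (n + 1) | Dn \<Rightarrow> H j n - H (Suc j) (n + s))
     else
       (case c of Hz \<Rightarrow> H (Suc j) n - H (Suc j) (n + 1) | Up \<Rightarrow> H (Suc j) (n + 1) - H j (n + s) + 1 - s
         | Dn \<Rightarrow> H j (n + s) - H (Suc j) n + s))"

definition matching_of :: "nat \<Rightarrow> (nat \<Rightarrow> diamond) \<Rightarrow> (nat \<Rightarrow> int \<Rightarrow> int) \<Rightarrow> edge set" where
  "matching_of k d H = {edge d j n c | j n c. j < k \<and> edge_ind d H j n c = 1}"

text \<open>The edges of strip \<open>j\<close> that end at \<open>Vp d (Suc j) m\<close>; the
  companion \<open>in_right d j m\<close> collects those ending at \<open>Vp d j m\<close>. The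
  first thus concerns the right border of the strip, the second the left one.\<close>

definition in_left :: "(nat \<Rightarrow> diamond) \<Rightarrow> nat \<Rightarrow> int \<Rightarrow> (int \<times> kind) set" where
  "in_left d j m = (if primed (d (Suc j)) then {(m - shift (d (Suc j)), Up), (m - shift (d (Suc j)) + 1, Dn)} else {(m, Hz)})"

definition in_right :: "(nat \<Rightarrow> diamond) \<Rightarrow> nat \<Rightarrow> int \<Rightarrow> (int \<times> kind) set" where
  "in_right d j m = (if primed (d (Suc j)) then {(m, Hz)} else {(m - shift (d (Suc j)), Up), (m - shift (d (Suc j)) + 1, Dn)})"

lemma edge_in_matching_of [simp]:
  "edge d j n c \<in> matching_of k d H \<longleftrightarrow> j < k \<and> edge_ind d H j n c = 1"
  unfolding matching_of_def by (auto simp: edge_eq_iff)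

text \<open>Around a vertex of a \<open>W\<close>-column the height differences cancel and only the
  normalizing constants remain.\<close>

lemma edge_ind_sum: "edge_ind d H j n Hz + edge_ind d H j n Up + edge_ind d H j n Dn = 1"
  by (simp add: edge_ind_def Let_def)

lemma end_iff:
  "end_col d j c = i \<and> end_idx d j n c = m \<longleftrightarrow> (Suc j = i \<and> (n, c) \<in> in_left d j m) \<or> (j = i \<and> (n, c) \<in> in_right d j m)"
  by (cases c) (auto simp: end_col_def end_idx_def in_left_def in_right_def)

lemma V_in_edge_iff:
  "Vp d i m \<in> edge d j n c \<longleftrightarrow> (Suc j = i \<and> (n, c) \<in> in_left d j m) \<or> (j = i \<and> (n, c) \<in> in_right d j m)"
  unfolding end_iff[symmetric] edge_def by auto

lemma W_in_edge_iff: "Wp d i m \<in> edge d j n c \<longleftrightarrow> i = j \<and> m = n"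
  by (auto simp: edge_def)

text \<open>Summed over the edges to the left of a vertex of a \<open>V\<close>-column, the values
  give the particle indicator; the edges to its right give the hole indicator. Together they make
  1.\<close>

lemma in_left_sum: "(\<Sum>(n, c)\<in>in_left d j m. edge_ind d H j n c) = H (Suc j) m - H (Suc j) (m + 1)"
  by (simp add: in_left_def edge_ind_def Let_def)

lemma in_right_sum: "(\<Sum>(n, c)\<in>in_right d j m. edge_ind d H j n c) = 1 - H j m + H j (m + 1)"
  by (simp add: in_right_def edge_ind_def Let_def)

lemma finite_in [simp]: "finite (in_left d j m)" "finite (in_right d j m)"
  by (auto simp: in_left_def in_right_def)

text \<open>Up to index shifts, the two interlacing inequalities of a strip are the nonnegativity of
  its two families of diagonal edges.\<close>

lemma step_iff_edge_ind:
  "step (d (Suc j)) (H j) (H (Suc j)) \<longleftrightarrow> (\<forall>n. 0 \<le> edge_ind d H j n Up \<and> 0 \<le> edge_ind d H j n Dn)"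
proof -
  have sh: "(\<forall>y. P (y :: int)) \<longleftrightarrow> (\<forall>y. P (y + 1))" "(\<forall>y. P (y :: int)) \<longleftrightarrow> (\<forall>y. P (y - 1))" for P
    by (metis diff_add_cancel) (metis add_diff_cancel)
  show ?thesis
  proof (cases "d (Suc j)")
    case Prec
    have "(\<forall>y. H j y \<le> H (Suc j) y) \<longleftrightarrow> (\<forall>y. H j (y + 1) \<le> H (Suc j) (y + 1))" by (rule sh)
    moreover have "0 \<le> H j (n + 1) - H (Suc j) n + 1 \<longleftrightarrow> H (Suc j) n \<le> H j (n + 1) + 1" for n by auto
    ultimately show ?thesis using Prec by (auto simp: edge_ind_def Let_def primed_def shift_def)
  next
    case Succ
    have "(\<forall>y. H j y \<le> H (Suc j) (y + 1) + 1) \<longleftrightarrow> (\<forall>y. H j y - 1 \<le> H (Suc j) (y + 1))" by (auto simp: algebra_simps)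
    then show ?thesis using Succ by (auto simp: edge_ind_def Let_def primed_def shift_def algebra_simps)
  next
    case Prec'
    have "(\<forall>y. H j y \<le> H (Suc j) y) \<longleftrightarrow> (\<forall>y. H j (y + 1) \<le> H (Suc j) (y + 1))" by (rule sh)
    moreover have "(\<forall>y. H (Suc j) y \<le> H j (y - 1)) \<longleftrightarrow> (\<forall>y. H (Suc j) (y + 1) \<le> H j (y + 1 - 1))" by (rule sh)
    ultimately show ?thesis using Prec' by (auto simp: edge_ind_def Let_def primed_def shift_def)
  next
    case Succ'
    have "(\<forall>y. H j y \<le> H (Suc j) (y - 1)) \<longleftrightarrow> (\<forall>y. H j (y + 1) \<le> H (Suc j) (y + 1 - 1))" by (rule sh)
    then show ?thesis using Succ' by (auto simp: edge_ind_def Let_def primed_def shift_def)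
  qed
qed

lemma edge_ind_nonneg:
  assumes H: "H \<in> Config k d" and j: "j < k"
  shows "0 \<le> edge_ind d H j n c"
proof (cases c)
  case Hz
  have "profile (H j)" "profile (H (Suc j))" using H by (auto simp: Config_def)
  then show ?thesis using Hz profile_lip[of "H j" n] profile_dec[of "H (Suc j)" n]
    by (auto simp: edge_ind_def Let_def)
qed (use assms step_iff_edge_ind[of d j H] in \<open>auto simp: Config_def\<close>)

text \<open>Three nonnegative integers with sum 1 are each 0 or 1.\<close>

lemma edge_ind_cases:
  assumes "H \<in> Config k d" "j < k"
  shows "edge_ind d H j n c = 0 \<or> edge_ind d H j n c = 1"
  using edge_ind_nonneg[OF assms, of n Hz] edge_ind_nonneg[OF assms, of n Up] edge_ind_nonneg[OF assms, of n Dn] edge_ind_sum[of d H j n]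
  by (cases c; hypsubst; arith)

text \<open>Nonnegativity of the edge values already contains the profile conditions: summing over
  the edges to the left of a vertex gives monotonicity, over those to its right the bound on the
  slope.\<close>

lemma ConfigI:
  assumes fin: "\<And>j. \<exists>N. \<forall>y. N \<le> \<bar>y\<bar> \<longrightarrow> H j y = ground y"
    and H0: "H 0 = ground" and Hk: "\<And>j. k \<le> j \<Longrightarrow> H j = ground"
    and edge_ind: "\<And>j n c. j < k \<Longrightarrow> 0 \<le> edge_ind d H j n c"
  shows "H \<in> Config k d"
proof -
  have "profile (H j)" for j
  proof (cases "0 < j \<and> j < k")
    case True
    then obtain i where i: "j = Suc i" "i < k" by (cases j) auto
    have "H j (y + 1) \<le> H j y" for y
    proof -
      have "0 \<le> (\<Sum>(n, c)\<in>in_left d i y. edge_ind d H i n c)" by (rule sum_nonneg) (use edge_ind i in auto)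
      then show ?thesis unfolding in_left_sum i by simp
    qed
    moreover have "H j y \<le> H j (y + 1) + 1" for y
    proof -
      have "0 \<le> (\<Sum>(n, c)\<in>in_right d j y. edge_ind d H j n c)" by (rule sum_nonneg) (use edge_ind True in auto)
      then show ?thesis unfolding in_right_sum by simp
    qed
    ultimately show ?thesis using fin[of j] by (auto simp: profile_def)
  next
    case False
    then have "H j = ground" using H0 Hk[of j] by (cases "j = 0") auto
    then show ?thesis using profile_ground by simp
  qed
  moreover have "step (d (Suc j)) (H j) (H (Suc j))" if "j < k" for j
    unfolding step_iff_edge_ind using edge_ind that by blast
  ultimately show ?thesis using H0 Hk by (auto simp: Config_def)
qed

section \<open>Vertices covered by the matching of a height function\<close>

lemma sum_01_unique:
  fixes f :: "'a \<Rightarrow> int"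
  assumes "finite A" "\<And>x. x \<in> A \<Longrightarrow> 0 \<le> f x" "sum f A \<le> 1" "x \<in> A" "y \<in> A" "f x = 1" "f y = 1"
  shows "x = y"
proof (rule ccontr)
  assume "x \<noteq> y"
  then have "sum f {x, y} = 2" using assms by simp
  moreover have "sum f {x, y} \<le> sum f A" using assms by (intro sum_mono2) auto
  ultimately show False using assms by simp
qed

lemma sum_01_ex:
  fixes f :: "'a \<Rightarrow> int"
  assumes "\<And>x. x \<in> A \<Longrightarrow> f x = 0 \<or> f x = 1" "finite A" "sum f A \<le> 1"
  shows "(\<exists>x\<in>A. f x = 1) \<longleftrightarrow> sum f A = 1"
proof
  assume "\<exists>x\<in>A. f x = 1"
  then obtain x where x: "x \<in> A" "f x = 1" by blast
  have "f x \<le> sum f A" by (rule member_le_sum) (use x assms in force)+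
  then show "sum f A = 1" using assms(3) x by simp
next
  assume "sum f A = 1"
  then have "sum f A \<noteq> 0" by simp
  then obtain x where "x \<in> A" "f x \<noteq> 0" by (rule sum.not_neutral_contains_not_neutral)
  then show "\<exists>x\<in>A. f x = 1" using assms(1) by blast
qed

lemma left_matched_iff:
  assumes H: "H \<in> Config k d" and j: "j < k"
  shows "(\<exists>(n, c)\<in>in_left d j m. edge_ind d H j n c = 1) \<longleftrightarrow> H (Suc j) m - H (Suc j) (m + 1) = 1"
proof -
  have "profile (H (Suc j))" using H by (auto simp: Config_def)
  then show ?thesis
    using sum_01_ex[of "in_left d j m" "\<lambda>(n, c). edge_ind d H j n c"] edge_ind_cases[OF H j] profile_lip[of "H (Suc j)" m]
    unfolding in_left_sum by (auto simp: case_prod_beta)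
qed

lemma right_matched_iff:
  assumes H: "H \<in> Config k d" and j: "j < k"
  shows "(\<exists>(n, c)\<in>in_right d j m. edge_ind d H j n c = 1) \<longleftrightarrow> H j m = H j (m + 1)"
proof -
  have "profile (H j)" using H by (auto simp: Config_def)
  then show ?thesis
    using sum_01_ex[of "in_right d j m" "\<lambda>(n, c). edge_ind d H j n c"] edge_ind_cases[OF H j] profile_dec[of "H j" m]
    unfolding in_right_sum by (auto simp: case_prod_beta)
qed

lemma left_unique:
  assumes H: "H \<in> Config k d" and j: "j < k" and "(n, c) \<in> in_left d j m" "(n', c') \<in> in_left d j m"
    "edge_ind d H j n c = 1" "edge_ind d H j n' c' = 1"
  shows "n = n' \<and> c = c'"
proof -
  have "profile (H (Suc j))" using H by (auto simp: Config_def)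
  then show ?thesis
    using sum_01_unique[of "in_left d j m" "\<lambda>(n, c). edge_ind d H j n c" "(n, c)" "(n', c')"]
      assms edge_ind_nonneg[OF H j] profile_lip[of "H (Suc j)" m]
    unfolding in_left_sum by (auto simp: case_prod_beta)
qed

lemma right_unique:
  assumes H: "H \<in> Config k d" and j: "j < k" and "(n, c) \<in> in_right d j m" "(n', c') \<in> in_right d j m"
    "edge_ind d H j n c = 1" "edge_ind d H j n' c' = 1"
  shows "n = n' \<and> c = c'"
proof -
  have "profile (H j)" using H by (auto simp: Config_def)
  then show ?thesis
    using sum_01_unique[of "in_right d j m" "\<lambda>(n, c). edge_ind d H j n c" "(n, c)" "(n', c')"]
      assms edge_ind_nonneg[OF H j] profile_dec[of "H j" m]
    unfolding in_right_sum by (auto simp: case_prod_beta)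
qed

text \<open>At a \<open>W\<close>-vertex and on one side of a \<open>V\<close>-vertex, the values
  sum to at most 1. Chosen edges on both sides of a \<open>V\<close>-vertex would make it a particle
  and a hole at once.\<close>

lemma matching_unique:
  assumes H: "H \<in> Config k d" and e: "edge d j n c \<in> matching_of k d H" "edge d j' n' c' \<in> matching_of k d H"
    and v: "v \<in> edge d j n c" "v \<in> edge d j' n' c'"
  shows "j = j' \<and> n = n' \<and> c = c'"
proof -
  have j: "j < k" "j' < k" and i: "edge_ind d H j n c = 1" "edge_ind d H j' n' c' = 1" using e by auto
  have LR: False if "a < k" "Suc a < k" "(p, x) \<in> in_left d a m" "edge_ind d H a p x = 1" "(q, y) \<in> in_right d (Suc a) m" "edge_ind d H (Suc a) q y = 1"
    for a p x q y m
    using left_matched_iff[OF H that(1), of m] right_matched_iff[OF H that(2), of m] that by fastforce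
  from v(1) consider "v = Wp d j n" | a m where "v = Vp d a m" by (auto simp: edge_def)
  then show ?thesis
  proof cases
    case 1
    then have "j = j' \<and> n = n'" using v(2) W_in_edge_iff by metis
    moreover from this have "c = c'"
      using i edge_ind_nonneg[OF H j(1), of n Hz] edge_ind_nonneg[OF H j(1), of n Up] edge_ind_nonneg[OF H j(1), of n Dn] edge_ind_sum[of d H j n]
      by (cases c; cases c'; simp)
    ultimately show ?thesis by simp
  next
    case 2
    then consider "Suc j = a" "(n, c) \<in> in_left d j m" "Suc j' = a" "(n', c') \<in> in_left d j' m"
      | "Suc j = a" "(n, c) \<in> in_left d j m" "j' = a" "(n', c') \<in> in_right d j' m"
      | "j = a" "(n, c) \<in> in_right d j m" "Suc j' = a" "(n', c') \<in> in_left d j' m"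
      | "j = a" "(n, c) \<in> in_right d j m" "j' = a" "(n', c') \<in> in_right d j' m"
      using v V_in_edge_iff by metis
    then show ?thesis
    proof cases
      case 1
      then show ?thesis using left_unique[OF H j(1), of n c m n' c'] i by auto
    next
      case 2
      then show ?thesis using LR[of j n c m n' c'] i j by auto
    next
      case 3
      then show ?thesis using LR[of j' n' c' m n c] i j by auto
    next
      case 4
      then show ?thesis using right_unique[OF H j(1), of n c m n' c'] i by auto
    qed
  qed
qed

lemma matching_of_subset: "matching_of k d H \<subseteq> edges k d"
  unfolding matching_of_def edges_eq by blast

lemma V_covered_iff:
  assumes "M \<subseteq> edges k d" "i \<le> k"
  shows "Vp d i m \<in> \<Union>M \<longleftrightarrow>
    (\<exists>j n c. Suc j = i \<and> (n, c) \<in> in_left d j m \<and> edge d j n c \<in> M) \<or> (\<exists>n c. i < k \<and> (n, c) \<in> in_right d i m \<and> edge d i n c \<in> M)"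
proof
  assume "Vp d i m \<in> \<Union>M"
  then obtain e where e: "e \<in> M" "Vp d i m \<in> e" by blast
  then obtain j n c where jnc: "e = edge d j n c" "j < k" using assms unfolding edges_eq by blast
  then show "(\<exists>j n c. Suc j = i \<and> (n, c) \<in> in_left d j m \<and> edge d j n c \<in> M) \<or> (\<exists>n c. i < k \<and> (n, c) \<in> in_right d i m \<and> edge d i n c \<in> M)"
    using e V_in_edge_iff by metis
next
  assume "(\<exists>j n c. Suc j = i \<and> (n, c) \<in> in_left d j m \<and> edge d j n c \<in> M) \<or> (\<exists>n c. i < k \<and> (n, c) \<in> in_right d i m \<and> edge d i n c \<in> M)"
  then show "Vp d i m \<in> \<Union>M" using V_in_edge_iff by (metis UnionI)
qed

lemma fst_Wp: "fst (Wp d j n) < fst (Vp d (Suc j) m)" "fst (Vp d j m) < fst (Wp d j n)"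
  by (auto simp: Wp_def Vp_def)

lemma edge_other: "{Vp d i m, w} = edge d j n c \<longleftrightarrow> w = Wp d j n \<and> end_col d j c = i \<and> end_idx d j n c = m"
  by (auto simp: edge_def doubleton_eq_iff)

lemma ex_left_iff:
  assumes "M \<subseteq> edges k d"
  shows "(\<exists>w. {Vp d i m, w} \<in> M \<and> fst w < fst (Vp d i m)) \<longleftrightarrow>
    (\<exists>j n c. Suc j = i \<and> (n, c) \<in> in_left d j m \<and> edge d j n c \<in> M)"
proof
  assume "\<exists>w. {Vp d i m, w} \<in> M \<and> fst w < fst (Vp d i m)"
  then obtain w where w: "{Vp d i m, w} \<in> M" "fst w < fst (Vp d i m)" by blast
  then obtain j n c where jnc: "{Vp d i m, w} = edge d j n c" "j < k" using assms unfolding edges_eq by blast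
  then have "w = Wp d j n" "end_col d j c = i \<and> end_idx d j n c = m" unfolding edge_other by auto
  moreover have "j \<noteq> i" using w(2) fst_Wp(2)[of d j m n] \<open>w = _\<close> by auto
  ultimately have "Suc j = i \<and> (n, c) \<in> in_left d j m" unfolding end_iff by auto
  then show "\<exists>j n c. Suc j = i \<and> (n, c) \<in> in_left d j m \<and> edge d j n c \<in> M" using w(1) jnc(1) by metis
next
  assume "\<exists>j n c. Suc j = i \<and> (n, c) \<in> in_left d j m \<and> edge d j n c \<in> M"
  then obtain j n c where *: "Suc j = i" "(n, c) \<in> in_left d j m" "edge d j n c \<in> M" by blast
  then have "{Vp d i m, Wp d j n} = edge d j n c" unfolding edge_other using end_iff by blast
  then show "\<exists>w. {Vp d i m, w} \<in> M \<and> fst w < fst (Vp d i m)" using * fst_Wp(1) by metis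
qed

lemma ex_right_iff:
  assumes "M \<subseteq> edges k d"
  shows "(\<exists>w. {Vp d i m, w} \<in> M \<and> fst w > fst (Vp d i m)) \<longleftrightarrow> (\<exists>n c. i < k \<and> (n, c) \<in> in_right d i m \<and> edge d i n c \<in> M)"
proof
  assume "\<exists>w. {Vp d i m, w} \<in> M \<and> fst w > fst (Vp d i m)"
  then obtain w where w: "{Vp d i m, w} \<in> M" "fst w > fst (Vp d i m)" by blast
  then obtain j n c where jnc: "{Vp d i m, w} = edge d j n c" "j < k" using assms unfolding edges_eq by blast
  then have "w = Wp d j n" "end_col d j c = i \<and> end_idx d j n c = m" unfolding edge_other by auto
  moreover have "Suc j \<noteq> i" using w(2) fst_Wp(1)[of d j n m] \<open>w = _\<close> by auto
  ultimately have "j = i \<and> (n, c) \<in> in_right d j m" unfolding end_iff by auto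
  then show "\<exists>n c. i < k \<and> (n, c) \<in> in_right d i m \<and> edge d i n c \<in> M" using w(1) jnc by metis
next
  assume "\<exists>n c. i < k \<and> (n, c) \<in> in_right d i m \<and> edge d i n c \<in> M"
  then obtain n c where *: "(n, c) \<in> in_right d i m" "edge d i n c \<in> M" by blast
  then have "{Vp d i m, Wp d i n} = edge d i n c" unfolding edge_other using end_iff by blast
  then show "\<exists>w. {Vp d i m, w} \<in> M \<and> fst w > fst (Vp d i m)" using * fst_Wp(2) by metis
qed

lemma covered_of_config:
  assumes H: "H \<in> Config k d" and i: "i \<le> k"
  shows "(\<exists>j n c. Suc j = i \<and> (n, c) \<in> in_left d j m \<and> edge d j n c \<in> matching_of k d H) \<longleftrightarrow> 0 < i \<and> H i m - H i (m + 1) = 1"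
    "(\<exists>n c. i < k \<and> (n, c) \<in> in_right d i m \<and> edge d i n c \<in> matching_of k d H) \<longleftrightarrow> i < k \<and> H i m = H i (m + 1)"
proof -
  show "(\<exists>n c. i < k \<and> (n, c) \<in> in_right d i m \<and> edge d i n c \<in> matching_of k d H) \<longleftrightarrow> i < k \<and> H i m = H i (m + 1)"
    using right_matched_iff[OF H, of i m] by auto
  show "(\<exists>j n c. Suc j = i \<and> (n, c) \<in> in_left d j m \<and> edge d j n c \<in> matching_of k d H) \<longleftrightarrow> 0 < i \<and> H i m - H i (m + 1) = 1"
  proof (cases i)
    case (Suc j)
    then have "j < k" using i by simp
    then show ?thesis using left_matched_iff[OF H, of j m] Suc by auto
  qed auto
qed

text \<open>In column 0 the particles are exactly the uncovered vertices, which count as matched to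
  the left by convention; likewise for the holes in column \<open>k\<close>.\<close>

lemma matched_of_config:
  assumes H: "H \<in> Config k d" and i: "i \<le> k" and k: "k \<ge> 1"
  shows "matched_left (matching_of k d H) (Vp d i m) \<longleftrightarrow> H i m - H i (m + 1) = 1"
    "matched_right k (matching_of k d H) (Vp d i m) \<longleftrightarrow> H i m = H i (m + 1)"
proof -
  have "profile (H i)" using H by (auto simp: Config_def)
  then have p: "H i m - H i (m + 1) = 1 \<longleftrightarrow> H i m \<noteq> H i (m + 1)"
    using profile_dec[of "H i" m] profile_lip[of "H i" m] by auto
  note c = V_covered_iff[where M = "matching_of k d H" and d = d and m = m, OF matching_of_subset i, unfolded covered_of_config[OF H i]]
  show "matched_left (matching_of k d H) (Vp d i m) \<longleftrightarrow> H i m - H i (m + 1) = 1"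
    unfolding matched_left_def ex_left_iff[OF matching_of_subset] covered_of_config[OF H i] c
    using k p by auto
  show "matched_right k (matching_of k d H) (Vp d i m) \<longleftrightarrow> H i m = H i (m + 1)"
    unfolding matched_right_def ex_right_iff[OF matching_of_subset] covered_of_config[OF H i] c
    using k p i by auto
qed

lemma is_matching_of_config:
  assumes H: "H \<in> Config k d"
  shows "is_matching k d (matching_of k d H)"
  unfolding is_matching_def
proof (intro conjI)
  show "matching_of k d H \<subseteq> edges k d" by (rule matching_of_subset)
  show "pairwise disjnt (matching_of k d H)"
  proof (rule pairwiseI)
    fix e e' assume e: "e \<in> matching_of k d H" "e' \<in> matching_of k d H" "e \<noteq> e'"
    then obtain j n c j' n' c' where eq: "e = edge d j n c" "e' = edge d j' n' c'" unfolding matching_of_def by blast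
    show "disjnt e e'"
    proof (rule ccontr)
      assume "\<not> disjnt e e'"
      then obtain v where "v \<in> e" "v \<in> e'" by (auto simp: disjnt_iff)
      then show False using matching_unique[OF H] e unfolding eq by metis
    qed
  qed
  show "verts k d - (V_col 0 \<union> V_col k) \<subseteq> \<Union> (matching_of k d H)"
  proof
    fix v assume v: "v \<in> verts k d - (V_col 0 \<union> V_col k)"
    then consider i m where "v = Vp d i m" "i \<le> k" | i m where "v = Wp d i m" "i < k" unfolding verts_eq by blast
    then show "v \<in> \<Union> (matching_of k d H)"
    proof cases
      case 1
      then have i: "0 < i" "i < k" using v by auto
      have "profile (H i)" using H by (auto simp: Config_def)
      then show ?thesis unfolding 1 V_covered_iff[OF matching_of_subset 1(2)] covered_of_config[OF H 1(2)]
        using i profile_dec[of "H i" m] profile_lip[of "H i" m] by auto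
    next
      case 2
      have "\<exists>c. edge_ind d H i m c = 1"
        using edge_ind_sum[of d H i m] edge_ind_cases[OF H 2(2), of m Hz] edge_ind_cases[OF H 2(2), of m Up] edge_ind_cases[OF H 2(2), of m Dn]
        by force
      then obtain c where "edge d i m c \<in> matching_of k d H" using 2 by auto
      then show ?thesis using W_in_edge_iff 2(1) by (metis UnionI)
    qed
  qed
qed

section \<open>Admissibility and injectivity\<close>

lemma sum_indicator_card:
  "finite A \<Longrightarrow> (\<Sum>y\<in>A. if P y then 1 else 0 :: int) = int (card {y \<in> A. P y})"
  by (simp add: sum.If_cases Collect_conj_eq)

text \<open>Both numbers equal \<open>h 0\<close>: the particles from 0 upwards by telescoping
  \<open>h y\<close>, the holes below 0 by telescoping \<open>h y + y\<close>.\<close>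

lemma profile_balance:
  assumes h: "profile h"
  shows "finite {m. 0 \<le> m \<and> h m - h (m + 1) = 1}" "finite {m. m < 0 \<and> h m = h (m + 1)}"
    "card {m. 0 \<le> m \<and> h m - h (m + 1) = 1} = card {m. m < 0 \<and> h m = h (m + 1)}"
proof -
  obtain N where N: "N > 0" "\<And>y. N \<le> \<bar>y\<bar> \<Longrightarrow> h y = ground y" using profile_bound[OF h] by metis
  have eqL: "{m. 0 \<le> m \<and> h m - h (m + 1) = 1} = {m \<in> {0..N}. h m - h (m + 1) = 1}"
  proof (intro set_eqI iffI)
    fix m assume m: "m \<in> {m. 0 \<le> m \<and> h m - h (m + 1) = 1}"
    have "m \<le> N"
    proof (rule ccontr)
      assume "\<not> m \<le> N"
      then have "h m = ground m" "h (m + 1) = ground (m + 1)" using N(1) by (auto intro!: N(2))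
      then show False using m by (auto simp: ground_def)
    qed
    then show "m \<in> {m \<in> {0..N}. h m - h (m + 1) = 1}" using m by auto
  qed auto
  have eqR: "{m. m < 0 \<and> h m = h (m + 1)} = {m \<in> {-N-1..-1}. h m = h (m + 1)}"
  proof (intro set_eqI iffI)
    fix m assume m: "m \<in> {m. m < 0 \<and> h m = h (m + 1)}"
    have "- N - 1 \<le> m"
    proof (rule ccontr)
      assume "\<not> - N - 1 \<le> m"
      then have "h m = ground m" "h (m + 1) = ground (m + 1)" using N(1) by (auto intro!: N(2))
      then show False using m by (auto simp: ground_def)
    qed
    then show "m \<in> {m \<in> {-N-1..-1}. h m = h (m + 1)}" using m by auto
  qed auto
  show "finite {m. 0 \<le> m \<and> h m - h (m + 1) = 1}" unfolding eqL by (rule finite_subset[of _ "{0..N}"]) auto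
  show "finite {m. m < 0 \<and> h m = h (m + 1)}" unfolding eqR by (rule finite_subset[of _ "{-N-1..-1}"]) auto
  have "int (card {m \<in> {0..N}. h m - h (m + 1) = 1}) = (\<Sum>y\<in>{0..N}. if h y - h (y + 1) = 1 then 1 else 0)"
    by (rule sum_indicator_card[symmetric]) simp
  also have "\<dots> = (\<Sum>y\<in>{0..N}. - (h (y + 1) - h y))"
  proof (rule sum.cong[OF refl])
    fix y show "(if h y - h (y + 1) = 1 then 1 else 0) = - (h (y + 1) - h y)"
      using profile_dec[OF h, of y] profile_lip[OF h, of y] by auto
  qed
  also have "\<dots> = h 0 - h (N + 1)" unfolding sum_negf using N(1) by (subst sum_telescope_int) auto
  also have "\<dots> = h 0" using N by (subst N(2)) (auto simp: ground_def)
  finally have 1: "int (card {m \<in> {0..N}. h m - h (m + 1) = 1}) = h 0" .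
  have "int (card {m \<in> {-N-1..-1}. h m = h (m + 1)}) = (\<Sum>y\<in>{-N-1..-1}. if h y = h (y + 1) then 1 else 0)"
    by (rule sum_indicator_card[symmetric]) simp
  also have "\<dots> = (\<Sum>y\<in>{-N-1..-1}. (h (y + 1) + (y + 1)) - (h y + y))"
  proof (rule sum.cong[OF refl])
    fix y show "(if h y = h (y + 1) then 1 else 0) = (h (y + 1) + (y + 1)) - (h y + y)"
      using profile_dec[OF h, of y] profile_lip[OF h, of y] by auto
  qed
  also have "\<dots> = h (-1 + 1) + (-1 + 1) - (h (-N-1) + (-N-1))"
    using N(1) by (subst sum_telescope_int[of "-N-1" "-1" "\<lambda>y. h y + y"]) auto
  also have "\<dots> = h 0" using N by (subst N(2)[of "-N-1"]) (auto simp: ground_def)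
  finally have 2: "int (card {m \<in> {-N-1..-1}. h m = h (m + 1)}) = h 0" .
  show "card {m. 0 \<le> m \<and> h m - h (m + 1) = 1} = card {m. m < 0 \<and> h m = h (m + 1)}"
    unfolding eqL eqR using 1 2 by simp
qed

lemma admissible_of_config:
  assumes H: "H \<in> Config k d" and k: "k \<ge> 1"
  shows "admissible k d (matching_of k d H)"
  unfolding admissible_def Let_def
proof (intro conjI ballI)
  show "is_matching k d (matching_of k d H)" by (rule is_matching_of_config[OF H])
  fix j assume "j \<in> {0..k}"
  then have j: "j \<le> k" by simp
  have h: "profile (H j)" using H by (auto simp: Config_def)
  have L: "{v \<in> V_col j. Y_ord d j < snd v \<and> matched_left (matching_of k d H) v} = Vp d j ` {m. 0 \<le> m \<and> H j m - H j (m + 1) = 1}"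
    unfolding V_col_eq[of j d] using matched_of_config(1)[OF H j k] by (auto simp: Vp_def)
  have R: "{v \<in> V_col j. snd v < Y_ord d j \<and> matched_right k (matching_of k d H) v} = Vp d j ` {m. m < 0 \<and> H j m = H j (m + 1)}"
    unfolding V_col_eq[of j d] using matched_of_config(2)[OF H j k] by (auto simp: Vp_def)
  have inj: "inj_on (Vp d j) A" for A by (auto simp: inj_on_def)
  show "finite {v \<in> V_col j. Y_ord d j < snd v \<and> matched_left (matching_of k d H) v}"
    "finite {v \<in> V_col j. snd v < Y_ord d j \<and> matched_right k (matching_of k d H) v}"
    "card {v \<in> V_col j. Y_ord d j < snd v \<and> matched_left (matching_of k d H) v} =
     card {v \<in> V_col j. snd v < Y_ord d j \<and> matched_right k (matching_of k d H) v}"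
    unfolding L R card_image[OF inj] using profile_balance[OF h] by simp_all
qed

text \<open>The matching determines the particles and thereby all differences of heights within a
  column; the common value far above fixes the constant.\<close>

lemma matching_of_inj:
  assumes H: "H \<in> Config k d" "H' \<in> Config k d" and k: "k \<ge> 1" and eq: "matching_of k d H = matching_of k d H'"
  shows "H = H'"
proof (rule ext, rule ext)
  fix i y
  show "H i y = H' i y"
  proof (cases "i \<le> k")
    case False
    then have "H i = ground" "H' i = ground" using H by (auto simp: Config_def)
    then show ?thesis by simp
  next
    case True
    have p: "profile (H i)" "profile (H' i)" using H by (auto simp: Config_def)
    have step: "H i m - H i (m + 1) = H' i m - H' i (m + 1)" for m
      using matched_of_config(1)[OF H(1) True k, of m] matched_of_config(1)[OF H(2) True k, of m] eq
        profile_dec[OF p(1), of m] profile_lip[OF p(1), of m] profile_dec[OF p(2), of m] profile_lip[OF p(2), of m]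
      by auto
    obtain N where N: "N > 0" "\<And>y. N \<le> \<bar>y\<bar> \<Longrightarrow> H i y = ground y" "\<And>y. N \<le> \<bar>y\<bar> \<Longrightarrow> H' i y = ground y"
      using profile_bound2[OF p] by metis
    have "H i y - H i (y + int t) = H' i y - H' i (y + int t)" for t
    proof (induction t)
      case (Suc t)
      then show ?case using step[of "y + int t"] by (simp add: algebra_simps)
    qed simp
    from this[of "nat (\<bar>y\<bar> + N)"] show ?thesis
      using N(2)[of "y + (\<bar>y\<bar> + N)"] N(3)[of "y + (\<bar>y\<bar> + N)"] N(1) by auto
  qed
qed

section \<open>The minimal matching\<close>

text \<open>The hypothesis only tells on which side each \<open>V\<close>-vertex is matched. This
  settles the horizontal edges; the diagonal ones then follow by propagation along a half-infinite
  chain, started where the horizontal edges stop.\<close>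

lemma min_matching_unique:
  assumes k: "k \<ge> 1" and adm: "admissible k d M"
    and left: "\<And>j m. j \<le> k \<Longrightarrow> matched_left M (Vp d j m) \<longleftrightarrow> m < 0"
  shows "M = matching_of k d (\<lambda>_. ground)"
proof -
  let ?G = "\<lambda>_ :: nat. ground"
  have ism: "is_matching k d M" using adm by (simp add: admissible_def)
  then have sub: "M \<subseteq> edges k d" and cov: "verts k d - (V_col 0 \<union> V_col k) \<subseteq> \<Union>M"
    by (auto simp: is_matching_def)
  have uniq: "e = e'" if "e \<in> M" "e' \<in> M" "v \<in> e" "v \<in> e'" for e e' v
    using ism that unfolding is_matching_def pairwise_def disjnt_iff by metis
  have L: "(\<exists>(n, c)\<in>in_left d j m. edge d j n c \<in> M) \<longleftrightarrow> m < 0" if "j < k" for j m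
  proof -
    have "matched_left M (Vp d (Suc j) m) \<longleftrightarrow> (\<exists>(n, c)\<in>in_left d j m. edge d j n c \<in> M)"
      unfolding matched_left_def ex_left_iff[OF sub] by auto
    then show ?thesis using left[of "Suc j" m] that by simp
  qed
  \<comment> \<open>In column 0, being matched to the left means being uncovered; in the inner
    columns every vertex is covered, and from one side only.\<close>
  have R: "(\<exists>(n, c)\<in>in_right d j m. edge d j n c \<in> M) \<longleftrightarrow> 0 \<le> m" if j: "j < k" for j m
  proof -
    have ml: "matched_left M (Vp d j m) \<longleftrightarrow> m < 0" using left j by simp
    note c = V_covered_iff[where i = j and m = m, OF sub]
    show ?thesis
    proof (cases j)
      case 0
      have "matched_left M (Vp d j m) \<longleftrightarrow> Vp d j m \<notin> \<Union>M"
        unfolding matched_left_def ex_left_iff[OF sub] using 0 by simp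
      then show ?thesis using ml c j 0 by auto
    next
      case (Suc i)
      then have "Vp d j m \<in> verts k d - (V_col 0 \<union> V_col k)" using j by simp
      then have "Vp d j m \<in> \<Union>M" using cov by blast
      then have "(\<exists>(n, c)\<in>in_left d i m. edge d i n c \<in> M) \<or> (\<exists>(n, c)\<in>in_right d j m. edge d j n c \<in> M)"
        using c j Suc by auto
      moreover have False if "(n, c) \<in> in_left d i m" "edge d i n c \<in> M" "(n', c') \<in> in_right d j m" "edge d j n' c' \<in> M" for n c n' c'
      proof -
        have "edge d i n c = edge d j n' c'"
          using uniq[of "edge d i n c" "edge d j n' c'" "Vp d j m"] that V_in_edge_iff Suc by metis
        then show False using Suc by (simp add: edge_eq_iff)
      qed
      ultimately show ?thesis using L[of i m] Suc j by fastforce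
    qed
  qed
  have W: "\<exists>c. edge d j n c \<in> M" if "j < k" for j n
  proof -
    have "Wp d j n \<in> verts k d - (V_col 0 \<union> V_col k)" using that by simp
    then have "Wp d j n \<in> \<Union>M" using cov by blast
    then obtain e where e: "e \<in> M" "Wp d j n \<in> e" by blast
    then obtain j' n' c' where "e = edge d j' n' c'" using sub unfolding edges_eq by blast
    then show ?thesis using e W_in_edge_iff by metis
  qed
  have Wu: "c = c'" if "edge d j n c \<in> M" "edge d j n c' \<in> M" for j n c c'
    using uniq[OF that, of "Wp d j n"] by (simp add: W_in_edge_iff edge_eq_iff)
  have Vu: "n = n' \<and> c = c'" if "edge d j n c \<in> M" "edge d j n' c' \<in> M"
    "((n, c) \<in> in_left d j m \<and> (n', c') \<in> in_left d j m) \<or> ((n, c) \<in> in_right d j m \<and> (n', c') \<in> in_right d j m)" for j n c n' c' m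
  proof -
    have "edge d j n c = edge d j n' c'"
      using that(3) uniq[OF that(1,2), of "Vp d (Suc j) m"] uniq[OF that(1,2), of "Vp d j m"] V_in_edge_iff by metis
    then show ?thesis by (simp add: edge_eq_iff)
  qed
  have g: "ground m = (if m < 0 then - m else 0)" for m by (simp add: ground_def)
  have main: "edge d j n c \<in> M" if j: "j < k" and i: "edge_ind d ?G j n c = 1" for j n c
  proof (cases "primed (d (Suc j))")
    case False
    define s where "s = shift (d (Suc j))"
    have s: "s = 0 \<or> s = 1" by (simp add: s_def shift_def)
    have lf: "in_left d j m = {(m, Hz)}" and rt: "in_right d j m = {(m - s, Up), (m - s + 1, Dn)}" for m
      using False by (simp_all add: in_left_def in_right_def s_def)
    have Hz: "edge d j m Hz \<in> M \<longleftrightarrow> m < 0" for m using L[OF j, of m] unfolding lf by simp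
    have R': "edge d j (m - s) Up \<in> M \<or> edge d j (m - s + 1) Dn \<in> M \<longleftrightarrow> 0 \<le> m" for m
      using R[OF j, of m] unfolding rt by simp
    \<comment> \<open>For \<open>s = 1\<close> the horizontal edge at \<open>Wp d j (-1)\<close>
      leaves only the \<open>Dn\<close> edge of \<open>Wp d j 0\<close> for \<open>Vp d j 0\<close>;
      this uses up \<open>Wp d j 0\<close>, so \<open>Vp d j 1\<close> must take the next
      \<open>Dn\<close> edge, and so on. For \<open>s = 0\<close> the vertex \<open>Wp d j 0\<close>
      can take neither its horizontal nor its \<open>Dn\<close> edge, and its \<open>Up\<close> edge
      then blocks the \<open>Dn\<close> edge of \<open>Wp d j 1\<close>.\<close>
    have up: "edge d j m (if s = 1 then Dn else Up) \<in> M" if "0 \<le> m" for m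
      using that
    proof (induction m rule: int_ge_induct)
      case base
      show ?case
      proof (cases "s = 1")
        case True
        then show ?thesis using R'[of 0] Hz[of "-1"] Wu[of j "-1" Hz Up] by auto
      next
        case False
        then have s0: "s = 0" using s by simp
        obtain c where c: "edge d j 0 c \<in> M" using W[OF j] by blast
        have "c \<noteq> Hz" "c \<noteq> Dn" using c Hz[of 0] R'[of "-1"] s0 by auto
        then show ?thesis using c s0 by (cases c) auto
      qed
    next
      case (step m)
      show ?case
      proof (cases "s = 1")
        case True
        then show ?thesis using R'[of "m + 1"] step Wu[of j m Up Dn] by auto
      next
        case False
        then have s0: "s = 0" using s by simp
        obtain c where c: "edge d j (m + 1) c \<in> M" using W[OF j] by blast
        have "c \<noteq> Hz" using c Hz[of "m + 1"] step by auto
        moreover have "c \<noteq> Dn"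
        proof
          assume "c = Dn"
          then show False using c step s0 Vu[of j m Up "m + 1" Dn m] unfolding rt by simp
        qed
        ultimately show ?thesis using c s0 by (cases c) auto
      qed
    qed
    show ?thesis
    proof (cases c)
      case Hz
      then have "n < 0" using i False by (auto simp: edge_ind_def Let_def g split: if_splits)
      then show ?thesis using Hz \<open>\<And>m. edge d j m Hz \<in> M \<longleftrightarrow> m < 0\<close> by simp
    next
      case Up
      then have "s = 0 \<and> 0 \<le> n" using i False s unfolding edge_ind_def Let_def s_def[symmetric] by (auto simp: g split: if_splits)
      then show ?thesis using up[of n] Up by simp
    next
      case Dn
      then have "s = 1 \<and> 0 \<le> n" using i False s unfolding edge_ind_def Let_def s_def[symmetric] by (auto simp: g split: if_splits)
      then show ?thesis using up[of n] Dn by simp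
    qed
  next
    case True
    define s where "s = shift (d (Suc j))"
    have s: "s = 0 \<or> s = 1" by (simp add: s_def shift_def)
    have rt: "in_right d j m = {(m, Hz)}" and lf: "in_left d j m = {(m - s, Up), (m - s + 1, Dn)}" for m
      using True by (simp_all add: in_left_def in_right_def s_def)
    have Hz: "edge d j m Hz \<in> M \<longleftrightarrow> 0 \<le> m" for m using R[OF j, of m] unfolding rt by simp
    have L': "edge d j (m - s) Up \<in> M \<or> edge d j (m - s + 1) Dn \<in> M \<longleftrightarrow> m < 0" for m
      using L[OF j, of m] unfolding lf by simp
    \<comment> \<open>The same propagation, downwards from index -1 and along the right border of
      the strip, since here the horizontal edges occupy the vertices of nonnegative index.\<close>
    have dn: "edge d j m (if s = 1 then Dn else Up) \<in> M" if "m \<le> -1" for m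
      using that
    proof (induction m rule: int_le_induct)
      case base
      show ?case
      proof (cases "s = 1")
        case False
        then have "s = 0" using s by simp
        then show ?thesis using L'[of "-1"] Hz[of 0] Wu[of j 0 Hz Dn] by auto
      next
        case True
        obtain c where c: "edge d j (-1) c \<in> M" using W[OF j] by blast
        have "c \<noteq> Hz" "c \<noteq> Up" using c Hz[of "-1"] L'[of 0] True by auto
        then show ?thesis using c True by (cases c) auto
      qed
    next
      case (step m)
      show ?case
      proof (cases "s = 1")
        case False
        then have "s = 0" using s by simp
        then show ?thesis using L'[of "m - 1"] step Wu[of j m Up Dn] by auto
      next
        case True
        obtain c where c: "edge d j (m - 1) c \<in> M" using W[OF j] by blast
        have "c \<noteq> Hz" using c Hz[of "m - 1"] step by auto
        moreover have "c \<noteq> Up"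
        proof
          assume "c = Up"
          then show False using c step True Vu[of j m Dn "m - 1" Up m] unfolding lf by simp
        qed
        ultimately show ?thesis using c True by (cases c) auto
      qed
    qed
    show ?thesis
    proof (cases c)
      case Hz
      then have "0 \<le> n" using i True by (auto simp: edge_ind_def Let_def g split: if_splits)
      then show ?thesis using Hz \<open>\<And>m. edge d j m Hz \<in> M \<longleftrightarrow> 0 \<le> m\<close> by simp
    next
      case Up
      then have "s = 0 \<and> n < 0" using i True s unfolding edge_ind_def Let_def s_def[symmetric] by (auto simp: g split: if_splits)
      then show ?thesis using dn[of n] Up by simp
    next
      case Dn
      then have "s = 1 \<and> n < 0" using i True s unfolding edge_ind_def Let_def s_def[symmetric] by (auto simp: g split: if_splits)
      then show ?thesis using dn[of n] Dn by simp
    qed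
  qed
  show ?thesis
  proof
    show "matching_of k d ?G \<subseteq> M" unfolding matching_of_def using main by blast
    \<comment> \<open>Both matchings use exactly one edge at every \<open>W\<close>-vertex, so the
      inclusion just shown is an equality.\<close>
    show "M \<subseteq> matching_of k d ?G"
    proof
      fix e assume e: "e \<in> M"
      then obtain j n c where jnc: "e = edge d j n c" "j < k" using sub unfolding edges_eq by blast
      note G = ground_const_config[of k d]
      have "\<exists>c'. edge_ind d ?G j n c' = 1"
        using edge_ind_sum[of d ?G j n] edge_ind_cases[OF G jnc(2), of n Hz] edge_ind_cases[OF G jnc(2), of n Up] edge_ind_cases[OF G jnc(2), of n Dn]
        by force
      then obtain c' where c': "edge_ind d ?G j n c' = 1" by blast
      then have "edge d j n c' \<in> M" using main jnc by blast
      then have "c = c'" using Wu e jnc by blast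
      then show "e \<in> matching_of k d ?G" using c' jnc by simp
    qed
  qed
qed

theorem min_matching_eq:
  assumes k: "k \<ge> 1"
  shows "min_matching k d = matching_of k d (\<lambda>_. ground)"
  unfolding min_matching_def
proof (rule the_equality)
  have V: "(\<forall>v\<in>V_col j. P v) \<longleftrightarrow> (\<forall>m. P (Vp d j m))" for j and P :: "point \<Rightarrow> bool"
    unfolding V_col_eq[of j d] by auto
  have snd: "snd (Vp d j m) < Y_ord d j \<longleftrightarrow> m < 0" for j m by (auto simp: Vp_def)
  have gr: "ground m - ground (m + 1) = 1 \<longleftrightarrow> m < 0" for m by (auto simp: ground_def)
  show "admissible k d (matching_of k d (\<lambda>_. ground)) \<and>
    (\<forall>j\<in>{0..k}. \<forall>v\<in>V_col j. matched_left (matching_of k d (\<lambda>_. ground)) v = (snd v < Y_ord d j))"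
    using admissible_of_config[OF ground_const_config k] unfolding V snd
    by (auto simp: matched_of_config(1)[OF ground_const_config _ k] gr)
  fix M assume M: "admissible k d M \<and> (\<forall>j\<in>{0..k}. \<forall>v\<in>V_col j. matched_left M v = (snd v < Y_ord d j))"
  then show "M = matching_of k d (\<lambda>_. ground)"
    using min_matching_unique[OF k, of d M] unfolding V snd by auto
qed

section \<open>Flips\<close>

definition raise_at :: "nat \<Rightarrow> int \<Rightarrow> int \<Rightarrow> (nat \<Rightarrow> int \<Rightarrow> int) \<Rightarrow> (nat \<Rightarrow> int \<Rightarrow> int)" where
  "raise_at j n t H = H(j := (H j)(n := H j n + t))"

text \<open>On a side with four edges the boundary runs through the upper horizontal edge, the
  \<open>Dn\<close> edge, the \<open>Up\<close> edge and the lower horizontal edge, with signs plus,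
  minus, plus, minus. A side with two edges has one of each sign.\<close>

definition side_sign :: "int \<Rightarrow> int \<Rightarrow> kind \<Rightarrow> int" where
  "side_sign n m c = (if c = Up \<or> (c = Hz \<and> m = n) then 1 else -1)"

text \<open>The sign with which raising the height of the cell changes \<open>edge_ind\<close>; it alternates along the
  boundary of the cell.\<close>

definition flip_sign :: "(nat \<Rightarrow> diamond) \<Rightarrow> nat \<Rightarrow> int \<Rightarrow> nat \<Rightarrow> int \<Rightarrow> kind \<Rightarrow> int" where
  "flip_sign d j n i m c = (if Suc i = j \<and> (m, c) \<in> left_edges d j n then side_sign n m c
     else if i = j \<and> (m, c) \<in> right_edges d j n then - side_sign n m c else 0)"

lemma edge_ind_raise_at: "edge_ind d (raise_at j n t H) i m c = edge_ind d H i m c + t * flip_sign d j n i m c"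
proof -
  consider "i = j" | "Suc i = j" | "i \<noteq> j" "Suc i \<noteq> j" by blast
  then show ?thesis
  proof cases
    case 1
    then show ?thesis
      by (cases c; cases "primed (d (Suc j))")
         (auto simp: edge_ind_def Let_def raise_at_def flip_sign_def side_sign_def right_edges_def)
  next
    case 2
    then have "d (Suc i) = d j" "i \<noteq> j" by auto
    then show ?thesis using 2
      by (cases c; cases "primed (d j)")
         (auto simp: edge_ind_def Let_def raise_at_def flip_sign_def side_sign_def left_edges_def)
  next
    case 3
    then show ?thesis by (cases c) (simp_all add: edge_ind_def Let_def raise_at_def flip_sign_def)
  qed
qed

lemma flip_sign_cases: "flip_sign d j n i m c \<in> {-1, 0, 1}"
  by (auto simp: flip_sign_def side_sign_def)

section \<open>Flips as changes of a single height\<close>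

lemma face_edge_iff:
  assumes j: "0 < j" "j < k"
  shows "edge d i m c \<in> face_edges k d (cell k d j n) \<longleftrightarrow> flip_sign d j n i m c \<noteq> 0"
proof -
  have "side_sign n m c \<noteq> 0" by (simp add: side_sign_def)
  then show ?thesis unfolding face_edges_cell[OF j] flip_sign_def using j by (auto simp: edge_eq_iff)
qed

lemma finite_face_sets [simp]: "finite (left_edges d j n)" "finite (right_edges d j n)"
  by (auto simp: left_edges_def right_edges_def)

lemma card_face_filter:
  assumes j: "0 < j" "j < k"
  shows "card {e \<in> face_edges k d (cell k d j n). P e} =
    card {(m, c) \<in> left_edges d j n. P (edge d (j - 1) m c)} + card {(m, c) \<in> right_edges d j n. P (edge d j m c)}"
proof -
  let ?L = "{(m, c) \<in> left_edges d j n. P (edge d (j - 1) m c)}" and ?R = "{(m, c) \<in> right_edges d j n. P (edge d j m c)}"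
  let ?fL = "\<lambda>(m, c). edge d (j - 1) m c" and ?fR = "\<lambda>(m, c). edge d j m c"
  have eq: "{e \<in> face_edges k d (cell k d j n). P e} = ?fL ` ?L \<union> ?fR ` ?R"
    unfolding face_edges_cell[OF j] by auto
  have inj: "inj_on ?fL ?L" "inj_on ?fR ?R" by (auto simp: inj_on_def edge_eq_iff)
  have dj: "?fL ` ?L \<inter> ?fR ` ?R = {}" using j by (auto simp: edge_eq_iff)
  have fin: "finite ?L" "finite ?R"
    by (rule finite_subset[of _ "left_edges d j n"], auto) (rule finite_subset[of _ "right_edges d j n"], auto)
  show ?thesis unfolding eq using fin dj inj by (subst card_Un_disjoint) (auto simp: card_image)
qed

lemma sum_side_sign: "(\<Sum>(m, c)\<in>left_edges d j n. side_sign n m c) = 0" "(\<Sum>(m, c)\<in>right_edges d j n. side_sign n m c) = 0"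
  by (simp_all add: left_edges_def right_edges_def side_sign_def)

lemma card_matching_face:
  assumes H: "H \<in> Config k d" and j: "0 < j" "j < k"
  shows "int (card (matching_of k d H \<inter> face_edges k d (cell k d j n))) =
    (\<Sum>(m, c)\<in>left_edges d j n. edge_ind d H (j - 1) m c) + (\<Sum>(m, c)\<in>right_edges d j n. edge_ind d H j m c)"
    "int (card (face_edges k d (cell k d j n))) = int (card (left_edges d j n)) + int (card (right_edges d j n))"
proof -
  have j1: "j - 1 < k" using j by simp
  have sum: "int (card {(m, c) \<in> A. edge d i m c \<in> matching_of k d H}) = (\<Sum>(m, c)\<in>A. edge_ind d H i m c)"
    if "finite A" "i < k" for A i
  proof -
    have "(\<Sum>(m, c)\<in>A. edge_ind d H i m c) = (\<Sum>x\<in>A. if edge d i (fst x) (snd x) \<in> matching_of k d H then 1 else 0)"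
      using edge_ind_cases[OF H that(2)] that(2) by (intro sum.cong) (auto, metis)
    also have "\<dots> = int (card {x \<in> A. edge d i (fst x) (snd x) \<in> matching_of k d H})"
      by (rule sum_indicator_card[OF that(1)])
    also have "{x \<in> A. edge d i (fst x) (snd x) \<in> matching_of k d H} = {(m, c) \<in> A. edge d i m c \<in> matching_of k d H}"
      by auto
    finally show ?thesis by (rule sym)
  qed
  have "matching_of k d H \<inter> face_edges k d (cell k d j n) = {e \<in> face_edges k d (cell k d j n). e \<in> matching_of k d H}" by auto
  then show "int (card (matching_of k d H \<inter> face_edges k d (cell k d j n))) =
    (\<Sum>(m, c)\<in>left_edges d j n. edge_ind d H (j - 1) m c) + (\<Sum>(m, c)\<in>right_edges d j n. edge_ind d H j m c)"
    using card_face_filter[OF j, of d n "\<lambda>e. e \<in> matching_of k d H"] sum[OF finite_face_sets(1) j1] sum[OF finite_face_sets(2) j(2)]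
    by simp
  show "int (card (face_edges k d (cell k d j n))) = int (card (left_edges d j n)) + int (card (right_edges d j n))"
    using card_face_filter[OF j, of d n "\<lambda>_. True"] by simp
qed

text \<open>The values lie in \<open>{0, 1}\<close> before and after and change by 1 in absolute
  value exactly on the boundary of the face, where they are therefore toggled.\<close>

lemma matching_of_raise_at:
  assumes H: "H \<in> Config k d" and H': "raise_at j n t H \<in> Config k d" and t: "t \<in> {1, -1}" and j: "0 < j" "j < k"
  shows "matching_of k d (raise_at j n t H) = (matching_of k d H - face_edges k d (cell k d j n)) \<union>
     (face_edges k d (cell k d j n) - matching_of k d H)" (is "?M' = ?X")
proof -
  have *: "edge d i m c \<in> ?M' \<longleftrightarrow> edge d i m c \<in> ?X" if i: "i < k" for i m c
  proof -
    have "edge_ind d H i m c = 0 \<or> edge_ind d H i m c = 1" "edge_ind d H i m c + t * flip_sign d j n i m c = 0 \<or> edge_ind d H i m c + t * flip_sign d j n i m c = 1"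
      using edge_ind_cases[OF H i, of m c] edge_ind_cases[OF H' i, of m c] unfolding edge_ind_raise_at by auto
    then show ?thesis using t flip_sign_cases[of d j n i m c] i unfolding Un_iff Diff_iff face_edge_iff[OF j] edge_in_matching_of edge_ind_raise_at
      by auto
  qed
  have sub: "?M' \<subseteq> edges k d" "?X \<subseteq> edges k d" using matching_of_subset by (auto simp: face_edges_def)
  show ?thesis
  proof (intro set_eqI)
    fix e show "e \<in> ?M' \<longleftrightarrow> e \<in> ?X"
    proof (cases "e \<in> edges k d")
      case True
      then obtain i m c where "e = edge d i m c" "i < k" unfolding edges_eq by blast
      then show ?thesis using * by simp
    next
      case False
      then show ?thesis using sub by blast
    qed
  qed
qed

lemma cell_bounded_face:
  assumes "0 < j" "j < k"
  shows "cell k d j n \<in> bounded_faces k d"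
  using bounded_faces_eq[of k d] assms by auto

text \<open>A value in \<open>{0, 1}\<close> that stays there after adding \<open>t\<close> times
  its sign equals half of 1 minus that product. The signs cancel around the face, so exactly half of
  its edges are present.\<close>

lemma flip_of_config:
  assumes H: "H \<in> Config k d" and H': "raise_at j n t H \<in> Config k d" and t: "t \<in> {1, -1}" and j: "0 < j" "j < k"
  shows "flip k d (cell k d j n) (matching_of k d H) (matching_of k d (raise_at j n t H))"
  unfolding flip_def
proof (intro conjI)
  show "cell k d j n \<in> bounded_faces k d" by (rule cell_bounded_face[OF j])
  show "matching_of k d (raise_at j n t H) = matching_of k d H - face_edges k d (cell k d j n) \<union>
    (face_edges k d (cell k d j n) - matching_of k d H)" by (rule matching_of_raise_at[OF assms])
  have tw: "2 * edge_ind d H i m c = 1 - t * flip_sign d j n i m c" if "i < k" "flip_sign d j n i m c \<noteq> 0" for i m c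
    using edge_ind_cases[OF H that(1), of m c] edge_ind_cases[OF H' that(1), of m c] t flip_sign_cases[of d j n i m c] that(2)
    unfolding edge_ind_raise_at by auto
  have l: "2 * edge_ind d H (j - 1) m c = 1 - t * side_sign n m c" if "(m, c) \<in> left_edges d j n" for m c
    using tw[of "j - 1" m c] that j by (auto simp: flip_sign_def side_sign_def)
  have r: "2 * edge_ind d H j m c = 1 + t * side_sign n m c" if "(m, c) \<in> right_edges d j n" for m c
    using tw[of j m c] that j by (auto simp: flip_sign_def side_sign_def)
  have "2 * (\<Sum>(m, c)\<in>left_edges d j n. edge_ind d H (j - 1) m c) = (\<Sum>(m, c)\<in>left_edges d j n. 1 - t * side_sign n m c)"
    unfolding sum_distrib_left using l by (intro sum.cong) auto
  also have "\<dots> = int (card (left_edges d j n)) - t * (\<Sum>(m, c)\<in>left_edges d j n. side_sign n m c)"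
    by (simp add: case_prod_beta sum_subtractf sum_distrib_left)
  finally have 1: "2 * (\<Sum>(m, c)\<in>left_edges d j n. edge_ind d H (j - 1) m c) = int (card (left_edges d j n))"
    unfolding sum_side_sign by simp
  have "2 * (\<Sum>(m, c)\<in>right_edges d j n. edge_ind d H j m c) = (\<Sum>(m, c)\<in>right_edges d j n. 1 + t * side_sign n m c)"
    unfolding sum_distrib_left using r by (intro sum.cong) auto
  also have "\<dots> = int (card (right_edges d j n)) + t * (\<Sum>(m, c)\<in>right_edges d j n. side_sign n m c)"
    by (simp add: case_prod_beta sum.distrib sum_distrib_left)
  finally have 2: "2 * (\<Sum>(m, c)\<in>right_edges d j n. edge_ind d H j m c) = int (card (right_edges d j n))"
    unfolding sum_side_sign by simp
  show "\<exists>p. card (face_edges k d (cell k d j n)) = 2 * p \<and> card (matching_of k d H \<inter> face_edges k d (cell k d j n)) = p"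
    using card_matching_face[OF H j, of n] 1 2 by (intro exI[of _ "card (matching_of k d H \<inter> face_edges k d (cell k d j n))"]) linarith
qed

text \<open>Two edges of a matching that are consecutive on the boundary of a face cannot both be present.
  If half of the edges are present, this forces them to alternate.\<close>

lemma flip_alternating:
  assumes H: "H \<in> Config k d" and j: "0 < j" "j < k"
    and half: "2 * ((\<Sum>(m, c)\<in>left_edges d j n. edge_ind d H (j - 1) m c) + (\<Sum>(m, c)\<in>right_edges d j n. edge_ind d H j m c))
      = int (card (left_edges d j n)) + int (card (right_edges d j n))"
  shows "\<exists>t\<in>{1, -1}. (\<forall>(m, c)\<in>left_edges d j n. 2 * edge_ind d H (j - 1) m c = 1 - t * side_sign n m c) \<and>
    (\<forall>(m, c)\<in>right_edges d j n. 2 * edge_ind d H j m c = 1 + t * side_sign n m c)"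
proof -
  obtain i where i: "j = Suc i" using j(1) by (cases j) auto
  have ik: "i < k" using i j by simp
  note nn = edge_ind_nonneg[OF H ik] edge_ind_nonneg[OF H j(2)]
  note c01 = edge_ind_cases[OF H ik] edge_ind_cases[OF H j(2)]
  have Wl: "edge_ind d H i m Hz + edge_ind d H i m Up \<le> 1" "edge_ind d H i m Hz + edge_ind d H i m Dn \<le> 1" "edge_ind d H i m Up + edge_ind d H i m Dn \<le> 1" for m
    using edge_ind_sum[of d H i m] nn(1)[of m Hz] nn(1)[of m Up] nn(1)[of m Dn] by linarith+
  have Wr: "edge_ind d H j m Hz + edge_ind d H j m Up \<le> 1" "edge_ind d H j m Hz + edge_ind d H j m Dn \<le> 1" "edge_ind d H j m Up + edge_ind d H j m Dn \<le> 1" for m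
    using edge_ind_sum[of d H j m] nn(2)[of m Hz] nn(2)[of m Up] nn(2)[of m Dn] by linarith+
  have V: "(\<Sum>(m, c)\<in>in_left d i a. edge_ind d H i m c) + (\<Sum>(m, c)\<in>in_right d j a. edge_ind d H j m c) = 1" for a
    unfolding in_left_sum in_right_sum i by simp
  have pr: "profile (H a)" for a using H by (auto simp: Config_def)
  \<comment> \<open>The tip of the face lies in a neighbouring \<open>V\<close>-column, possibly an
    outer one. Only its edges inside the adjacent strip enter, and these sum to at most 1 in every
    column.\<close>
  have Vl: "(\<Sum>(m, c)\<in>in_right d i a. edge_ind d H i m c) \<le> 1" for a
    unfolding in_right_sum using profile_dec[OF pr, of i a] by simp
  have Vr: "(\<Sum>(m, c)\<in>in_left d j a. edge_ind d H j m c) \<le> 1" for a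
    unfolding in_left_sum using profile_lip[OF pr, of "Suc j" a] by simp
  have ji: "j - 1 = i" and dj: "d (Suc i) = d j" using i by auto
  define sl where "sl = shift (d j)"
  define sr where "sr = shift (d (Suc j))"
  note defs = left_edges_def right_edges_def in_left_def in_right_def dj sl_def[symmetric] sr_def[symmetric]
  show ?thesis
  proof (cases "primed (d j)"; cases "primed (d (Suc j))")
    assume p: "primed (d j)" "primed (d (Suc j))"
    let ?a = "edge_ind d H i (n - sl) Up" and ?b = "edge_ind d H i (n - sl) Dn"
    let ?w = "edge_ind d H j (n - 1) Hz" and ?x = "edge_ind d H j n Hz" and ?y = "edge_ind d H j (n - 1) Up" and ?z = "edge_ind d H j n Dn"
    have sum: "?a + ?b + ?w + ?x + ?y + ?z = 3" using half p unfolding ji by (simp add: defs)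
    have "?a + ?x \<le> 1" using V[of n] p nn(1)[of "n - sl + 1" Dn] by (simp add: defs)
    moreover have "?b + ?w \<le> 1" using V[of "n - 1"] p nn(1)[of "n - sl - 1" Up] by (simp add: defs algebra_simps)
    moreover have "?y + ?z \<le> 1" using Vr[of "n - 1 + sr"] p by (simp add: defs)
    ultimately have "(?a = 1 \<and> ?b = 0 \<and> ?w = 1 \<and> ?x = 0 \<and> ?y = 0 \<and> ?z = 1) \<or> (?a = 0 \<and> ?b = 1 \<and> ?w = 0 \<and> ?x = 1 \<and> ?y = 1 \<and> ?z = 0)"
      using sum c01(1)[of "n - sl" Up] Wl(3)[of "n - sl"] Wr(1)[of "n - 1"] Wr(2)[of n] by linarith
    then show ?thesis unfolding ji using p by (auto simp: defs side_sign_def)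
  next
    assume p: "primed (d j)" "\<not> primed (d (Suc j))"
    let ?a = "edge_ind d H i (n - sl) Up" and ?b = "edge_ind d H i (n - sl) Dn"
    let ?y = "edge_ind d H j (n - sr) Up" and ?z = "edge_ind d H j (n - sr) Dn"
    have sum: "?a + ?b + ?y + ?z = 2" using half p unfolding ji by (simp add: defs)
    have "?a + ?y \<le> 1" using V[of n] p nn(1)[of "n - sl + 1" Dn] nn(2)[of "n - sr + 1" Dn] by (simp add: defs)
    moreover have "?b + ?z \<le> 1" using V[of "n - 1"] p nn(1)[of "n - sl - 1" Up] nn(2)[of "n - sr - 1" Up] by (simp add: defs algebra_simps)
    ultimately have "(?a = 1 \<and> ?b = 0 \<and> ?y = 0 \<and> ?z = 1) \<or> (?a = 0 \<and> ?b = 1 \<and> ?y = 1 \<and> ?z = 0)"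
      using sum c01(1)[of "n - sl" Up] Wl(3)[of "n - sl"] Wr(3)[of "n - sr"] by linarith
    then show ?thesis unfolding ji using p by (auto simp: defs side_sign_def)
  next
    assume p: "\<not> primed (d j)" "primed (d (Suc j))"
    let ?a = "edge_ind d H i (n - 1) Hz" and ?b = "edge_ind d H i n Hz" and ?c = "edge_ind d H i (n - 1) Up" and ?e = "edge_ind d H i n Dn"
    let ?w = "edge_ind d H j (n - 1) Hz" and ?x = "edge_ind d H j n Hz" and ?y = "edge_ind d H j (n - 1) Up" and ?z = "edge_ind d H j n Dn"
    have sum: "?a + ?b + ?c + ?e + ?w + ?x + ?y + ?z = 4" using half p unfolding ji by (simp add: defs)
    have "?b + ?x \<le> 1" using V[of n] p by (simp add: defs)
    moreover have "?a + ?w \<le> 1" using V[of "n - 1"] p by (simp add: defs)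
    moreover have "?y + ?z \<le> 1" using Vr[of "n - 1 + sr"] p by (simp add: defs)
    moreover have "?c + ?e \<le> 1" using Vl[of "n - 1 + sl"] p by (simp add: defs)
    ultimately have "(?b = 1 \<and> ?a = 0 \<and> ?c = 1 \<and> ?e = 0 \<and> ?w = 1 \<and> ?x = 0 \<and> ?y = 0 \<and> ?z = 1) \<or>
       (?b = 0 \<and> ?a = 1 \<and> ?c = 0 \<and> ?e = 1 \<and> ?w = 0 \<and> ?x = 1 \<and> ?y = 1 \<and> ?z = 0)"
      using sum c01(1)[of n Hz] Wl(1)[of "n - 1"] Wl(2)[of n] Wr(1)[of "n - 1"] Wr(2)[of n] by linarith
    then show ?thesis unfolding ji using p by (auto simp: defs side_sign_def)
  next
    assume p: "\<not> primed (d j)" "\<not> primed (d (Suc j))"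
    let ?a = "edge_ind d H i (n - 1) Hz" and ?b = "edge_ind d H i n Hz" and ?c = "edge_ind d H i (n - 1) Up" and ?e = "edge_ind d H i n Dn"
    let ?y = "edge_ind d H j (n - sr) Up" and ?z = "edge_ind d H j (n - sr) Dn"
    have sum: "?a + ?b + ?c + ?e + ?y + ?z = 3" using half p unfolding ji by (simp add: defs)
    have "?b + ?y \<le> 1" using V[of n] p nn(2)[of "n - sr + 1" Dn] by (simp add: defs)
    moreover have "?a + ?z \<le> 1" using V[of "n - 1"] p nn(2)[of "n - sr - 1" Up] by (simp add: defs algebra_simps)
    moreover have "?c + ?e \<le> 1" using Vl[of "n - 1 + sl"] p by (simp add: defs)
    ultimately have "(?b = 1 \<and> ?a = 0 \<and> ?c = 1 \<and> ?e = 0 \<and> ?y = 0 \<and> ?z = 1) \<or> (?b = 0 \<and> ?a = 1 \<and> ?c = 0 \<and> ?e = 1 \<and> ?y = 1 \<and> ?z = 0)"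
      using sum c01(1)[of n Hz] Wl(1)[of "n - 1"] Wl(2)[of n] Wr(3)[of "n - sr"] by linarith
    then show ?thesis unfolding ji using p by (auto simp: defs side_sign_def)
  qed
qed

text \<open>Converse of \<open>flip_of_config\<close>. Since the edges alternate, raising or
  lowering the height replaces the values on the boundary by their complements, so all values stay
  nonnegative and \<open>ConfigI\<close> applies.\<close>

lemma flip_config_ex:
  assumes H: "H \<in> Config k d" and k: "k \<ge> 1" and fl: "flip k d F (matching_of k d H) M'"
  obtains j n t where "0 < j" "j < k" "F = cell k d j n" "t \<in> {1, -1}" "raise_at j n t H \<in> Config k d"
    "M' = matching_of k d (raise_at j n t H)"
proof -
  obtain j n where F: "F = cell k d j n" and j: "0 < j" "j < k"
    using fl unfolding flip_def bounded_faces_eq[OF k] by blast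
  let ?E = "face_edges k d (cell k d j n)"
  obtain p where "card ?E = 2 * p" "card (matching_of k d H \<inter> ?E) = p"
    and M': "M' = (matching_of k d H - ?E) \<union> (?E - matching_of k d H)"
    using fl unfolding flip_def F by blast
  then have "int (card ?E) = 2 * int (card (matching_of k d H \<inter> ?E))" by simp
  then have "2 * ((\<Sum>(m, c)\<in>left_edges d j n. edge_ind d H (j - 1) m c) + (\<Sum>(m, c)\<in>right_edges d j n. edge_ind d H j m c))
      = int (card (left_edges d j n)) + int (card (right_edges d j n))"
    unfolding card_matching_face[OF H j, of n] by simp
  from flip_alternating[OF H j this] obtain t where t: "t \<in> {1, -1}"
    and l: "\<And>m c. (m, c) \<in> left_edges d j n \<Longrightarrow> 2 * edge_ind d H (j - 1) m c = 1 - t * side_sign n m c"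
    and r: "\<And>m c. (m, c) \<in> right_edges d j n \<Longrightarrow> 2 * edge_ind d H j m c = 1 + t * side_sign n m c" by blast
  have H': "raise_at j n t H \<in> Config k d"
  proof (rule ConfigI)
    show "raise_at j n t H 0 = ground" using H j by (auto simp: raise_at_def Config_def)
    show "raise_at j n t H i = ground" if "k \<le> i" for i using H j that by (auto simp: raise_at_def Config_def)
    show "\<exists>N. \<forall>y. N \<le> \<bar>y\<bar> \<longrightarrow> raise_at j n t H i y = ground y" for i
    proof -
      have "profile (H i)" using H by (auto simp: Config_def)
      then obtain N where N: "\<And>y. N \<le> \<bar>y\<bar> \<Longrightarrow> H i y = ground y" by (rule profile_bound) blast
      show ?thesis
      proof (intro exI allI impI)
        fix y assume "max N (\<bar>n\<bar> + 1) \<le> \<bar>y\<bar>"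
        then have "H i y = ground y" "y \<noteq> n" using N[of y] by auto
        then show "raise_at j n t H i y = ground y" by (auto simp: raise_at_def)
      qed
    qed
    show "0 \<le> edge_ind d (raise_at j n t H) i m c" if i: "i < k" for i m c
    proof -
      have "flip_sign d j n i m c = 0 \<or> 2 * edge_ind d H i m c = 1 - t * flip_sign d j n i m c"
        using l[of m c] r[of m c] by (auto simp: flip_sign_def)
      then show ?thesis unfolding edge_ind_raise_at using edge_ind_nonneg[OF H i, of m c] t flip_sign_cases[of d j n i m c] by auto
    qed
  qed
  show ?thesis
    by (rule that[OF j F t H']) (simp add: M' matching_of_raise_at[OF H H' t j])
qed

section \<open>Reachability\<close>

text \<open>The tie-breaker in the potential of \<open>removable_ex\<close>: adjacent columns with
  equal heights at the same position differ in \<open>tilt\<close> by 1, in the direction of the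
  step between them.\<close>

definition tilt :: "(nat \<Rightarrow> diamond) \<Rightarrow> nat \<Rightarrow> int" where
  "tilt d j = (\<Sum>i\<in>{1..j}. if d i \<in> ups then 1 else -1)"

lemma tilt_Suc: "tilt d (Suc j) = tilt d j + (if d (Suc j) \<in> ups then 1 else -1)"
proof -
  have "{1..Suc j} = insert (Suc j) {1..j}" by auto
  then show ?thesis by (simp add: tilt_def)
qed

lemma raise_at_other [simp]:
  "(i, m) \<noteq> (j, n) \<Longrightarrow> raise_at j n t H i m = H i m"
  by (auto simp: raise_at_def)

lemma finite_excess:
  assumes H: "H \<in> Config k d"
  shows "finite {(j, n). H j n \<noteq> ground n}"
proof (rule finite_subset)
  show "{(j, n). H j n \<noteq> ground n} \<subseteq> (SIGMA j:{..<k}. {n. H j n \<noteq> ground n})"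
    using H by (auto simp: Config_def not_le[symmetric])
  show "finite (SIGMA j:{..<k}. {n. H j n \<noteq> ground n})"
  proof (rule finite_SigmaI)
    fix j
    have "profile (H j)" using H by (auto simp: Config_def)
    then obtain N where N: "\<And>y. N \<le> \<bar>y\<bar> \<Longrightarrow> H j y = ground y" by (rule profile_bound) blast
    show "finite {n. H j n \<noteq> ground n}"
    proof (rule finite_subset)
      show "{n. H j n \<noteq> ground n} \<subseteq> {-N..N}"
      proof
        fix y assume "y \<in> {n. H j n \<noteq> ground n}"
        then have "\<not> N \<le> \<bar>y\<bar>" using N by auto
        then show "y \<in> {-N..N}" by auto
      qed
    qed simp
  qed simp
qed

text \<open>A vertex maximizing \<open>4 * excess + 2 * \<bar>n\<bar> - tilt\<close> can be lowered: if a constraint blocked it, then the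
  height at the neighbouring position would be determined by it, and the potential would be larger there.\<close>

lemma removable_ex:
  assumes H: "H \<in> Config k d" and ne: "H \<noteq> (\<lambda>_. ground)"
  obtains j n where "0 < j" "j < k" "raise_at j n (-1) H \<in> Config k d"
proof -
  define w :: "int \<Rightarrow> int" where "w n = 2 * \<bar>n\<bar>" for n
  \<comment> \<open>The weights 4 and 2 are such that passing to \<open>n + 1\<close> at equal
    height, or to \<open>n - 1\<close> at a height larger by 1, raises the first two terms by at
    least 2, whatever the sign of \<open>n\<close>; \<open>tilt\<close> can take back at most
    1.\<close>
  define pot where "pot j n = 4 * (H j n - ground n) + w n - tilt d j" for j n
  let ?S = "{(j, n). H j n \<noteq> ground n}"
  have fin: "finite ?S" by (rule finite_excess[OF H])
  obtain j0 n0 where "H j0 n0 \<noteq> ground n0" using ne by (meson ext)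
  then have ne: "case_prod pot ` ?S \<noteq> {}" by blast
  note finI = finite_imageI[OF fin, of "case_prod pot"]
  obtain u where u0: "u \<in> ?S" "Max (case_prod pot ` ?S) = case_prod pot u"
    using Max_in[OF finI ne] by (rule imageE)
  have u: "case_prod pot v \<le> case_prod pot u" if "v \<in> ?S" for v
    using Max_ge[OF finI imageI[OF that]] unfolding u0(2) .
  obtain j n where jn: "u = (j, n)" by fastforce
  have pr: "profile (H i)" for i using H by (auto simp: Config_def)
  have gr: "ground y \<le> H i y" for i y by (rule profile_ge_ground[OF pr])
  have pos: "H j n > ground n" using u0(1) gr[of n j] unfolding jn by auto
  have best: "pot i m \<le> pot j n" if "H i m > ground m" for i m
    using u[of "(i, m)"] that unfolding jn by simp
  have "H 0 = ground" "\<And>i. k \<le> i \<Longrightarrow> H i = ground" using H by (auto simp: Config_def)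
  then have j: "0 < j" "j < k" using pos by (metis gr_zeroI less_irrefl, metis not_le less_irrefl)
  note gd = ground_def
  \<comment> \<open>The facts \<open>right\<close>, \<open>left\<close> and \<open>same\<close>
    exclude the three equalities through which a constraint could block the lowering: in each case
    the other position would have larger potential.\<close>
  have right: "H i (n + 1) \<noteq> H j n" if "\<bar>tilt d i - tilt d j\<bar> \<le> 1" for i
  proof
    assume "H i (n + 1) = H j n"
    moreover define n' where "n' = n + 1"
    ultimately have eq: "H i n' = H j n" by simp
    have "ground n' \<le> ground n" by (simp add: gd n'_def)
    then have "pot i n' \<le> pot j n" using best[of n' i] eq pos by simp
    moreover have "4 * (ground n - ground n') + (w n' - w n) \<ge> 2"
      by (cases "n \<ge> 0") (auto simp: gd w_def n'_def)
    moreover have "tilt d i - tilt d j \<le> 1" using that by linarith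
    ultimately show False using eq unfolding pot_def by auto
  qed
  have left: "H i (n - 1) \<noteq> H j n + 1" if "\<bar>tilt d i - tilt d j\<bar> \<le> 1" for i
  proof
    assume eq: "H i (n - 1) = H j n + 1"
    have "ground (n - 1) \<le> ground n + 1" by (simp add: gd)
    then have "pot i (n - 1) \<le> pot j n" using best[of "n - 1" i] eq pos by simp
    moreover have "4 * (ground n + 1 - ground (n - 1)) + (w (n - 1) - w n) \<ge> 2"
      by (cases "n \<ge> 1") (auto simp: gd w_def)
    moreover have "tilt d i - tilt d j \<le> 1" using that by linarith
    ultimately show False using eq unfolding pot_def by auto
  qed
  have same: "H i n \<noteq> H j n" if "tilt d i < tilt d j" for i
    using best[of n i] pos that by (auto simp: pot_def)
  define H' where "H' = raise_at j n (-1) H"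
  have H'eq: "H' i m = H i m - (if i = j \<and> m = n then 1 else 0)" for i m by (simp add: H'_def raise_at_def)
  have j1: "H j (n + 1) < H j n" using right[of j] profile_dec[OF pr, of j n] by simp
  have j2: "H j (n - 1) \<le> H j n" using left[of j] profile_lip'[OF pr, of j n] by simp
  have prof: "profile (H' i)" for i
  proof -
    obtain N where N: "\<And>y. N \<le> \<bar>y\<bar> \<Longrightarrow> H i y = ground y" using pr[of i] by (rule profile_bound) blast
    show ?thesis
    proof (rule profileI[where N = "max N (\<bar>n\<bar> + 1)"])
      fix y
      show "H' i (y + 1) \<le> H' i y"
        using profile_dec[OF pr, of i y] j1 by (auto simp: H'eq)
      show "H' i y \<le> H' i (y + 1) + 1"
      proof (cases "i = j \<and> y + 1 = n")
        case True
        then have "y = n - 1" by simp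
        then show ?thesis using True j2 by (auto simp: H'eq)
      next
        case False
        then show ?thesis using profile_lip[OF pr, of i y] by (auto simp: H'eq)
      qed
      show "H' i y = ground y" if "max N (\<bar>n\<bar> + 1) \<le> \<bar>y\<bar>" using N[of y] that by (auto simp: H'eq)
    qed
  qed
  have step: "step (d (Suc i)) (H' i) (H' (Suc i))" if i: "i < k" for i
  proof -
    have old: "step (d (Suc i)) (H i) (H (Suc i))" using H i by (auto simp: Config_def)
    have tilt: "\<bar>tilt d i - tilt d (Suc i)\<bar> \<le> 1" "\<bar>tilt d (Suc i) - tilt d i\<bar> \<le> 1" by (auto simp: tilt_Suc)
    show ?thesis
    proof (cases "d (Suc i)")
      case Prec
      have t: "tilt d (Suc i) = tilt d i + 1" by (simp add: tilt_Suc Prec ups_def)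
      have o: "H i y \<le> H (Suc i) y" "H (Suc i) y \<le> H i (y + 1) + 1" for y using old Prec by auto
      have "H' i y \<le> H' (Suc i) y" for y
        using o(1)[of y] same[of i] t by (auto simp: H'eq)
      moreover have "H' (Suc i) y \<le> H' i (y + 1) + 1" for y
      proof (cases "i = j \<and> y + 1 = n")
        case True
        then have "y = n - 1" "i = j" by auto
        then show ?thesis using o(2)[of y] left[of "Suc i"] tilt by (auto simp: H'eq)
      qed (use o(2)[of y] in \<open>auto simp: H'eq\<close>)
      ultimately show ?thesis using Prec by simp
    next
      case Prec'
      have t: "tilt d (Suc i) = tilt d i + 1" by (simp add: tilt_Suc Prec' ups_def)
      have o: "H i y \<le> H (Suc i) y" "H (Suc i) y \<le> H i (y - 1)" for y using old Prec' by auto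
      have "H' i y \<le> H' (Suc i) y" for y
        using o(1)[of y] same[of i] t by (auto simp: H'eq)
      moreover have "H' (Suc i) y \<le> H' i (y - 1)" for y
      proof (cases "i = j \<and> y - 1 = n")
        case True
        then have "y = n + 1" "i = j" by auto
        then show ?thesis using o(2)[of y] right[of "Suc i"] tilt by (auto simp: H'eq)
      qed (use o(2)[of y] in \<open>auto simp: H'eq\<close>)
      ultimately show ?thesis using Prec' by simp
    next
      case Succ
      have t: "tilt d (Suc i) = tilt d i - 1" by (simp add: tilt_Suc Succ ups_def)
      have o: "H (Suc i) y \<le> H i y" "H i y \<le> H (Suc i) (y + 1) + 1" for y using old Succ by auto
      have "H' (Suc i) y \<le> H' i y" for y
        using o(1)[of y] same[of "Suc i"] t by (auto simp: H'eq)
      moreover have "H' i y \<le> H' (Suc i) (y + 1) + 1" for y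
      proof (cases "Suc i = j \<and> y + 1 = n")
        case True
        then have "y = n - 1" "j = Suc i" by auto
        then show ?thesis using o(2)[of y] left[of i] tilt by (auto simp: H'eq)
      qed (use o(2)[of y] in \<open>auto simp: H'eq\<close>)
      ultimately show ?thesis using Succ by simp
    next
      case Succ'
      have t: "tilt d (Suc i) = tilt d i - 1" by (simp add: tilt_Suc Succ' ups_def)
      have o: "H (Suc i) y \<le> H i y" "H i y \<le> H (Suc i) (y - 1)" for y using old Succ' by auto
      have "H' (Suc i) y \<le> H' i y" for y
        using o(1)[of y] same[of "Suc i"] t by (auto simp: H'eq)
      moreover have "H' i y \<le> H' (Suc i) (y - 1)" for y
      proof (cases "Suc i = j \<and> y - 1 = n")
        case True
        then have "y = n + 1" "j = Suc i" by auto
        then show ?thesis using o(2)[of y] right[of i] tilt by (auto simp: H'eq)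
      qed (use o(2)[of y] in \<open>auto simp: H'eq\<close>)
      ultimately show ?thesis using Succ' by simp
    qed
  qed
  have "H' \<in> Config k d"
    using prof step j H unfolding Config_def by (auto simp: H'_def raise_at_def)
  then show ?thesis using that j unfolding H'_def by blast
qed

section \<open>Shortest flip sequences\<close>

definition volume :: "nat \<Rightarrow> (nat \<Rightarrow> int \<Rightarrow> int) \<Rightarrow> nat" where
  "volume k H = (\<Sum>i\<in>{1..<k}. nat (area (H i)))"

lemma area_raise_at:
  assumes "H \<in> Config k d" "raise_at j n t H \<in> Config k d"
  shows "area (raise_at j n t H i) = area (H i) + (if i = j then t else 0)"
proof (cases "i = j")
  case True
  have "profile (H j)" "profile ((H j)(n := H j n + t))" using assms by (auto simp: Config_def raise_at_def fun_upd_same dest!: spec[of _ j])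
  then show ?thesis using area_upd[of "H j" n "H j n + t"] True by (simp add: raise_at_def)
qed (simp add: raise_at_def)

lemma flip_seq_append:
  "flip_seq k d M (Fs @ Gs) M' \<longleftrightarrow> (\<exists>M1. flip_seq k d M Fs M1 \<and> flip_seq k d M1 Gs M')"
  by (induction Fs arbitrary: M) auto

text \<open>The heights are lowered one by one down to \<open>ground\<close>, each time decreasing
  the volume by 1, and the flips are performed in reverse order.\<close>

lemma flip_seq_to_config:
  assumes "H \<in> Config k d"
  shows "\<exists>Fs. flip_seq k d (matching_of k d (\<lambda>_. ground)) Fs (matching_of k d H) \<and> length Fs = volume k H"
  using assms
proof (induction "volume k H" arbitrary: H rule: less_induct)
  case less
  show ?case
  proof (cases "H = (\<lambda>_. ground)")
    case True
    then show ?thesis by (intro exI[of _ "[]"]) (simp add: volume_def)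
  next
    case False
    obtain j n where j: "0 < j" "j < k" and H': "raise_at j n (-1) H \<in> Config k d"
      using removable_ex[OF less.prems False] by blast
    let ?H' = "raise_at j n (-1) H"
    have ar: "area (?H' i) = area (H i) + (if i = j then -1 else 0)" for i
      by (rule area_raise_at[OF less.prems H'])
    have "profile (?H' j)" using H' by (auto simp: Config_def)
    then have "area (?H' j) \<ge> 0" by (rule area_nonneg)
    then have "nat (area (H j)) = Suc (nat (area (?H' j)))" using ar[of j] by simp
    moreover have "(\<Sum>i\<in>{1..<k} - {j}. nat (area (H i))) = (\<Sum>i\<in>{1..<k} - {j}. nat (area (?H' i)))"
      using ar by (intro sum.cong) auto
    ultimately have vol: "volume k H = Suc (volume k ?H')"
      unfolding volume_def using j sum.remove[of "{1..<k}" j "\<lambda>i. nat (area (H i))"] sum.remove[of "{1..<k}" j "\<lambda>i. nat (area (?H' i))"]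
      by simp
    then obtain Fs where Fs: "flip_seq k d (matching_of k d (\<lambda>_. ground)) Fs (matching_of k d ?H')" "length Fs = volume k ?H'"
      using less.hyps[of ?H'] H' by auto
    have HH: "raise_at j n 1 ?H' = H" by (rule ext, rule ext) (simp add: raise_at_def)
    have "flip k d (cell k d j n) (matching_of k d ?H') (matching_of k d (raise_at j n 1 ?H'))"
      by (rule flip_of_config[OF H' _ _ j]) (use less.prems HH in simp_all)
    then have "flip_seq k d (matching_of k d (\<lambda>_. ground)) (Fs @ [cell k d j n]) (matching_of k d H)"
      using Fs(1) unfolding flip_seq_append HH by auto
    then show ?thesis using Fs(2) vol by (intro exI[of _ "Fs @ [cell k d j n]"]) simp
  qed
qed

definition flip_count :: "nat \<Rightarrow> (nat \<Rightarrow> diamond) \<Rightarrow> point set list \<Rightarrow> nat \<Rightarrow> nat" where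
  "flip_count k d Fs i = length (filter (\<lambda>F. face_abscissa k d F = 3/2 * real i) Fs)"

text \<open>A flip changes the area of just the column at its abscissa, by 1 up or down. The bound
  on the area is an inequality because flips may also lower.\<close>

lemma flip_seq_from_config:
  assumes k: "k \<ge> 1"
  shows "H \<in> Config k d \<Longrightarrow> flip_seq k d (matching_of k d H) Fs M' \<Longrightarrow>
    \<exists>H'\<in>Config k d. M' = matching_of k d H' \<and> (\<forall>i. area (H' i) \<le> area (H i) + int (flip_count k d Fs i)) \<and>
      length Fs = (\<Sum>i\<in>{1..<k}. flip_count k d Fs i)"
proof (induction Fs arbitrary: H)
  case Nil
  then show ?case by (intro bexI[of _ H]) (auto simp: flip_count_def)
next
  case (Cons F Fs)
  then obtain M1 where M1: "flip k d F (matching_of k d H) M1" "flip_seq k d M1 Fs M'" by auto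
  obtain j n t where j: "0 < j" "j < k" and F: "F = cell k d j n" and t: "t \<in> {1, -1}"
    and H1: "raise_at j n t H \<in> Config k d" and M1': "M1 = matching_of k d (raise_at j n t H)"
    using flip_config_ex[OF Cons.prems(1) k M1(1)] by metis
  obtain H' where H': "H' \<in> Config k d" "M' = matching_of k d H'"
    "\<And>i. area (H' i) \<le> area (raise_at j n t H i) + int (flip_count k d Fs i)" "length Fs = (\<Sum>i\<in>{1..<k}. flip_count k d Fs i)"
    using Cons.IH[OF H1] M1(2) unfolding M1' by blast
  have cnt: "flip_count k d (F # Fs) i = flip_count k d Fs i + (if i = j then 1 else 0)" for i
    unfolding flip_count_def F using face_abscissa_cell[OF j, of d n] by auto
  have "area (H' i) \<le> area (H i) + int (flip_count k d (F # Fs) i)" for i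
    using H'(3)[of i] t unfolding area_raise_at[OF Cons.prems(1) H1] cnt by auto
  moreover have "length (F # Fs) = (\<Sum>i\<in>{1..<k}. flip_count k d (F # Fs) i)"
    unfolding cnt sum.distrib using H'(4) j by simp
  ultimately show ?case using H' by blast
qed

definition config_monomial :: "nat \<Rightarrow> (nat \<Rightarrow> int \<Rightarrow> int) \<Rightarrow> (nat \<Rightarrow>\<^sub>0 nat)" where
  "config_monomial k H = (\<Sum>i\<in>{1..<k}. Poly_Mapping.single i (nat (area (H i))))"

theorem flip_reachable_eq:
  assumes k: "k \<ge> 1"
  shows "flip_reachable k d = matching_of k d ` Config k d"
proof (intro set_eqI iffI)
  fix M assume "M \<in> flip_reachable k d"
  then obtain Fs where "flip_seq k d (matching_of k d (\<lambda>_. ground)) Fs M"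
    unfolding flip_reachable_def min_matching_eq[OF k] by blast
  then show "M \<in> matching_of k d ` Config k d"
    using flip_seq_from_config[OF k ground_const_config] by blast
next
  fix M assume "M \<in> matching_of k d ` Config k d"
  then obtain H where "H \<in> Config k d" "M = matching_of k d H" by blast
  then show "M \<in> flip_reachable k d"
    unfolding flip_reachable_def min_matching_eq[OF k] using admissible_of_config[OF _ k] flip_seq_to_config by blast
qed

text \<open>The areas bound the flip counts from below column by column, and some sequence attains
  the sum of these bounds. Hence a shortest sequence attains every one of them, and its monomial
  does not depend on the choice of the sequence.\<close>

theorem is_exponent_iff:
  assumes k: "k \<ge> 1" and H: "H \<in> Config k d"
  shows "is_exponent k d (matching_of k d H) m \<longleftrightarrow> m = config_monomial k H"
proof -
  let ?G = "matching_of k d (\<lambda>_. ground)"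
  have lower: "nat (area (H i)) \<le> flip_count k d Fs i" "length Fs = (\<Sum>i\<in>{1..<k}. flip_count k d Fs i)"
    if fs: "flip_seq k d ?G Fs (matching_of k d H)" for Fs i
  proof -
    obtain H' where H': "H' \<in> Config k d" "matching_of k d H = matching_of k d H'"
      "\<And>i. area (H' i) \<le> area ground + int (flip_count k d Fs i)" "length Fs = (\<Sum>i\<in>{1..<k}. flip_count k d Fs i)"
      using flip_seq_from_config[OF k ground_const_config fs] by blast
    have "H = H'" by (rule matching_of_inj[OF H H'(1) k H'(2)])
    then show "nat (area (H i)) \<le> flip_count k d Fs i" "length Fs = (\<Sum>i\<in>{1..<k}. flip_count k d Fs i)"
      using H'(3)[of i] H'(4) by auto
  qed
  have len: "volume k H \<le> length Fs" if "flip_seq k d ?G Fs (matching_of k d H)" for Fs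
    unfolding lower(2)[OF that] volume_def by (rule sum_mono) (rule lower(1)[OF that])
  have monom: "flip_monomial k d Fs = config_monomial k H" if fs: "flip_seq k d ?G Fs (matching_of k d H)" "length Fs = volume k H" for Fs
  proof -
    have "flip_count k d Fs i = nat (area (H i))" if i: "i \<in> {1..<k}" for i
    proof (rule ccontr)
      assume "flip_count k d Fs i \<noteq> nat (area (H i))"
      then have "nat (area (H i)) < flip_count k d Fs i" using lower(1)[OF fs(1), of i] by simp
      then have "volume k H < (\<Sum>i\<in>{1..<k}. flip_count k d Fs i)"
        unfolding volume_def using i by (intro sum_strict_mono_ex1) (auto intro: lower(1)[OF fs(1)])
      then show False using lower(2)[OF fs(1)] fs(2) by simp
    qed
    then show ?thesis unfolding flip_monomial_def config_monomial_def flip_count_def[symmetric] by (intro sum.cong) auto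
  qed
  obtain Fs0 where Fs0: "flip_seq k d ?G Fs0 (matching_of k d H)" "length Fs0 = volume k H"
    using flip_seq_to_config[OF H] by blast
  have minimal: "min_flip_seq k d (matching_of k d H) Fs \<longleftrightarrow> flip_seq k d ?G Fs (matching_of k d H) \<and> length Fs = volume k H" for Fs
    unfolding min_flip_seq_def min_matching_eq[OF k] using Fs0 len by (metis le_antisym)
  show ?thesis unfolding is_exponent_def minimal using monom Fs0 by blast
qed

section \<open>The product formula\<close>

lemma lookup_sum_single:
  assumes "finite I"
  shows "Poly_Mapping.lookup (\<Sum>i\<in>I. Poly_Mapping.single i (f i)) l = (if l \<in> I then f l else 0)"
proof -
  have "Poly_Mapping.lookup (\<Sum>i\<in>I. Poly_Mapping.single i (f i)) l = (\<Sum>i\<in>I. if i = l then f i else 0)"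
    unfolding lookup_sum by (rule sum.cong) (auto simp: lookup_single when_def)
  then show ?thesis using assms by (simp add: sum.delta)
qed

definition pair_monomial :: "nat \<times> nat \<Rightarrow> (nat \<Rightarrow>\<^sub>0 nat)" where
  "pair_monomial p = (\<Sum>l\<in>{fst p..<snd p}. Poly_Mapping.single l 1)"

lemma lookup_pair_monomial:
  "Poly_Mapping.lookup (pair_monomial p) l = (if fst p \<le> l \<and> l < snd p then 1 else 0)"
  unfolding pair_monomial_def lookup_sum_single[OF finite_atLeastLessThan] by simp

lemma config_monomial_eq_filling:
  assumes H: "H \<in> Config k d" and a: "\<And>l. load k d a l = area (H l)"
  shows "(\<Sum>p\<in>pairs k d. smul (a p) (pair_monomial p)) = config_monomial k H"
proof (rule poly_mapping_eqI)
  fix l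
  have "int (Poly_Mapping.lookup (\<Sum>p\<in>pairs k d. smul (a p) (pair_monomial p)) l) = load k d a l"
    unfolding lookup_sum lookup_smul lookup_pair_monomial load_def of_nat_sum
    by (rule sum.cong) auto
  then have "Poly_Mapping.lookup (\<Sum>p\<in>pairs k d. smul (a p) (pair_monomial p)) l = nat (area (H l))" using a by simp
  moreover have "area (H l) = 0" if "l \<notin> {1..<k}"
  proof -
    have "l = 0 \<or> k \<le> l" using that by auto
    then have "H l = ground" using H by (auto simp: Config_def)
    then show ?thesis by simp
  qed
  ultimately show "Poly_Mapping.lookup (\<Sum>p\<in>pairs k d. smul (a p) (pair_monomial p)) l = Poly_Mapping.lookup (config_monomial k H) l"
    unfolding config_monomial_def lookup_sum_single[OF finite_atLeastLessThan] by simp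
qed

lemma pair_monomial_neq_0: "p \<in> pairs k d \<Longrightarrow> pair_monomial p \<noteq> 0"
proof
  assume p: "p \<in> pairs k d" and "pair_monomial p = 0"
  then have "Poly_Mapping.lookup (pair_monomial p) (fst p) = 0" by simp
  then show False using p unfolding lookup_pair_monomial by (auto simp: pairs_def)
qed

theorem gen_fun_Config:
  "gen_fun (Config k d) (config_monomial k) = (\<Prod>p\<in>pairs k d. gen_fun (mults d p) (\<lambda>n. smul n (pair_monomial p))) \<and>
   fin_fibers (Config k d) (config_monomial k)"
proof -
  obtain f where f: "bij_betw f (Config k d) (Fillings k d)" "\<And>H l. H \<in> Config k d \<Longrightarrow> load k d (f H) l = area (H l)"
    using Config_Fillings by blast
  let ?w = "\<lambda>a. \<Sum>p\<in>pairs k d. smul (a p) (pair_monomial p)"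
  have w: "?w (f H) = config_monomial k H" if "H \<in> Config k d" for H
    by (rule config_monomial_eq_filling[OF that f(2)[OF that]])
  have "gen_fun (Config k d) (config_monomial k) = gen_fun (Fillings k d) ?w"
    by (rule gen_fun_bij[OF f(1)]) (rule w)
  moreover have "fin_fibers (Config k d) (config_monomial k) \<longleftrightarrow> fin_fibers (Fillings k d) ?w"
    by (rule fin_fibers_bij[OF f(1)]) (rule w)
  moreover have "gen_fun (Fillings k d) ?w = (\<Prod>p\<in>pairs k d. gen_fun (mults d p) (\<lambda>n. smul n (pair_monomial p)))"
    by (rule gen_fun_Fill[OF finite_pairs pair_monomial_neq_0])
  moreover have "fin_fibers (Fillings k d) ?w"
    by (rule fin_fibers_Fill[OF finite_pairs pair_monomial_neq_0])
  ultimately show ?thesis by simp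
qed

lemma factor_eq:
  assumes "p \<in> pairs k d"
  shows "gen_fun (mults d p) (\<lambda>n. smul n (pair_monomial p)) =
    (1 + of_int (eps (d (fst p)) (d (snd p))) * (\<Prod>l\<in>{fst p..<snd p}. mps_var l)) powi eps (d (fst p)) (d (snd p))"
proof -
  have v: "(\<Prod>l\<in>{fst p..<snd p}. mps_var l) = mono_mps (pair_monomial p)"
    unfolding pair_monomial_def by (rule prod_mps_var) simp
  show ?thesis
  proof (cases "eps (d (fst p)) (d (snd p)) = 1")
    case True
    then show ?thesis by (simp add: v mults_def multiplicities_def case_prod_beta gen_fun_two[unfolded One_nat_def])
  next
    case False
    then have e: "eps (d (fst p)) (d (snd p)) = -1" by (simp add: eps_def split: if_splits)
    show ?thesis
      using gen_fun_geometric[OF pair_monomial_neq_0[OF assms]] by (simp add: e v mults_def multiplicities_def case_prod_beta)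
  qed
qed

text \<open>The first two conjuncts give the series its meaning: unique exponents justify the
  \<open>THE\<close> in \<open>exponent\<close>, and finite fibres make the \<open>card\<close> in
  \<open>S_series\<close> an honest count.\<close>

theorem theorem17:
  fixes k :: nat and d :: "nat \<Rightarrow> diamond"
  assumes "k \<ge> 1"
  shows "(\<forall>M\<in>flip_reachable k d. \<exists>!m. is_exponent k d M m) \<and>
    (\<forall>m. finite {M \<in> flip_reachable k d. exponent k d M = m}) \<and>
    S_series k d =
      (\<Prod>(i, j)\<in>{(i, j). 1 \<le> i \<and> i < j \<and> j \<le> k \<and> d i \<in> {Prec, Prec'} \<and> d j \<in> {Succ, Succ'}}.
         (1 + of_int (eps (d i) (d j)) * (\<Prod>l\<in>{i..<j}. mps_var l)) powi eps (d i) (d j))"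
proof -
  note k = assms
  have ex: "exponent k d (matching_of k d H) = config_monomial k H" if "H \<in> Config k d" for H
    unfolding exponent_def is_exponent_iff[OF k that] by simp
  have fib: "{M \<in> flip_reachable k d. exponent k d M = m} = matching_of k d ` {H \<in> Config k d. config_monomial k H = m}" for m
    unfolding flip_reachable_eq[OF k] using ex by auto
  have inj: "inj_on (matching_of k d) (Config k d)"
    using matching_of_inj[OF _ _ k] by (intro inj_onI) metis
  have fin: "finite {H \<in> Config k d. config_monomial k H = m}" for m
    using gen_fun_Config[of k d] unfolding fin_fibers_def by blast
  have 1: "\<exists>!m. is_exponent k d M m" if "M \<in> flip_reachable k d" for M
  proof -
    obtain H where "H \<in> Config k d" "M = matching_of k d H" using \<open>M \<in> flip_reachable k d\<close> unfolding flip_reachable_eq[OF k] by blast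
    then show ?thesis using is_exponent_iff[OF k] by simp
  qed
  have "card {M \<in> flip_reachable k d. exponent k d M = m} = card {H \<in> Config k d. config_monomial k H = m}" for m
    unfolding fib by (rule card_image) (rule inj_on_subset[OF inj], auto)
  then have "S_series k d = gen_fun (Config k d) (config_monomial k)"
    by (simp add: S_series_def gen_fun_def)
  also have "\<dots> = (\<Prod>p\<in>pairs k d. gen_fun (mults d p) (\<lambda>n. smul n (pair_monomial p)))"
    using gen_fun_Config by blast
  also have "\<dots> = (\<Prod>(i, j)\<in>pairs k d. (1 + of_int (eps (d i) (d j)) * (\<Prod>l\<in>{i..<j}. mps_var l)) powi eps (d i) (d j))"
    by (rule prod.cong[OF refl]) (simp add: factor_eq case_prod_beta)
  finally show ?thesis using 1 fin unfolding fib pairs_def ups_def downs_def by blast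
qed

end
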